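(* Let $1\le v\le 2$ and $0<u\le 1$. Every $(u,v)$-Furstenberg set $A\subset\mathbb{R}^2$ satisfies $$\dim_H A \ge \min(2u+v-1,\ u+1).$$ Moreover, this is sharp when $u+v\ge 2$: for $1\le v\le 2$, $0<u\le 1$ with $u+v\ge 2$, $$\inf\{\dim_H A : A \text{ is a } (u,v)\text{-Furstenberg set}\} = \min(2u+v-1,\,u+1) = u+1.$$
   Context: $\dim_H$ denotes Hausdorff dimension. A set $A\subset\mathbb{R}^2$ is called a $(u,v)$-Furstenberg set if there exists a family of lines $\mathcal{L}$ in $\mathbb{R}^2$ with $\dim_H\mathcal{L}=v$ and $\dim_H(A\cap\ell)\ge u$ for all $\ell\in\mathcal{L}$. The Hausdorff dimension of a family of lines is taken with respect to the usual metric on the 2-dimensional manifold of affine lines in $\mathbb{R}^2$ (equivalently, for non-vertical lines $y=mx+k$, the Hausdorff dimension of the set of parameters $(m,k)\in\mathbb{R}^2$). *)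

theory Defs
  imports "HOL-Analysis.Analysis"
begin

(* 0 ^ 0 = 1 on nonempty sets, so that the 0-dimensional measure is counting measure;
   powr alone would give 0 powr 0 = 0. *)
definition diam_powr :: "real \<Rightarrow> 'a::metric_space set \<Rightarrow> ennreal" where
  "diam_powr s U =
     (if U = {} then 0 else if s = 0 then 1 else ennreal (diameter U powr s))"

(* The boundedness condition is essential: on unbounded sets the value of diameter is
   meaningless. *)
definition hausdorff_premeasure :: "real \<Rightarrow> real \<Rightarrow> 'a::metric_space set \<Rightarrow> ennreal" where
  "hausdorff_premeasure s \<delta> A =
     (INF U \<in> {U :: nat \<Rightarrow> 'a set. A \<subseteq> (\<Union>i. U i) \<and> (\<forall>i. bounded (U i) \<and> diameter (U i) \<le> \<delta>)}.
        (\<Sum>i. diam_powr s (U i)))"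

definition hausdorff_outer_measure :: "real \<Rightarrow> 'a::metric_space set \<Rightarrow> ennreal" where
  "hausdorff_outer_measure s A = (SUP \<delta> \<in> {0<..}. hausdorff_premeasure s \<delta> A)"

(* The empty set gets dimension 0. *)
definition hausdorff_dim :: "'a::metric_space set \<Rightarrow> ereal" where
  "hausdorff_dim A = Inf {ereal s | s. 0 \<le> s \<and> hausdorff_outer_measure s A = 0}"


typedef line = "{l :: (real^2) set. affine l \<and> aff_dim l = 1}"
  morphisms points_of Line
proof
  let ?l = "affine hull {0, axis 1 1 :: real^2}"
  have "(0::real^2) \<noteq> axis 1 1"
    by (metis axis_eq_0_iff one_neq_zero)
  then show "?l \<in> {l. affine l \<and> aff_dim l = 1}"
    by (simp add: aff_dim_2)
qed

definition foot :: "line \<Rightarrow> real^2" where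
  "foot l = closest_point (points_of l) 0"

definition direction :: "line \<Rightarrow> (real^2) set" where
  "direction l = (\<lambda>x. x - foot l) ` points_of l"

(* Orthogonal projection onto the direction line *)
definition line_proj :: "line \<Rightarrow> real^2 \<Rightarrow> real^2" where
  "line_proj l = closest_point (direction l)"

lemma closest_point_subspace_eqI:
  fixes L :: "'a::euclidean_space set"
  assumes "subspace L" "y \<in> L" "\<And>z. z \<in> L \<Longrightarrow> (x - y) \<bullet> z = 0"
  shows "closest_point L x = y"
proof -
  have "dist x y \<le> dist x z" if "z \<in> L" for z
  proof -
    have "y - z \<in> L"
      using assms that by (simp add: subspace_diff)
    then have "(x - y) \<bullet> (y - z) = 0"
      using assms(3) by blast
    then have "(norm (x - z))\<^sup>2 = (norm (x - y))\<^sup>2 + (norm (y - z))\<^sup>2"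
      by (simp add: power2_norm_eq_inner algebra_simps inner_commute)
    then have "(norm (x - y))\<^sup>2 \<le> (norm (x - z))\<^sup>2"
      by simp
    then show ?thesis
      by (simp add: dist_norm)
  qed
  then show ?thesis
    using closest_point_unique[of L y x] assms(1,2)
    by (simp add: subspace_imp_convex closed_subspace)
qed

lemma closest_point_subspace_orthogonal:
  fixes L :: "'a::euclidean_space set"
  assumes "subspace L"
  shows "closest_point L x \<in> L" "z \<in> L \<Longrightarrow> (x - closest_point L x) \<bullet> z = 0"
proof -
  obtain y w where y: "y \<in> span L" "\<And>w'. w' \<in> span L \<Longrightarrow> orthogonal w w'" "x = y + w"
    using orthogonal_subspace_decomp_exists[of L x] by metis
  moreover have "span L = L"
    using assms by (simp add: span_eq_iff)
  ultimately have y': "y \<in> L" "\<And>w'. w' \<in> L \<Longrightarrow> (x - y) \<bullet> w' = 0"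
    by (auto simp: orthogonal_def)
  then have "closest_point L x = y"
    by (intro closest_point_subspace_eqI[OF assms]) auto
  then show "closest_point L x \<in> L" "z \<in> L \<Longrightarrow> (x - closest_point L x) \<bullet> z = 0"
    using y' by auto
qed

lemma bounded_linear_closest_point_subspace:
  fixes L :: "'a::euclidean_space set"
  assumes "subspace L"
  shows "bounded_linear (closest_point L)"
proof -
  note o = closest_point_subspace_orthogonal[OF assms]
  have "linear (closest_point L)"
  proof (rule linearI)
    fix x y
    show "closest_point L (x + y) = closest_point L x + closest_point L y"
    proof (rule closest_point_subspace_eqI[OF assms])
      show "closest_point L x + closest_point L y \<in> L"
        using o(1) assms by (simp add: subspace_add)
      show "(x + y - (closest_point L x + closest_point L y)) \<bullet> z = 0" if "z \<in> L" for z
        using o(2)[OF that, of x] o(2)[OF that, of y] by (simp add: algebra_simps)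
    qed
  next
    fix r x
    show "closest_point L (r *\<^sub>R x) = r *\<^sub>R closest_point L x"
    proof (rule closest_point_subspace_eqI[OF assms])
      show "r *\<^sub>R closest_point L x \<in> L"
        using o(1) assms by (simp add: subspace_scale)
      show "(r *\<^sub>R x - r *\<^sub>R closest_point L x) \<bullet> z = 0" if "z \<in> L" for z
        using o(2)[OF that, of x] by (simp flip: scaleR_diff_right)
    qed
  qed
  then show ?thesis
    by (rule linear_conv_bounded_linear[THEN iffD1])
qed

lemma affine_points_of: "affine (points_of l)" and points_of_nonempty: "points_of l \<noteq> {}"
  using points_of[of l] by auto

lemma foot_in: "foot l \<in> points_of l"
  unfolding foot_def
  by (intro closest_point_in_set) (auto simp: affine_points_of affine_closed points_of_nonempty)

lemma subspace_direction: "subspace (direction l)"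
proof -
  have "direction l = (\<lambda>x. - foot l + x) ` points_of l"
    by (simp add: direction_def)
  then show ?thesis
    using affine_diffs_subspace[OF affine_points_of foot_in, of l] by simp
qed

lemma points_of_eq: "points_of l = (\<lambda>x. foot l + x) ` direction l"
  by (simp add: direction_def image_image)

lemma bounded_linear_line_proj: "bounded_linear (line_proj l)"
  unfolding line_proj_def by (rule bounded_linear_closest_point_subspace[OF subspace_direction])

lemma direction_eq_range: "direction l = range (line_proj l)"
proof -
  have "closest_point (direction l) x = x" if "x \<in> direction l" for x
    using that by (rule closest_point_self)
  then show ?thesis
    using closest_point_subspace_orthogonal(1)[OF subspace_direction, of l]
    unfolding line_proj_def by (metis image_subset_iff rangeI subsetI subset_antisym)
qed

(* The standard metric on the affine Grassmannian A(2,1). *)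
instantiation line :: metric_space
begin

definition dist_line :: "line \<Rightarrow> line \<Rightarrow> real" where
  "dist l l' = onorm (\<lambda>x. line_proj l x - line_proj l' x) + norm (foot l - foot l')"

definition uniformity_line :: "(line \<times> line) filter" where
  "uniformity = (INF e\<in>{0<..}. principal {(x, y). dist (x::line) y < e})"

definition open_line :: "line set \<Rightarrow> bool" where
  "open U \<longleftrightarrow> (\<forall>x\<in>U. eventually (\<lambda>(x', y). x' = x \<longrightarrow> y \<in> U) uniformity)" for U :: "line set"

instance
proof
  fix x y z :: line
  note bl = bounded_linear_sub[OF bounded_linear_line_proj bounded_linear_line_proj]
  show "dist x y = 0 \<longleftrightarrow> x = y"
  proof
    assume "dist x y = 0"
    moreover define n where "n = onorm (\<lambda>p. line_proj x p - line_proj y p)"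
    moreover have "n \<ge> 0"
      unfolding n_def by (rule onorm_pos_le[OF bl])
    ultimately have n: "n = 0" and foot: "foot x = foot y"
      by (auto simp: dist_line_def add_nonneg_eq_0_iff)
    have "\<forall>p. line_proj x p - line_proj y p = 0"
      using n unfolding n_def by (subst (asm) onorm_eq_0[OF bl])
    then have "line_proj x = line_proj y"
      by auto
    with foot have "points_of x = points_of y"
      by (simp add: points_of_eq direction_eq_range)
    then show "x = y"
      by (simp add: points_of_inject)
  qed (simp add: dist_line_def onorm_zero)
  define f where "f = (\<lambda>p. line_proj x p - line_proj z p)"
  define g where "g = (\<lambda>p. line_proj y p - line_proj z p)"
  have fg: "bounded_linear f" "bounded_linear g"
    unfolding f_def g_def by (rule bl)+
  then have "onorm (\<lambda>p. f p + - g p) \<le> onorm f + onorm g"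
    using onorm_triangle[OF fg(1) bounded_linear_minus[OF fg(2)]] onorm_neg[of g] by linarith
  moreover have "(\<lambda>p. line_proj x p - line_proj y p) = (\<lambda>p. f p + - g p)"
    by (auto simp: f_def g_def)
  ultimately have "onorm (\<lambda>p. line_proj x p - line_proj y p) \<le> onorm f + onorm g"
    by (simp only:)
  moreover have "norm (foot x - foot y) \<le> norm (foot x - foot z) + norm (foot y - foot z)"
    using dist_triangle2[of "foot x" "foot y" "foot z"] by (simp add: dist_norm)
  ultimately show "dist x y \<le> dist x z + dist y z"
    by (simp add: dist_line_def f_def g_def)
qed (rule uniformity_line_def open_line_def)+

end


definition furstenberg :: "real \<Rightarrow> real \<Rightarrow> (real^2) set \<Rightarrow> bool" where
  "furstenberg u v A \<longleftrightarrow>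
     (\<exists>\<L> :: line set. hausdorff_dim \<L> = ereal v \<and>
        (\<forall>l\<in>\<L>. hausdorff_dim (A \<inter> points_of l) \<ge> ereal u))"

end

theory Submission
  imports Defs
begin

text \<open>
  Call a set \<open>s\<close>-null if its \<open>s\<close>-dimensional Hausdorff measure vanishes.
  For the lower bound it suffices to show (theorem \<open>null_dim_lines\<close>): if \<open>A\<close> is \<open>a\<close>-null with \<open>a < 2u + v - 1\<close> and
  \<open>u + v < 2\<close>, then the lines that meet \<open>A\<close> in a set which is not \<open>u\<close>-null form a \<open>v\<close>-null
  family. The bound \<open>u + 1\<close>, which governs \<open>u + v > 2\<close>, is the same statement with \<open>v\<close> lowered
  to \<open>2 - u\<close>. After a countable decomposition the lines are \<open>y = m x + k\<close> with \<open>\<bar>m\<bar> \<le> 1\<close>,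
  the parameters \<open>(m, k)\<close> lie in one unit square, and only \<open>0 \<le> x < 1\<close> matters
  (theorem \<open>null_dim_of_rich_lines\<close>).

  Cover \<open>A\<close> by dyadic squares with a small sum of \<open>side\<^sup>a\<close>. Two observations let each side
  length \<open>2\<^sup>-\<^sup>J\<close> be treated on its own. First, the cover may be assumed to be sparse: a square
  of side \<open>R\<close> contains at most \<open>(R/r)\<^sup>1\<^sup>+\<^sup>u\<close> of its members of side \<open>r\<close>. Otherwise one replaces
  those members by the big square, and since \<open>a \<le> 1 + u\<close> this does not increase the sum of
  \<open>side\<^sup>a\<close> (lemma \<open>regular_dyadic_cover\<close>). Second, by pigeonholing over \<open>J\<close>, a line with a large
  slice meets, for some \<open>J\<close>, about \<open>M = 2\<^bsup>J(u - \<epsilon>)\<^esup>\<close> members of side \<open>2\<^sup>-\<^sup>J\<close>. The lines selected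
  in this way for one \<open>J\<close> can be covered by parameter squares of total weight \<open>side\<^sup>v\<close> at most
  \<open>W\<close>, where \<open>W\<close> is the mass of a weight on finitely many of these lines that gives every square
  of side \<open>r\<close> mass at most \<open>r\<^sup>v\<close> (lemma \<open>dyadic_frostman\<close>).

  What remains is the incidence estimate \<open>W M\<^sup>2 \<le> C N 2\<^bsup>J(1 - v)\<^esup>\<close>, where \<open>N\<close> is the number of
  squares (theorem \<open>incidence_bound\<close>). The number of incidences is bounded by a sum over squares
  and lines of a bump of width \<open>2\<^sup>-\<^sup>J\<close> across the line, and the bump is telescoped over all scales
  \<open>2\<^sup>-\<^sup>j\<close>, \<open>j \<le> J\<close>. Every difference is a profile of mean zero across the line. Such waves along
  two transversal lines are almost orthogonal in \<open>L\<^sup>2\<close> (lemma \<open>line_pairing_bounds\<close>), so that the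
  Frostman condition on the weights bounds the \<open>L\<^sup>2\<close> norm of the weighted sum of waves
  (lemma \<open>wave_energy\<close>). A Sobolev inequality turns this into a bound for the sum over the \<open>N\<close>
  squares that loses only the number of squares in a box of side \<open>2\<^sup>-\<^sup>j\<close>, and sparsity bounds that
  number (lemma \<open>level_estimate\<close>). The resulting bounds grow geometrically in \<open>j\<close>, because
  \<open>u + v < 2\<close>, and the last one is the claim.

  For sharpness let \<open>C\<close> be a self-similar Cantor set of dimension \<open>u\<close>. The set \<open>C \<times> \<real>\<close> has
  dimension \<open>u + 1\<close>, and every line that is not vertical meets it in a bi-Lipschitz copy of \<open>C\<close>.
  A family of such lines of dimension exactly \<open>v\<close> is given by the parameters in the square of a
  Cantor set of dimension \<open>v/2\<close> (theorem \<open>furstenberg_example\<close>).\<close>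

section \<open>Sets of vanishing Hausdorff measure\<close>

text \<open>The sums are bounded over finite index sets, so that no question of summability arises.\<close>

definition cheap_cover :: "real \<Rightarrow> real \<Rightarrow> 'a::metric_space set \<Rightarrow> (nat \<Rightarrow> 'a set) \<Rightarrow> bool" where
  "cheap_cover s \<eta> X U \<longleftrightarrow> X \<subseteq> (\<Union>i. U i) \<and> (\<forall>i. bounded (U i)) \<and>
     (\<forall>F. finite F \<longrightarrow> (\<Sum>i\<in>F. diameter (U i) powr s) \<le> \<eta>)"

text \<open>For \<open>s > 0\<close> this says that the \<open>s\<close>-dimensional Hausdorff measure vanishes. No bound on the diameters
  appears, because a small sum of \<open>diameter powr s\<close> forces every diameter to be small.\<close>

definition null_dim :: "real \<Rightarrow> 'a::metric_space set \<Rightarrow> bool" where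
  "null_dim s X \<longleftrightarrow> (\<forall>\<eta>>0. \<exists>U. cheap_cover s \<eta> X U)"

lemma cheap_coverD:
  assumes "cheap_cover s \<eta> X U"
  shows "X \<subseteq> (\<Union>i. U i)" "bounded (U i)" "finite F \<Longrightarrow> (\<Sum>i\<in>F. diameter (U i) powr s) \<le> \<eta>"
  using assms unfolding cheap_cover_def by blast+

lemma cheap_coverI:
  assumes "X \<subseteq> (\<Union>i. U i)" "\<And>i. bounded (U i)" "\<And>n. (\<Sum>i<n. diameter (U i) powr s) \<le> \<eta>"
  shows "cheap_cover s \<eta> X U"
proof -
  have "(\<Sum>i\<in>F. diameter (U i) powr s) \<le> \<eta>" if F: "finite F" for F
  proof -
    obtain n where "F \<subseteq> {..<n}" using finite_nat_bounded[OF F] by blast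
    then have "(\<Sum>i\<in>F. diameter (U i) powr s) \<le> (\<Sum>i<n. diameter (U i) powr s)"
      by (intro sum_mono2) auto
    then show ?thesis using assms(3)[of n] by linarith
  qed
  then show ?thesis using assms(1,2) by (simp add: cheap_cover_def)
qed

text \<open>Covers arise below with various countable index types, for instance pairs of a level and a square.
  An injection into the natural numbers turns them into sequences, padded by empty sets.\<close>

lemma cheap_cover_countable:
  fixes X :: "'a::metric_space set" and I :: "'i::countable set"
  assumes IV: "X \<subseteq> (\<Union>i\<in>I. V i)" "\<And>i. i \<in> I \<Longrightarrow> bounded (V i)"
    "\<And>F. finite F \<Longrightarrow> F \<subseteq> I \<Longrightarrow> (\<Sum>i\<in>F. diameter (V i) powr s) \<le> \<eta>"
  shows "\<exists>U. cheap_cover s \<eta> X U"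
proof -
  define U where "U n = (if n \<in> to_nat ` I then V (from_nat n) else {})" for n
  have "X \<subseteq> (\<Union>n. U n)"
  proof
    fix x assume "x \<in> X"
    then obtain i where "i \<in> I" "x \<in> V i" using IV(1) by auto
    then have "x \<in> U (to_nat i)" by (simp add: U_def)
    then show "x \<in> (\<Union>n. U n)" by blast
  qed
  moreover have "bounded (U n)" for n
    using IV(2) by (auto simp: U_def)
  moreover have "(\<Sum>i<n. diameter (U i) powr s) \<le> \<eta>" for n
  proof -
    let ?F = "{i\<in>I. to_nat i < n}"
    have fin: "finite ?F"
      by (rule finite_imageD[of to_nat]) (auto intro: finite_subset[of _ "{..<n}"] simp: inj_on_def)
    have "(\<Sum>i<n. diameter (U i) powr s) = (\<Sum>i\<in>to_nat ` ?F. diameter (U i) powr s)"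
      by (rule sum.mono_neutral_right) (auto simp: U_def)
    also have "\<dots> = (\<Sum>i\<in>?F. diameter (V i) powr s)"
      by (subst sum.reindex) (auto simp: inj_on_def U_def)
    also have "\<dots> \<le> \<eta>" by (rule IV(3)[OF fin]) auto
    finally show ?thesis .
  qed
  ultimately show ?thesis using cheap_coverI by blast
qed

lemma null_dim_subset: "null_dim s Y \<Longrightarrow> X \<subseteq> Y \<Longrightarrow> null_dim s X"
  unfolding null_dim_def cheap_cover_def by (meson order_trans)

lemma sum_geometric_half_le:
  fixes \<eta> :: real
  assumes "\<eta> \<ge> 0" and f: "finite F"
  shows "(\<Sum>i\<in>F. \<eta> * (1/2)^(Suc i)) \<le> \<eta>"
proof -
  have s: "(\<lambda>i. (1/2)^(Suc i)) sums (1::real)" by (rule power_half_series)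
  have "(\<Sum>i\<in>F. (1/2)^(Suc i)) \<le> (1::real)"
    using sum_le_suminf[OF sums_summable[OF s] f] sums_unique[OF s] by simp
  then have "\<eta> * (\<Sum>i\<in>F. (1/2)^(Suc i)) \<le> \<eta> * 1" using assms(1) by (rule mult_left_mono)
  then show ?thesis by (simp add: sum_distrib_left)
qed

lemma null_dim_UN_nat:
  fixes X :: "nat \<Rightarrow> 'a::metric_space set"
  assumes "\<And>n. null_dim s (X n)"
  shows "null_dim s (\<Union>n. X n)"
  unfolding null_dim_def
proof (intro allI impI)
  fix \<eta> :: real assume \<eta>: "\<eta> > 0"
  have "\<forall>n. \<exists>U. cheap_cover s (\<eta> * (1/2)^(Suc n)) (X n) U"
    using assms \<eta> by (simp add: null_dim_def)
  from choice[OF this] obtain U where "\<forall>n. cheap_cover s (\<eta> * (1/2)^(Suc n)) (X n) (U n)" ..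
  then have U: "cheap_cover s (\<eta> * (1/2)^(Suc n)) (X n) (U n)" for n ..
  show "\<exists>U. cheap_cover s \<eta> (\<Union>n. X n) U"
  proof (rule cheap_cover_countable[where I = UNIV and V = "\<lambda>p. U (fst p) (snd p)"])
    show "(\<Union>n. X n) \<subseteq> (\<Union>p. U (fst p) (snd p))" using cheap_coverD(1)[OF U] by fastforce
    show "bounded (U (fst p) (snd p))" for p by (rule cheap_coverD(2)[OF U])
    fix F :: "(nat \<times> nat) set" assume F: "finite F"
    have "(\<Sum>p\<in>F. diameter (U (fst p) (snd p)) powr s) \<le>
       (\<Sum>p\<in>fst ` F \<times> snd ` F. diameter (U (fst p) (snd p)) powr s)"
      using F by (intro sum_mono2 subset_fst_snd) auto
    also have "\<dots> = (\<Sum>n\<in>fst ` F. \<Sum>i\<in>snd ` F. diameter (U n i) powr s)"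
      by (subst sum.cartesian_product) (simp add: split_def)
    also have "\<dots> \<le> (\<Sum>n\<in>fst ` F. \<eta> * (1/2)^(Suc n))"
      by (intro sum_mono cheap_coverD(3)[OF U]) (use F in auto)
    also have "\<dots> \<le> \<eta>" using \<eta> F by (intro sum_geometric_half_le) auto
    finally show "(\<Sum>p\<in>F. diameter (U (fst p) (snd p)) powr s) \<le> \<eta>" .
  qed
qed

lemma null_dim_UN:
  fixes X :: "'i::countable \<Rightarrow> 'a::metric_space set"
  assumes "\<And>i. null_dim s (X i)"
  shows "null_dim s (\<Union>i. X i)"
proof -
  have "(\<Union>i. X i) \<subseteq> (\<Union>n. X (from_nat n))"
  proof
    fix x assume "x \<in> (\<Union>i. X i)"
    then obtain i where "x \<in> X i" by blast
    then have "x \<in> X (from_nat (to_nat i))" by simp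
    then show "x \<in> (\<Union>n. X (from_nat n))" by blast
  qed
  then show ?thesis using null_dim_UN_nat[of s "\<lambda>n. X (from_nat n)"] assms null_dim_subset by blast
qed

lemma null_dim_lipschitz_image:
  fixes f :: "'a::metric_space \<Rightarrow> 'b::metric_space"
  assumes X: "null_dim s X" and s: "s > 0" and C: "C > 0"
    and lip: "\<And>x y. x \<in> X \<Longrightarrow> y \<in> X \<Longrightarrow> dist (f x) (f y) \<le> C * dist x y"
  shows "null_dim s (f ` X)"
  unfolding null_dim_def
proof (intro allI impI)
  fix \<eta> :: real assume "\<eta> > 0"
  then have "\<eta> / C powr s > 0" using C by simp
  then obtain U where U: "cheap_cover s (\<eta> / C powr s) X U"
    using X by (auto simp: null_dim_def)
  note U = cheap_coverD[OF U]
  have dd: "dist x y \<le> C * diameter (U i)" if "x \<in> f ` (U i \<inter> X)" "y \<in> f ` (U i \<inter> X)" for x y i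
  proof -
    from that obtain x' y' where xy: "x' \<in> U i" "x' \<in> X" "y' \<in> U i" "y' \<in> X" "x = f x'" "y = f y'" by blast
    then have "dist x y \<le> C * dist x' y'" using lip by blast
    also have "\<dots> \<le> C * diameter (U i)"
      using diameter_bounded_bound[OF U(2)] xy C by (intro mult_left_mono) auto
    finally show ?thesis .
  qed
  have d: "diameter (f ` (U i \<inter> X)) \<le> C * diameter (U i)" for i
  proof (cases "f ` (U i \<inter> X) = {}")
    case True
    then show ?thesis using C diameter_ge_0[OF U(2)] by (simp only: diameter_empty) simp
  next
    case False
    have "diameter (f ` (U i \<inter> X)) = (SUP (x,y) \<in> (f ` (U i \<inter> X)) \<times> (f ` (U i \<inter> X)). dist x y)"
      unfolding diameter_def using False by simp
    also have "\<dots> \<le> C * diameter (U i)"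
      by (rule cSUP_least) (use False dd in auto)
    finally show ?thesis .
  qed
  have b: "bounded (f ` (U i \<inter> X))" for i
    using dd unfolding bounded_def by metis
  have "(\<Sum>i<n. diameter (f ` (U i \<inter> X)) powr s) \<le> \<eta>" for n
  proof -
    have "(\<Sum>i<n. diameter (f ` (U i \<inter> X)) powr s) \<le> (\<Sum>i<n. (C * diameter (U i)) powr s)"
      by (intro sum_mono powr_mono2) (use s d diameter_ge_0[OF b] in auto)
    also have "\<dots> = C powr s * (\<Sum>i<n. diameter (U i) powr s)"
      using C by (simp add: sum_distrib_left powr_mult diameter_ge_0 U)
    also have "\<dots> \<le> C powr s * (\<eta> / C powr s)"
      by (intro mult_left_mono U) auto
    finally show ?thesis using C by simp
  qed
  moreover have "f ` X \<subseteq> (\<Union>i. f ` (U i \<inter> X))" using U(1) by blast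
  ultimately show "\<exists>U. cheap_cover s \<eta> (f ` X) U" using b cheap_coverI by blast
qed

lemma diam_powr_pos: "s > 0 \<Longrightarrow> diam_powr s U = ennreal (diameter U powr s)"
  by (auto simp: diam_powr_def)

lemma null_dim_imp_outer_measure_0:
  fixes X :: "'a::metric_space set"
  assumes X: "null_dim s X" and s: "s > 0"
  shows "hausdorff_outer_measure s X = 0"
proof -
  have "hausdorff_premeasure s \<delta> X = 0" if \<delta>: "\<delta> > 0" for \<delta>
  proof -
    have "hausdorff_premeasure s \<delta> X \<le> ennreal e" if e: "e > 0" for e
    proof -
      define \<eta> where "\<eta> = min e (\<delta> powr s)"
      have "\<eta> > 0" using e \<delta> by (simp add: \<eta>_def)
      then obtain U where U: "cheap_cover s \<eta> X U"
        using X by (auto simp: null_dim_def)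
      note U = cheap_coverD[OF U]
      have "diameter (U i) \<le> \<delta>" for i
      proof (rule ccontr)
        assume "\<not> diameter (U i) \<le> \<delta>"
        then have "\<delta> powr s < diameter (U i) powr s" using s \<delta> by (intro powr_less_mono2) auto
        then show False using U(3)[of "{i}"] by (simp add: \<eta>_def)
      qed
      then have "hausdorff_premeasure s \<delta> X \<le> (\<Sum>i. diam_powr s (U i))"
        unfolding hausdorff_premeasure_def using U by (intro INF_lower) auto
      also have "\<dots> = (SUP n. \<Sum>i<n. ennreal (diameter (U i) powr s))"
        by (simp add: diam_powr_pos s suminf_eq_SUP)
      also have "\<dots> = (SUP n. ennreal (\<Sum>i<n. diameter (U i) powr s))"
        by (simp add: sum_ennreal)
      also have "\<dots> \<le> ennreal e"
        by (rule SUP_least) (use U(3) in \<open>auto intro!: ennreal_leI simp: \<eta>_def\<close>)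
      finally show ?thesis .
    qed
    then show ?thesis
      by (metis bot.extremum_unique bot_ennreal ennreal_0 ennreal_le_epsilon add_0 ennreal_zero_neq_top)
  qed
  then show ?thesis
    unfolding hausdorff_outer_measure_def by (auto intro!: antisym SUP_least)
qed

text \<open>The exponent is raised because the 0-dimensional premeasure counts sets, including sets of
  diameter 0, while \<open>0 powr 0 = 0\<close> would ignore them. Covers by sets of diameter at most 1 lose nothing
  when the exponent grows.\<close>

lemma outer_measure_0_imp_null_dim:
  fixes X :: "'a::metric_space set"
  assumes X: "hausdorff_outer_measure s X = 0" and s: "0 \<le> s" "s < t"
  shows "null_dim t X"
  unfolding null_dim_def
proof (intro allI impI)
  fix \<eta> :: real assume \<eta>: "\<eta> > 0"
  define e where "e = min (1/2) \<eta>"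
  have "hausdorff_premeasure s 1 X \<le> hausdorff_outer_measure s X"
    unfolding hausdorff_outer_measure_def by (rule SUP_upper) auto
  also have "\<dots> < ennreal e" using X \<eta> by (simp add: e_def)
  finally obtain U :: "nat \<Rightarrow> 'a set" where
    U: "X \<subseteq> (\<Union>i. U i)" "\<And>i. bounded (U i)" "\<And>i. diameter (U i) \<le> 1"
       "(\<Sum>i. diam_powr s (U i)) < ennreal e"
    unfolding hausdorff_premeasure_def INF_less_iff by auto
  have le: "ennreal (diameter (U i) powr t) \<le> diam_powr s (U i)" for i
  proof (cases "U i = {}")
    case True then show ?thesis by (simp add: diam_powr_def)
  next
    case False
    have "diameter (U i) \<ge> 0" using U(2) by (rule diameter_ge_0)
    then have "diameter (U i) powr t \<le> (if s = 0 then 1 else diameter (U i) powr s)"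
      using U(3)[of i] s by (cases "diameter (U i) = 0") (auto intro: powr_mono' simp: powr_le1)
    then show ?thesis using False by (auto simp: diam_powr_def intro: ennreal_leI simp flip: ennreal_1)
  qed
  have "(\<Sum>i<n. diameter (U i) powr t) \<le> \<eta>" for n
  proof -
    have "ennreal (\<Sum>i<n. diameter (U i) powr t) = (\<Sum>i<n. ennreal (diameter (U i) powr t))"
      by (simp add: sum_ennreal)
    also have "\<dots> \<le> (\<Sum>i<n. diam_powr s (U i))" by (intro sum_mono le)
    also have "\<dots> \<le> (\<Sum>i. diam_powr s (U i))" by (rule sum_le_suminf) auto
    also have "\<dots> < ennreal e" by (rule U)
    finally have "(\<Sum>i<n. diameter (U i) powr t) \<le> e"
      using \<eta> by (subst (asm) ennreal_less_iff) (auto simp: e_def intro!: sum_nonneg)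
    then show ?thesis by (simp add: e_def)
  qed
  then show "\<exists>U. cheap_cover t \<eta> X U" using U cheap_coverI by blast
qed

lemma hausdorff_dim_less_imp_null_dim:
  assumes "hausdorff_dim X < ereal t"
  obtains s where "s < t" "null_dim s X" "0 < s"
proof -
  obtain s where s: "0 \<le> s" "hausdorff_outer_measure s X = 0" "s < t"
    using assms unfolding hausdorff_dim_def Inf_less_iff by auto
  have "null_dim ((s+t)/2) X"
    by (rule outer_measure_0_imp_null_dim[OF s(2,1)]) (use s in auto)
  then show thesis using that[of "(s+t)/2"] s by auto
qed

lemma null_dim_imp_hausdorff_dim_le: "null_dim s X \<Longrightarrow> s > 0 \<Longrightarrow> hausdorff_dim X \<le> ereal s"
  unfolding hausdorff_dim_def by (rule Inf_lower) (auto dest: null_dim_imp_outer_measure_0)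

lemma hausdorff_dim_leI:
  assumes "t \<ge> 0" "\<And>s. s > t \<Longrightarrow> null_dim s X"
  shows "hausdorff_dim X \<le> ereal t"
proof (rule ereal_le_epsilon2)
  fix e :: real assume "e > 0"
  then show "hausdorff_dim X \<le> ereal t + ereal e"
    using null_dim_imp_hausdorff_dim_le[OF assms(2)[of "t+e"]] assms(1) by simp
qed

lemma hausdorff_dim_geI:
  assumes "\<And>s. 0 < s \<Longrightarrow> s < t \<Longrightarrow> \<not> null_dim s X"
  shows "hausdorff_dim X \<ge> ereal t"
  using assms hausdorff_dim_less_imp_null_dim not_le by metis

section \<open>Dyadic squares\<close>

text \<open>Squares of one level are indexed by integer pairs. Going \<open>k\<close> levels up is integer division
  by \<open>2 ^ k\<close>, which rounds down also for negative indices.\<close>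

definition ancestor :: "nat \<Rightarrow> int \<times> int \<Rightarrow> int \<times> int" where
  "ancestor k c = (fst c div 2 ^ k, snd c div 2 ^ k)"

lemma ancestor_0 [simp]: "ancestor 0 c = c"
  by (simp add: ancestor_def)

lemma ancestor_ancestor: "ancestor a (ancestor b c) = ancestor (a + b) c"
  by (simp add: ancestor_def add.commute[of a b] power_add zdiv_zmult2_eq)

text \<open>The pair \<open>(j, c)\<close> stands for the half-open square of side \<open>2\<^sup>-\<^sup>j\<close> with index \<open>c\<close>.\<close>

type_synonym cell = "nat \<times> int \<times> int"

text \<open>Inclusion of dyadic squares.\<close>

definition below :: "cell \<Rightarrow> cell \<Rightarrow> bool" (infix "\<sqsubseteq>" 50) where
  "Q \<sqsubseteq> R \<longleftrightarrow> fst R \<le> fst Q \<and> ancestor (fst Q - fst R) (snd Q) = snd R"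

lemma below_refl [simp]: "Q \<sqsubseteq> Q"
  by (simp add: below_def)

lemma below_trans [trans]: "Q \<sqsubseteq> R \<Longrightarrow> R \<sqsubseteq> S \<Longrightarrow> Q \<sqsubseteq> S"
  using ancestor_ancestor[of "fst R - fst S" "fst Q - fst R" "snd Q"] by (auto simp: below_def)

lemma below_same_level: "Q \<sqsubseteq> R \<Longrightarrow> fst Q = fst R \<Longrightarrow> Q = R"
  by (auto simp: below_def prod_eq_iff ancestor_def)

lemma below_comparable:
  assumes "Q \<sqsubseteq> R" "Q \<sqsubseteq> S" "fst R \<le> fst S"
  shows "S \<sqsubseteq> R"
proof -
  have "snd S = ancestor (fst Q - fst S) (snd Q)" "snd R = ancestor (fst Q - fst R) (snd Q)" "fst S \<le> fst Q"
    using assms by (auto simp: below_def)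
  then show ?thesis using assms(3) ancestor_ancestor[of "fst S - fst R" "fst Q - fst S" "snd Q"] by (auto simp: below_def)
qed

abbreviation side_powr :: "real \<Rightarrow> cell \<Rightarrow> real" where
  "side_powr s Q \<equiv> 2 powr (- s * real (fst Q))"

text \<open>A heavy square is too crowded: at exponent \<open>t\<close> it is no more expensive than some of the squares
  of \<open>\<Q>\<close> inside it.\<close>

definition heavy :: "real \<Rightarrow> cell set \<Rightarrow> cell \<Rightarrow> bool" where
  "heavy t \<Q> R \<longleftrightarrow> (\<exists>F. finite F \<and> F \<subseteq> {Q\<in>\<Q>. Q \<sqsubseteq> R} \<and> side_powr t R \<le> (\<Sum>Q\<in>F. side_powr t Q))"

text \<open>The maximal heavy squares.\<close>

definition coarsen :: "real \<Rightarrow> cell set \<Rightarrow> cell set" where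
  "coarsen t \<Q> = {R. heavy t \<Q> R \<and> (\<forall>S. heavy t \<Q> S \<longrightarrow> R \<sqsubseteq> S \<longrightarrow> S = R)}"

lemma heavy_member: "Q \<in> \<Q> \<Longrightarrow> heavy t \<Q> Q"
  unfolding heavy_def by (rule exI[of _ "{Q}"]) auto

text \<open>Levels are natural numbers, so among the heavy squares around a given one there is a largest.\<close>

lemma below_coarsen:
  assumes "heavy t \<Q> Q"
  shows "\<exists>R\<in>coarsen t \<Q>. Q \<sqsubseteq> R"
proof -
  define P where "P n \<longleftrightarrow> (\<exists>R. heavy t \<Q> R \<and> Q \<sqsubseteq> R \<and> fst R = n)" for n
  have "P (fst Q)" unfolding P_def using assms by (intro exI[of _ Q]) simp
  then have "P (LEAST n. P n)" by (rule LeastI)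
  then obtain R where R: "heavy t \<Q> R" "Q \<sqsubseteq> R" "fst R = (LEAST n. P n)" unfolding P_def[of "LEAST n. P n"] by blast
  have "S = R" if S: "heavy t \<Q> S" "R \<sqsubseteq> S" for S
  proof -
    have "P (fst S)" using S R below_trans unfolding P_def by blast
    then have "fst R \<le> fst S" using R(3) by (simp add: Least_le)
    moreover have "fst S \<le> fst R" using S(2) by (simp add: below_def)
    ultimately show ?thesis using S(2) below_same_level[of R S] by simp
  qed
  then have "R \<in> coarsen t \<Q>" unfolding coarsen_def using R(1) by blast
  then show ?thesis using R(2) by blast
qed

lemma coarsen_disjoint:
  assumes "R \<in> coarsen t \<Q>" "S \<in> coarsen t \<Q>" "Q \<sqsubseteq> R" "Q \<sqsubseteq> S"
  shows "R = S"
proof (cases "fst R \<le> fst S")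
  case True
  then show ?thesis using below_comparable[OF assms(3,4)] assms(1,2) unfolding coarsen_def by blast
next
  case False
  then have "fst S \<le> fst R" by simp
  then show ?thesis using below_comparable[OF assms(4,3)] assms(1,2) unfolding coarsen_def by blast
qed

text \<open>Each new square replaces the old squares that made it heavy. At exponent \<open>t\<close> the exchange does not
  increase the sum, and at the smaller exponent \<open>a\<close> the large square is favoured even more. Different
  maximal squares are disjoint, so they do not compete for the same old squares.\<close>

lemma coarsen_sum:
  assumes \<eta>: "\<And>F. finite F \<Longrightarrow> F \<subseteq> \<Q> \<Longrightarrow> (\<Sum>Q\<in>F. side_powr a Q) \<le> \<eta>"
    and at: "a \<le> t" and G: "finite G" "G \<subseteq> coarsen t \<Q>"
  shows "(\<Sum>R\<in>G. side_powr a R) \<le> \<eta>"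
proof -
  have "\<forall>R\<in>G. \<exists>F. finite F \<and> F \<subseteq> {Q\<in>\<Q>. Q \<sqsubseteq> R} \<and> side_powr t R \<le> (\<Sum>Q\<in>F. side_powr t Q)"
    using G(2) unfolding coarsen_def heavy_def by blast
  from bchoice[OF this] obtain F where
    "\<forall>R\<in>G. finite (F R) \<and> F R \<subseteq> {Q\<in>\<Q>. Q \<sqsubseteq> R} \<and> side_powr t R \<le> (\<Sum>Q\<in>F R. side_powr t Q)" ..
  then have F: "\<And>R. R \<in> G \<Longrightarrow> finite (F R)" "\<And>R. R \<in> G \<Longrightarrow> F R \<subseteq> {Q\<in>\<Q>. Q \<sqsubseteq> R}"
    "\<And>R. R \<in> G \<Longrightarrow> side_powr t R \<le> (\<Sum>Q\<in>F R. side_powr t Q)" by simp_all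
  have "side_powr a R \<le> (\<Sum>Q\<in>F R. side_powr a Q)" if R: "R \<in> G" for R
  proof -
    \<comment> \<open>A square below \<open>R\<close> is smaller than \<open>R\<close>, so it gains at least as much as \<open>R\<close> when the exponent
      drops from \<open>t\<close> to \<open>a\<close>.\<close>
    have "side_powr a R = 2 powr ((t - a) * real (fst R)) * side_powr t R"
      by (simp add: powr_add[symmetric] algebra_simps)
    also have "\<dots> \<le> 2 powr ((t - a) * real (fst R)) * (\<Sum>Q\<in>F R. side_powr t Q)"
      using F(3)[OF R] by (intro mult_left_mono) auto
    also have "\<dots> \<le> (\<Sum>Q\<in>F R. side_powr a Q)"
      unfolding sum_distrib_left
    proof (rule sum_mono)
      fix Q assume "Q \<in> F R"
      then have "fst R \<le> fst Q" using F(2)[OF R] by (auto simp: below_def)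
      then have "(t - a) * real (fst R) \<le> (t - a) * real (fst Q)" using at by (intro mult_left_mono) auto
      then have "(t - a) * real (fst R) + - t * real (fst Q) \<le> - a * real (fst Q)"
        by (simp add: algebra_simps)
      then show "2 powr ((t - a) * real (fst R)) * side_powr t Q \<le> side_powr a Q"
        by (simp add: powr_add[symmetric])
    qed
    finally show ?thesis .
  qed
  then have "(\<Sum>R\<in>G. side_powr a R) \<le> (\<Sum>R\<in>G. \<Sum>Q\<in>F R. side_powr a Q)"
    by (rule sum_mono)
  also have "\<dots> = (\<Sum>Q\<in>(\<Union>R\<in>G. F R). side_powr a Q)"
  proof (rule sum.UNION_disjoint[symmetric])
    show "\<forall>R\<in>G. \<forall>S\<in>G. R \<noteq> S \<longrightarrow> F R \<inter> F S = {}"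
      using F(2) G(2) coarsen_disjoint by blast
  qed (use F(1) G in auto)
  also have "\<dots> \<le> \<eta>" 
  proof (rule \<eta>)
    show "finite (\<Union>R\<in>G. F R)" using F(1) G(1) by (rule finite_UN_I[rotated])
    show "(\<Union>R\<in>G. F R) \<subseteq> \<Q>" using F(2) by blast
  qed
  finally show ?thesis .
qed

text \<open>Otherwise the squares of \<open>\<Q>\<close> that make the members of \<open>G\<close> heavy would together make \<open>S\<close> heavy,
  against the maximality of the members of \<open>G\<close>.\<close>

lemma coarsen_regular:
  assumes G: "finite G" "G \<subseteq> coarsen t \<Q>" "\<And>R. R \<in> G \<Longrightarrow> R \<sqsubseteq> S \<and> R \<noteq> S"
  shows "(\<Sum>R\<in>G. side_powr t R) < side_powr t S"
proof (rule ccontr)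
  assume c: "\<not> ?thesis"
  have "\<forall>R\<in>G. \<exists>F. finite F \<and> F \<subseteq> {Q\<in>\<Q>. Q \<sqsubseteq> R} \<and> side_powr t R \<le> (\<Sum>Q\<in>F. side_powr t Q)"
    using G(2) unfolding coarsen_def heavy_def by blast
  from bchoice[OF this] obtain F where
    "\<forall>R\<in>G. finite (F R) \<and> F R \<subseteq> {Q\<in>\<Q>. Q \<sqsubseteq> R} \<and> side_powr t R \<le> (\<Sum>Q\<in>F R. side_powr t Q)" ..
  then have F: "\<And>R. R \<in> G \<Longrightarrow> finite (F R)" "\<And>R. R \<in> G \<Longrightarrow> F R \<subseteq> {Q\<in>\<Q>. Q \<sqsubseteq> R}"
    "\<And>R. R \<in> G \<Longrightarrow> side_powr t R \<le> (\<Sum>Q\<in>F R. side_powr t Q)" by simp_all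
  have "side_powr t S \<le> (\<Sum>R\<in>G. side_powr t R)" using c by simp
  also have "\<dots> \<le> (\<Sum>R\<in>G. \<Sum>Q\<in>F R. side_powr t Q)"
    by (rule sum_mono) (rule F)
  also have "\<dots> = (\<Sum>Q\<in>(\<Union>R\<in>G. F R). side_powr t Q)"
  proof (rule sum.UNION_disjoint[symmetric])
    show "\<forall>R\<in>G. \<forall>S\<in>G. R \<noteq> S \<longrightarrow> F R \<inter> F S = {}"
      using F(2) G(2) coarsen_disjoint by blast
  qed (use F(1) G in auto)
  finally have le: "side_powr t S \<le> (\<Sum>Q\<in>(\<Union>R\<in>G. F R). side_powr t Q)" .
  have "heavy t \<Q> S"
    unfolding heavy_def
  proof (rule exI[of _ "\<Union>R\<in>G. F R"], intro conjI le)
    show "finite (\<Union>R\<in>G. F R)" using F(1) G(1) by (rule finite_UN_I[rotated])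
    show "(\<Union>R\<in>G. F R) \<subseteq> {Q\<in>\<Q>. Q \<sqsubseteq> S}" using F(2) G(3) below_trans by blast
  qed
  moreover have "G \<noteq> {}" using c by auto
  then obtain R where "R \<in> G" by blast
  ultimately show False using G(2,3) unfolding coarsen_def by blast
qed

text \<open>The counting form of the previous lemma for squares of one level. The case \<open>i = J\<close> is separate, since
  there the square itself may occur.\<close>

lemma coarsen_card:
  assumes "finite D" "\<And>c. c \<in> D \<Longrightarrow> (J, c) \<in> coarsen t \<Q> \<and> ancestor (J - i) c = e" "i \<le> J"
  shows "real (card D) \<le> 2 powr (t * real (J - i))"
proof (cases "(i, e) \<in> Pair J ` D")
  case True
  then have "i = J" by auto
  then have "D \<subseteq> {e}" using assms(2) by auto
  then have "card D \<le> card {e}" by (intro card_mono) auto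
  then show ?thesis using \<open>i = J\<close> by simp
next
  case False
  have "(\<Sum>R\<in>Pair J ` D. side_powr t R) < side_powr t (i, e)"
  proof (rule coarsen_regular[of _ t \<Q>])
    show "finite (Pair J ` D)" "Pair J ` D \<subseteq> coarsen t \<Q>" using assms(1,2) by auto
    fix R assume R: "R \<in> Pair J ` D"
    then obtain c where c: "c \<in> D" "R = (J, c)" by blast
    then have "R \<sqsubseteq> (i, e)" using assms(2)[OF c(1)] assms(3) by (simp add: below_def)
    then show "R \<sqsubseteq> (i, e) \<and> R \<noteq> (i, e)" using R False by blast
  qed
  moreover have "(\<Sum>R\<in>Pair J ` D. side_powr t R) = real (card D) * 2 powr (- t * real J)"
    by (subst sum.reindex) (auto simp: inj_on_def)
  ultimately have "real (card D) * 2 powr (- t * real J) < 2 powr (- t * real i)" by simp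
  then have "real (card D) * (2 powr (- t * real J) * 2 powr (t * real J)) < 2 powr (- t * real i) * 2 powr (t * real J)"
    by (simp flip: mult.assoc)
  then show ?thesis using assms(3) by (simp add: powr_add[symmetric] of_nat_diff algebra_simps)
qed

lemma sum_UN_le:
  fixes g :: "'b \<Rightarrow> real"
  assumes "finite I" "\<And>i. i \<in> I \<Longrightarrow> finite (A i)" "\<And>x. g x \<ge> 0"
  shows "sum g (\<Union>i\<in>I. A i) \<le> (\<Sum>i\<in>I. sum g (A i))"
  using assms(1,2)
proof (induction I)
  case (insert i I)
  have "sum g (\<Union>i\<in>insert i I. A i) \<le> sum g (A i) + sum g (\<Union>i\<in>I. A i)"
    using sum_Un_nat sum.union_inter[of "A i" "\<Union>i\<in>I. A i" g] insert assms(3)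
      sum_nonneg[of "A i \<inter> (\<Union>i\<in>I. A i)" g] by auto
  then show ?case using insert by auto
qed auto

text \<open>A weight \<open>w\<close> on the squares in \<open>X\<close> below the square \<open>c\<close>, which lies \<open>d\<close> levels above them, together
  with a cover \<open>\<C>\<close> of these squares that costs no more than the mass of \<open>w\<close>. The members of \<open>\<C>\<close> carry the
  height above \<open>X\<close> as first component, and \<open>\<rho> k\<close> is both the greatest mass and the price of a square of
  height \<open>k\<close>.\<close>

definition frostman_weight ::
  "(nat \<Rightarrow> real) \<Rightarrow> (int \<times> int) set \<Rightarrow> nat \<Rightarrow> int \<times> int \<Rightarrow> (int \<times> int \<Rightarrow> real) \<Rightarrow> cell set \<Rightarrow> bool" where
  "frostman_weight \<rho> X d c w \<C> \<longleftrightarrow>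
     (\<forall>f. 0 \<le> w f \<and> (w f > 0 \<longrightarrow> f \<in> X \<and> ancestor d f = c)) \<and>
     (\<forall>k\<le>d. \<forall>e. (\<Sum>f | f \<in> X \<and> ancestor k f = e. w f) \<le> \<rho> k) \<and>
     finite \<C> \<and> (\<forall>(k,e)\<in>\<C>. k \<le> d) \<and>
     (\<forall>f\<in>X. ancestor d f = c \<longrightarrow> (\<exists>(k,e)\<in>\<C>. ancestor k f = e)) \<and>
     (\<Sum>(k,e)\<in>\<C>. \<rho> k) \<le> (\<Sum>f\<in>X. w f)"

text \<open>The finite dyadic form of Frostman's lemma, by induction on the height. The weights and covers of the
  four children are united. If the union has more mass than a square of this height may have, the weight
  is scaled down and the square itself replaces the cover.\<close>

lemma dyadic_frostman:
  fixes \<rho> :: "nat \<Rightarrow> real" and X :: "(int \<times> int) set"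
  assumes X: "finite X" and \<rho>: "\<And>k. \<rho> k > 0"
  shows "\<exists>w \<C>. frostman_weight \<rho> X d c w \<C>"
proof (induction d arbitrary: c)
  case 0
  have *: "(\<Sum>f | f \<in> X \<and> f = e. if f = c then \<rho> 0 else 0) \<le> \<rho> 0" for e
    using \<rho>[of 0] by (cases "e \<in> X") (auto simp: conj_commute cong: conj_cong)
  show ?case
  proof (cases "c \<in> X")
    case True
    then show ?thesis using X \<rho>[of 0] *
      unfolding frostman_weight_def
      by (intro exI[of _ "\<lambda>f. if f = c then \<rho> 0 else 0"] exI[of _ "{(0, c)}"]) (auto simp: less_imp_le)
  next
    case False
    then show ?thesis using X \<rho>[of 0]
      unfolding frostman_weight_def
      by (intro exI[of _ "\<lambda>f. 0"] exI[of _ "{}"]) (auto simp: less_imp_le)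
  qed
next
  case (Suc d)
  define Ch where "Ch = {e :: int \<times> int. ancestor 1 e = c}"
  have "Ch \<subseteq> {2 * fst c .. 2 * fst c + 1} \<times> {2 * snd c .. 2 * snd c + 1}"
    by (auto simp: Ch_def ancestor_def)
  then have finCh: "finite Ch" by (rule finite_subset) auto
  have "\<forall>e. \<exists>w \<C>. frostman_weight \<rho> X d e w \<C>"
    using Suc.IH by blast
  from choice[OF this] obtain w where "\<forall>e. \<exists>\<C>. frostman_weight \<rho> X d e (w e) \<C>" ..
  from choice[OF this] obtain \<C> where "\<forall>e. frostman_weight \<rho> X d e (w e) (\<C> e)" ..
  note wC = this[unfolded frostman_weight_def, rule_format]
  have w0: "\<And>e f. 0 \<le> w e f" and wsupp: "\<And>e f. w e f > 0 \<Longrightarrow> f \<in> X \<and> ancestor d f = e"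
    and wle: "\<And>e k e'. k \<le> d \<Longrightarrow> (\<Sum>f | f \<in> X \<and> ancestor k f = e'. w e f) \<le> \<rho> k"
    and finC: "\<And>e. finite (\<C> e)" and Cd: "\<And>e. \<forall>(k, e')\<in>\<C> e. k \<le> d"
    and Ccov: "\<And>e f. f \<in> X \<Longrightarrow> ancestor d f = e \<Longrightarrow> \<exists>(k,e)\<in>\<C> e. ancestor k f = e"
    and Csum: "\<And>e. (\<Sum>(k,e)\<in>\<C> e. \<rho> k) \<le> (\<Sum>f\<in>X. w e f)"
    using wC by (simp_all del: split_paired_All split_paired_Ex)
  define W where "W f = (\<Sum>e\<in>Ch. w e f)" for f
  define S where "S = (\<Sum>f\<in>X. W f)"
  have weq: "w e f = 0" if "ancestor d f \<noteq> e" for e f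
    using wsupp[of e f] w0[of e f] that by (cases "w e f > 0") auto
  have W_eq: "W f = (if ancestor d f \<in> Ch then w (ancestor d f) f else 0)" for f
  proof -
    have "W f = (\<Sum>e\<in>Ch. if ancestor d f = e then w (ancestor d f) f else 0)"
      unfolding W_def by (intro sum.cong) (auto simp: weq)
    then show ?thesis using finCh by (simp add: sum.delta')
  qed
  have upS: "ancestor (Suc d) f = c \<longleftrightarrow> ancestor d f \<in> Ch" for f
    by (simp add: Ch_def ancestor_ancestor)
  have W0: "0 \<le> W f" for f by (simp add: W_def w0 sum_nonneg)
  have Wsupp: "f \<in> X \<and> ancestor (Suc d) f = c" if "W f > 0" for f
    using that wsupp[of "ancestor d f" f] by (auto simp: W_eq upS split: if_splits)
  have Wle: "(\<Sum>f | f \<in> X \<and> ancestor k f = e. W f) \<le> \<rho> k" if k: "k \<le> d" for k e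
  proof -
    have "(\<Sum>f | f \<in> X \<and> ancestor k f = e. W f) \<le> (\<Sum>f | f \<in> X \<and> ancestor k f = e. w (ancestor (d - k) e) f)"
    proof (rule sum_mono)
      fix f assume "f \<in> {f. f \<in> X \<and> ancestor k f = e}"
      then have "ancestor d f = ancestor (d - k) e" using k by (auto simp: ancestor_ancestor)
      then show "W f \<le> w (ancestor (d - k) e) f" by (simp add: W_eq w0)
    qed
    also have "\<dots> \<le> \<rho> k" using wle[OF k] .
    finally show ?thesis .
  qed
  have S_eq: "S = (\<Sum>e\<in>Ch. \<Sum>f\<in>X. w e f)"
    unfolding S_def W_def by (rule sum.swap)
  show ?case
  proof (cases "S \<le> \<rho> (Suc d)")
    case True
    have "(\<Sum>(k,e)\<in>(\<Union>e\<in>Ch. \<C> e). \<rho> k) \<le> (\<Sum>e\<in>Ch. \<Sum>(k,e)\<in>\<C> e. \<rho> k)"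
      using finCh finC \<rho> by (intro sum_UN_le) (auto simp: less_imp_le)
    also have "\<dots> \<le> S" unfolding S_eq by (intro sum_mono Csum)
    finally have CS: "(\<Sum>(k,e)\<in>(\<Union>e\<in>Ch. \<C> e). \<rho> k) \<le> (\<Sum>f\<in>X. W f)" by (simp add: S_def)
    show ?thesis
      unfolding frostman_weight_def
    proof (intro exI[of _ W] exI[of _ "\<Union>e\<in>Ch. \<C> e"] conjI)
      show "\<forall>f. 0 \<le> W f \<and> (0 < W f \<longrightarrow> f \<in> X \<and> ancestor (Suc d) f = c)" using W0 Wsupp by blast
      show "\<forall>k\<le>Suc d. \<forall>e. (\<Sum>f | f \<in> X \<and> ancestor k f = e. W f) \<le> \<rho> k"
      proof (intro allI impI)
        fix k e assume "k \<le> Suc d"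
        show "(\<Sum>f | f \<in> X \<and> ancestor k f = e. W f) \<le> \<rho> k"
        proof (cases "k \<le> d")
          case False
          then have "k = Suc d" using \<open>k \<le> Suc d\<close> by simp
          have "(\<Sum>f | f \<in> X \<and> ancestor k f = e. W f) \<le> S"
            unfolding S_def using X W0 by (intro sum_mono2) auto
          then show ?thesis using True \<open>k = Suc d\<close> by simp
        qed (rule Wle)
      qed
      show "finite (\<Union>e\<in>Ch. \<C> e)" using finCh finC by auto
      show "\<forall>(k, e)\<in>\<Union>e\<in>Ch. \<C> e. k \<le> Suc d" using Cd by (fastforce simp: le_Suc_eq)
      show "\<forall>f\<in>X. ancestor (Suc d) f = c \<longrightarrow> (\<exists>(k, e)\<in>\<Union>e\<in>Ch. \<C> e. ancestor k f = e)"
      proof (intro ballI impI)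
        fix f assume f: "f \<in> X" "ancestor (Suc d) f = c"
        then have "ancestor d f \<in> Ch" by (simp add: upS)
        then show "\<exists>(k, e)\<in>\<Union>e\<in>Ch. \<C> e. ancestor k f = e" using Ccov[OF f(1) refl] by blast
      qed
      show "(\<Sum>(k,e)\<in>(\<Union>e\<in>Ch. \<C> e). \<rho> k) \<le> (\<Sum>f\<in>X. W f)" by (rule CS)
    qed
  next
    case False
    \<comment> \<open>The square itself is now the cheapest cover, and scaling makes its mass exactly \<open>\<rho> (Suc d)\<close>.\<close>
    define r where "r = \<rho> (Suc d) / S"
    have r: "0 < r" "r \<le> 1" "r * S = \<rho> (Suc d)" using False \<rho>[of "Suc d"] by (auto simp: r_def)
    show ?thesis
      unfolding frostman_weight_def
    proof (intro exI[of _ "\<lambda>f. r * W f"] exI[of _ "{(Suc d, c)}"] conjI)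
      show "\<forall>f. 0 \<le> r * W f \<and> (0 < r * W f \<longrightarrow> f \<in> X \<and> ancestor (Suc d) f = c)"
        using W0 Wsupp r by (auto simp: zero_less_mult_iff)
      show "\<forall>k\<le>Suc d. \<forall>e. (\<Sum>f | f \<in> X \<and> ancestor k f = e. r * W f) \<le> \<rho> k"
      proof (intro allI impI)
        fix k e assume "k \<le> Suc d"
        show "(\<Sum>f | f \<in> X \<and> ancestor k f = e. r * W f) \<le> \<rho> k"
        proof (cases "k \<le> d")
          case False
          then have "k = Suc d" using \<open>k \<le> Suc d\<close> by simp
          have "(\<Sum>f | f \<in> X \<and> ancestor k f = e. W f) \<le> S"
            unfolding S_def using X W0 by (intro sum_mono2) auto
          then have "r * (\<Sum>f | f \<in> X \<and> ancestor k f = e. W f) \<le> r * S"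
            using r by (intro mult_left_mono) auto
          then show ?thesis using r \<open>k = Suc d\<close> by (simp add: sum_distrib_left)
        next
          case True
          have "(\<Sum>f | f \<in> X \<and> ancestor k f = e. r * W f) \<le> (\<Sum>f | f \<in> X \<and> ancestor k f = e. W f)"
            by (intro sum_mono) (use r W0 in \<open>auto simp: mult_left_le_one_le\<close>)
          then show ?thesis using Wle[OF True, of e] by linarith
        qed
      qed
      show "(\<Sum>(k, e)\<in>{(Suc d, c)}. \<rho> k) \<le> (\<Sum>f\<in>X. r * W f)"
        using r by (simp add: sum_distrib_left[symmetric] S_def)
    qed auto
  qed
qed

section \<open>Almost orthogonality of waves along lines\<close>

lemma integrable_continuous_compact_support:
  fixes f :: "'a::euclidean_space \<Rightarrow> real"
  assumes "continuous_on UNIV f" "compact S" "\<And>x. x \<notin> S \<Longrightarrow> f x = 0"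
  shows "integrable lborel f"
proof -
  have "integrable lborel (\<lambda>x. indicator S x *\<^sub>R f x)"
    by (rule borel_integrable_compact[OF assms(2) continuous_on_subset[OF assms(1)]]) auto
  moreover have "(\<lambda>x. indicator S x *\<^sub>R f x) = f"
    using assms(3) by (auto simp: indicator_def fun_eq_iff)
  ultimately show ?thesis by simp
qed

lemma abs_integral_le_support:
  fixes f :: "real \<Rightarrow> real"
  assumes "integrable lborel f" "\<And>t. \<bar>f t\<bar> \<le> K" "\<And>t. t \<notin> {a..b} \<Longrightarrow> f t = 0" "a \<le> b"
  shows "\<bar>\<integral>t. f t \<partial>lborel\<bar> \<le> K * (b - a)"
proof -
  have "\<bar>\<integral>t. f t \<partial>lborel\<bar> \<le> (\<integral>t. K * indicator {a..b} t \<partial>lborel)"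
  proof (rule integral_abs_bound_integral[OF assms(1)])
    show "\<bar>f t\<bar> \<le> K * indicator {a..b} t" for t
      using assms(2)[of t] assms(3)[of t] by (auto simp: indicator_def)
    have "integrable lborel (indicat_real {a..b})"
      by (intro integrable_real_indicator) (auto simp: emeasure_lborel_Icc_eq)
    then show "integrable lborel (\<lambda>t. K * indicator {a..b} t)" by simp
  qed
  also have "\<dots> = K * (b - a)" using assms(4) by simp
  finally show ?thesis .
qed

lemma fubini_continuous_compact_support:
  fixes f :: "real \<times> real \<Rightarrow> real"
  assumes "continuous_on UNIV f" "compact S" "\<And>x. x \<notin> S \<Longrightarrow> f x = 0"
  shows "(\<integral>p. f p \<partial>lborel) = (\<integral>x. \<integral>y. f (x, y) \<partial>lborel \<partial>lborel)"
    "(\<integral>p. f p \<partial>lborel) = (\<integral>y. \<integral>x. f (x, y) \<partial>lborel \<partial>lborel)"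
    "integrable lborel (\<lambda>x. \<integral>y. f (x, y) \<partial>lborel)"
    "integrable lborel (\<lambda>y. \<integral>x. f (x, y) \<partial>lborel)"
proof -
  have i: "integrable (lborel \<Otimes>\<^sub>M lborel) (\<lambda>(x, y). f (x, y))"
    using integrable_continuous_compact_support[OF assms] by (simp add: lborel_prod)
  show "(\<integral>p. f p \<partial>lborel) = (\<integral>x. \<integral>y. f (x, y) \<partial>lborel \<partial>lborel)"
    using lborel_pair.integral_fst[OF i] by (simp add: lborel_prod)
  show "(\<integral>p. f p \<partial>lborel) = (\<integral>y. \<integral>x. f (x, y) \<partial>lborel \<partial>lborel)"
    using lborel_pair.integral_snd[OF i] by (simp add: lborel_prod)
  show "integrable lborel (\<lambda>x. \<integral>y. f (x, y) \<partial>lborel)"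
    using lborel_pair.integrable_fst[OF i] .
  show "integrable lborel (\<lambda>y. \<integral>x. f (x, y) \<partial>lborel)"
    using lborel_pair.integrable_snd[OF i] .
qed

text \<open>The cut-off in the direction of the lines. It is Lipschitz, compactly supported, and at least 1 on the
  region of the squares. A sharp cut-off would not do, since its jump spoils the cancellation for
  lines that meet near the jump.\<close>

definition tent :: "real \<Rightarrow> real" where
  "tent x = max 0 (2 - \<bar>x - 1\<bar>)"

lemma tent_bounds: "0 \<le> tent x" "tent x \<le> 2" "x \<notin> {-1..3} \<Longrightarrow> tent x = 0" "x \<in> {0..2} \<Longrightarrow> 1 \<le> tent x"
  by (auto simp: tent_def)

lemma tent_lipschitz: "\<bar>tent x - tent y\<bar> \<le> \<bar>x - y\<bar>"
  by (auto simp: tent_def)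

lemma continuous_on_tent [continuous_intros]:
  "continuous_on A f \<Longrightarrow> continuous_on A (\<lambda>x. tent (f x))"
  unfolding tent_def by (intro continuous_intros)

text \<open>The profile of a wave across a line.\<close>

definition wavelet :: "real \<Rightarrow> (real \<Rightarrow> real) \<Rightarrow> bool" where
  "wavelet K \<theta> \<longleftrightarrow> continuous_on UNIV \<theta> \<and> (\<forall>t. \<bar>\<theta> t\<bar> \<le> K) \<and> (\<forall>t. t \<notin> {-4..4} \<longrightarrow> \<theta> t = 0) \<and>
     (\<integral>t. \<theta> t \<partial>lborel) = 0"

lemma waveletD:
  assumes "wavelet K \<theta>"
  shows "continuous_on UNIV \<theta>" "\<bar>\<theta> t\<bar> \<le> K" "t \<notin> {-4..4} \<Longrightarrow> \<theta> t = 0"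
    "(\<integral>t. \<theta> t \<partial>lborel) = 0" "K \<ge> 0"
proof -
  have "\<bar>\<theta> 0\<bar> \<le> K" using assms unfolding wavelet_def by blast
  then show "K \<ge> 0" by linarith
qed (use assms in \<open>auto simp: wavelet_def\<close>)

lemma wavelet_continuous_compose:
  "wavelet K \<theta> \<Longrightarrow> continuous_on A f \<Longrightarrow> continuous_on A (\<lambda>x. \<theta> (f x))"
  using continuous_on_compose2[OF waveletD(1), of K \<theta> A f] by auto

lemma wavelet_mono: "wavelet K \<theta> \<Longrightarrow> K \<le> K' \<Longrightarrow> wavelet K' \<theta>"
  unfolding wavelet_def by (meson order_trans)

text \<open>This is the source of all cancellation. Over the support of \<open>\<theta>\<close> the argument of the tent varies only
  by \<open>O(1/\<bar>\<alpha>\<bar>)\<close>, and the constant part integrates to 0. The substitution gives the second factor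
  \<open>1/\<bar>\<alpha>\<bar>\<close>.\<close>

lemma tent_against_wavelet:
  assumes \<theta>: "wavelet K \<theta>" and \<alpha>: "\<alpha> \<noteq> 0"
  shows "\<bar>\<integral>x. tent x * \<theta> (\<alpha> * x + \<beta>) \<partial>lborel\<bar> \<le> 32 * K / \<alpha>\<^sup>2"
proof -
  note \<theta>' = waveletD[OF \<theta>]
  have int1: "integrable lborel (\<lambda>t. tent ((t - \<beta>) / \<alpha>) * \<theta> t)"
    by (rule integrable_continuous_compact_support[of _ "{-4..4}"])
       (use \<theta>' \<alpha> in \<open>auto intro!: continuous_intros\<close>)
  have int2: "integrable lborel \<theta>"
    by (rule integrable_continuous_compact_support[of _ "{-4..4}"]) (use \<theta>' in auto)
  have "(\<integral>x. tent x * \<theta> (\<alpha> * x + \<beta>) \<partial>lborel)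
      = \<bar>1/\<alpha>\<bar> *\<^sub>R (\<integral>t. tent (- \<beta>/\<alpha> + 1/\<alpha> * t) * \<theta> (\<alpha> * (- \<beta>/\<alpha> + 1/\<alpha> * t) + \<beta>) \<partial>lborel)"
    by (rule lborel_integral_real_affine) (use \<alpha> in simp)
  also have "\<dots> = \<bar>1/\<alpha>\<bar> * (\<integral>t. tent ((t - \<beta>) / \<alpha>) * \<theta> t \<partial>lborel)"
    using \<alpha> by (simp add: field_simps)
  \<comment> \<open>The mean of \<open>\<theta>\<close> vanishes, so a constant may be subtracted from the slowly varying factor.\<close>
  also have "(\<integral>t. tent ((t - \<beta>) / \<alpha>) * \<theta> t \<partial>lborel)
     = (\<integral>t. (tent ((t - \<beta>) / \<alpha>) - tent (- \<beta> / \<alpha>)) * \<theta> t \<partial>lborel)"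
    using int1 int2 \<theta>'(4) by (simp add: left_diff_distrib)
  finally have eq: "(\<integral>x. tent x * \<theta> (\<alpha> * x + \<beta>) \<partial>lborel)
      = \<bar>1/\<alpha>\<bar> * (\<integral>t. (tent ((t - \<beta>) / \<alpha>) - tent (- \<beta> / \<alpha>)) * \<theta> t \<partial>lborel)" .
  have "\<bar>\<integral>t. (tent ((t - \<beta>) / \<alpha>) - tent (- \<beta> / \<alpha>)) * \<theta> t \<partial>lborel\<bar> \<le> (4 / \<bar>\<alpha>\<bar> * K) * (4 - (-4))"
  proof (rule abs_integral_le_support)
    show "integrable lborel (\<lambda>t. (tent ((t - \<beta>) / \<alpha>) - tent (- \<beta> / \<alpha>)) * \<theta> t)"
      using int1 int2 by (simp add: left_diff_distrib)
    show "\<bar>(tent ((t - \<beta>) / \<alpha>) - tent (- \<beta> / \<alpha>)) * \<theta> t\<bar> \<le> 4 / \<bar>\<alpha>\<bar> * K" for t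
    proof (cases "t \<in> {-4..4}")
      case True
      have "\<bar>tent ((t - \<beta>) / \<alpha>) - tent (- \<beta> / \<alpha>)\<bar> \<le> \<bar>t / \<alpha>\<bar>"
        using tent_lipschitz[of "(t - \<beta>) / \<alpha>" "- \<beta> / \<alpha>"] by (simp add: diff_divide_distrib)
      also have "\<dots> \<le> 4 / \<bar>\<alpha>\<bar>" 
        unfolding abs_divide using True by (intro divide_right_mono) auto
      finally show ?thesis unfolding abs_mult using \<theta>'(2)[of t] \<theta>'(5) by (intro mult_mono) auto
    qed (use \<theta>' in simp)
  qed (use \<theta>'(3) in auto)
  then have "\<bar>1/\<alpha>\<bar> * \<bar>\<integral>t. (tent ((t - \<beta>) / \<alpha>) - tent (- \<beta> / \<alpha>)) * \<theta> t \<partial>lborel\<bar>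
     \<le> \<bar>1/\<alpha>\<bar> * ((4 / \<bar>\<alpha>\<bar> * K) * (4 - (-4)))"
    by (rule mult_left_mono) auto
  then show ?thesis unfolding eq abs_mult abs_abs
    by (simp add: power2_eq_square field_simps flip: abs_mult)
qed

text \<open>The inner product, weighted by the tent, of the waves of frequency \<open>s\<close> along the lines with slope and
  intercept \<open>l\<close> and \<open>l'\<close>.\<close>

definition line_pairing :: "(real \<Rightarrow> real) \<Rightarrow> real \<Rightarrow> real \<times> real \<Rightarrow> real \<times> real \<Rightarrow> real" where
  "line_pairing \<theta> s l l' = (\<integral>p. tent (fst p) * (\<theta> (s * (fst l * fst p + snd l - snd p))
      * \<theta> (s * (fst l' * fst p + snd l' - snd p))) \<partial>lborel)"

lemma line_wave_support:
  assumes \<theta>: "wavelet K \<theta>" and s: "s > 0"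
    and "p \<notin> {-1..3} \<times> {- (3 * \<bar>fst l\<bar> + \<bar>snd l\<bar> + 4 / s) .. 3 * \<bar>fst l\<bar> + \<bar>snd l\<bar> + 4 / s}"
  shows "tent (fst p) * (\<theta> (s * (fst l * fst p + snd l - snd p)) * c) = 0"
proof (cases "fst p \<in> {-1..3}")
  case True
  then have "\<bar>fst l * fst p\<bar> \<le> \<bar>fst l\<bar> * 3" unfolding abs_mult by (intro mult_left_mono) auto
  moreover have "\<bar>snd p\<bar> > 3 * \<bar>fst l\<bar> + \<bar>snd l\<bar> + 4 / s"
    using assms(3) True by (cases p) (auto simp: abs_if)
  ultimately have "\<bar>fst l * fst p + snd l - snd p\<bar> > 4 / s" by linarith
  then have "\<bar>s * (fst l * fst p + snd l - snd p)\<bar> > 4"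
    using s by (simp only: abs_mult) (simp add: pos_divide_less_eq mult.commute)
  then have "s * (fst l * fst p + snd l - snd p) \<notin> {-4..4}" by auto
  then show ?thesis using waveletD(3)[OF \<theta>] by simp
qed (simp add: tent_bounds)

lemma line_pairing_integrable:
  assumes \<theta>: "wavelet K \<theta>" and s: "s > 0"
  shows "integrable lborel (\<lambda>p. tent (fst p) * (\<theta> (s * (fst l * fst p + snd l - snd p))
      * \<theta> (s * (fst l' * fst p + snd l' - snd p))))"
  by (rule integrable_continuous_compact_support[OF _ _ line_wave_support[OF \<theta> s]])
     (auto intro!: continuous_intros wavelet_continuous_compose[OF \<theta>] compact_Times)

text \<open>A shear turns one of the two waves into a function of \<open>z\<close> alone. For fixed \<open>z\<close> the other one is a wave
  of frequency \<open>s * a\<close> in \<open>x\<close>, which the tent nearly annihilates. The third bound says that the waves have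
  disjoint supports when the lines stay apart over the support of the tent.\<close>

lemma line_pairing_bounds:
  fixes l l' :: "real \<times> real"
  assumes \<theta>: "wavelet K \<theta>" and s: "s > 0"
  defines "a \<equiv> fst l - fst l'" and "b \<equiv> snd l - snd l'"
  shows "\<bar>line_pairing \<theta> s l l'\<bar> \<le> 64 * K\<^sup>2 / s"
    "a \<noteq> 0 \<Longrightarrow> \<bar>line_pairing \<theta> s l l'\<bar> \<le> 256 * K\<^sup>2 / s / (s * a)\<^sup>2"
    "\<bar>b\<bar> > 3 * \<bar>a\<bar> + 8 / s \<Longrightarrow> line_pairing \<theta> s l l' = 0"
proof -
  note \<theta>' = waveletD[OF \<theta>]
  \<comment> \<open>The integrand of the pairing after the substitution \<open>y = m' x + k' - z / s\<close>.\<close>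
  define g where "g p = tent (fst p) * (\<theta> (s * (a * fst p + b) + snd p) * \<theta> (snd p))" for p :: "real \<times> real"
  have contg: "continuous_on UNIV g"
    unfolding g_def by (intro continuous_intros wavelet_continuous_compose[OF \<theta>])
  have suppg: "g p = 0" if "p \<notin> {-1..3} \<times> {-4..4}" for p
    using that by (cases p) (auto simp: g_def tent_bounds \<theta>'(3))
  have comp: "compact ({-1..3::real} \<times> {-4..4::real})" by (intro compact_Times) auto
  note fub = fubini_continuous_compact_support[OF contg comp suppg]
  have "line_pairing \<theta> s l l' = (\<integral>x. \<integral>y. tent x * (\<theta> (s * (fst l * x + snd l - y))
      * \<theta> (s * (fst l' * x + snd l' - y))) \<partial>lborel \<partial>lborel)"
    unfolding line_pairing_def
    by (subst fubini_continuous_compact_support(1)[OF _ _ line_wave_support[OF \<theta> s]])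
     (auto intro!: continuous_intros wavelet_continuous_compose[OF \<theta>] compact_Times)
  also have "\<dots> = (\<integral>x. (1/s) * (\<integral>z. g (x, z) \<partial>lborel) \<partial>lborel)"
  proof (rule Bochner_Integration.integral_cong[OF refl])
    fix x :: real
    have "(\<integral>y. tent x * (\<theta> (s * (fst l * x + snd l - y)) * \<theta> (s * (fst l' * x + snd l' - y))) \<partial>lborel)
      = \<bar>-1/s\<bar> *\<^sub>R (\<integral>z. tent x * (\<theta> (s * (fst l * x + snd l - ((fst l' * x + snd l') + -1/s * z)))
          * \<theta> (s * (fst l' * x + snd l' - ((fst l' * x + snd l') + -1/s * z)))) \<partial>lborel)"
      by (rule lborel_integral_real_affine) (use s in simp)
    also have "\<dots> = (1/s) * (\<integral>z. g (x, z) \<partial>lborel)"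
    proof -
      have "s * (fst l * x + snd l - ((fst l' * x + snd l') + -1/s * z)) = s * (a * x + b) + z" for z
        using s by (simp add: a_def b_def algebra_simps)
      moreover have "s * (fst l' * x + snd l' - ((fst l' * x + snd l') + -1/s * z)) = z" for z
        using s by simp
      ultimately show ?thesis using s by (simp only: g_def fst_conv snd_conv) simp
    qed
    finally show "(\<integral>y. tent x * (\<theta> (s * (fst l * x + snd l - y)) * \<theta> (s * (fst l' * x + snd l' - y))) \<partial>lborel)
       = (1/s) * (\<integral>z. g (x, z) \<partial>lborel)" .
  qed
  also have "\<dots> = (1/s) * (\<integral>p. g p \<partial>lborel)"
    using fub(1) by simp
  finally have eq: "line_pairing \<theta> s l l' = (1/s) * (\<integral>p. g p \<partial>lborel)" .
  have absbound: "\<bar>line_pairing \<theta> s l l'\<bar> \<le> C / s" if "\<bar>\<integral>p. g p \<partial>lborel\<bar> \<le> C" for C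
    using that s by (simp add: eq abs_mult divide_right_mono)
  have K2: "\<bar>\<theta> u * \<theta> v\<bar> \<le> K\<^sup>2" for u v
    using \<theta>' unfolding abs_mult power2_eq_square by (intro mult_mono) auto
  have g_le: "\<bar>g p\<bar> \<le> 2 * K\<^sup>2" for p
    unfolding g_def using tent_bounds[of "fst p"] K2 by (auto simp: abs_mult intro!: mult_mono)
  have int_z: "integrable lborel (\<lambda>z. g (x, z))" for x
    by (rule integrable_continuous_compact_support[of _ "{-4..4}"])
       (auto intro!: continuous_on_compose2[OF contg] continuous_intros suppg)
  have int_x: "integrable lborel (\<lambda>x. g (x, z))" for z
    by (rule integrable_continuous_compact_support[of _ "{-1..3}"])
       (auto intro!: continuous_on_compose2[OF contg] continuous_intros suppg)
  have "\<bar>\<integral>x. \<integral>z. g (x, z) \<partial>lborel \<partial>lborel\<bar> \<le> (2 * K\<^sup>2 * (4 - (-4))) * (3 - (-1))"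
  proof (rule abs_integral_le_support[OF fub(3)])
    show "\<bar>\<integral>z. g (x, z) \<partial>lborel\<bar> \<le> 2 * K\<^sup>2 * (4 - (-4))" for x
      by (rule abs_integral_le_support[OF int_z g_le]) (auto intro: suppg)
    show "(\<integral>z. g (x, z) \<partial>lborel) = 0" if "x \<notin> {-1..3}" for x
    proof -
      have "g (x, z) = 0" for z using that by (intro suppg) auto
      then show ?thesis by simp
    qed
    show "(-1::real) \<le> 3" by simp
  qed
  then show "\<bar>line_pairing \<theta> s l l'\<bar> \<le> 64 * K\<^sup>2 / s"
    by (intro absbound) (use fub(1) in simp)
  show "\<bar>line_pairing \<theta> s l l'\<bar> \<le> 256 * K\<^sup>2 / s / (s * a)\<^sup>2" if a: "a \<noteq> 0"
  proof -
    have "\<bar>\<integral>z. \<integral>x. g (x, z) \<partial>lborel \<partial>lborel\<bar> \<le> (K * (32 * K / (s * a)\<^sup>2)) * (4 - (-4))"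
    proof (rule abs_integral_le_support[OF fub(4)])
      show "\<bar>\<integral>x. g (x, z) \<partial>lborel\<bar> \<le> K * (32 * K / (s * a)\<^sup>2)" for z
      proof -
        have "(\<integral>x. g (x, z) \<partial>lborel) = (\<integral>x. \<theta> z * (tent x * \<theta> ((s * a) * x + (s * b + z))) \<partial>lborel)"
          by (simp add: g_def algebra_simps)
        also have "\<dots> = \<theta> z * (\<integral>x. tent x * \<theta> ((s * a) * x + (s * b + z)) \<partial>lborel)" by simp
        finally have "\<bar>\<integral>x. g (x, z) \<partial>lborel\<bar> = \<bar>\<theta> z\<bar> * \<bar>\<integral>x. tent x * \<theta> ((s * a) * x + (s * b + z)) \<partial>lborel\<bar>"
          by (simp only: abs_mult)
        also have "\<dots> \<le> K * (32 * K / (s * a)\<^sup>2)"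
          by (intro mult_mono tent_against_wavelet[OF \<theta>]) (use \<theta>' s a in auto)
        finally show ?thesis .
      qed
      show "(\<integral>x. g (x, z) \<partial>lborel) = 0" if "z \<notin> {-4..4}" for z
      proof -
        have "g (x, z) = 0" for x using that by (intro suppg) auto
        then show ?thesis by simp
      qed
      show "(-4::real) \<le> 4" by simp
    qed
    then have "\<bar>\<integral>p. g p \<partial>lborel\<bar> \<le> 256 * K\<^sup>2 / (s * a)\<^sup>2"
      using fub(2) by (simp add: power2_eq_square)
    from absbound[OF this] show ?thesis by (simp add: mult.commute)
  qed
  show "line_pairing \<theta> s l l' = 0" if b: "\<bar>b\<bar> > 3 * \<bar>a\<bar> + 8 / s"
  proof -
    have "g p = 0" for p
    proof (rule ccontr)
      assume ne: "g p \<noteq> 0"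
      then have p: "fst p \<in> {-1..3}" "snd p \<in> {-4..4}" using suppg[of p] by (auto simp: mem_Times_iff)
      have "s * (a * fst p + b) + snd p \<in> {-4..4}"
        using ne \<theta>'(3)[of "s * (a * fst p + b) + snd p"] by (auto simp: g_def)
      then have "\<bar>s * (a * fst p + b)\<bar> \<le> 8" using p by auto
      then have "\<bar>a * fst p + b\<bar> \<le> 8 / s"
        using s by (simp only: abs_mult) (simp add: pos_le_divide_eq mult.commute)
      moreover have "\<bar>a * fst p\<bar> \<le> \<bar>a\<bar> * 3" unfolding abs_mult using p by (intro mult_left_mono) auto
      ultimately show False using b by linarith
    qed
    then have "g = (\<lambda>p. 0)" by auto
    then show ?thesis by (simp add: eq)
  qed
qed

section \<open>The energy of a weighted family of lines\<close>

text \<open>The three bounds of the previous lemma in a form that fits dyadic Frostman conditions. The constant 11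
  is \<open>3 + 8\<close>: lines whose waves overlap and whose slopes differ by at most \<open>(1/2) ^ i\<close> have intercepts within
  \<open>3 * (1/2) ^ i + 8 / s\<close>.\<close>

lemma line_pairing_dyadic:
  assumes \<theta>: "wavelet K \<theta>" and s: "s = 2 ^ j" and a1: "\<bar>fst l - fst l'\<bar> \<le> 1"
  shows "\<bar>line_pairing \<theta> s l l'\<bar> \<le> (\<Sum>i\<le>j. 1024 * K\<^sup>2 / s * (4 ^ i / 4 ^ j) *
     of_bool (\<bar>fst l - fst l'\<bar> \<le> (1/2) ^ i \<and> \<bar>snd l - snd l'\<bar> \<le> 11 * (1/2) ^ i))"
proof -
  define a where "a = fst l - fst l'"
  define b where "b = snd l - snd l'"
  define T where "T i = 1024 * K\<^sup>2 / s * (4 ^ i / 4 ^ j) *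
     of_bool (\<bar>a\<bar> \<le> (1/2) ^ i \<and> \<bar>b\<bar> \<le> 11 * (1/2) ^ i)" for i :: nat
  have spos: "s > 0" by (simp add: s)
  have T0: "T i \<ge> 0" for i by (simp add: T_def spos less_imp_le)
  have member: "T i \<le> (\<Sum>i\<le>j. T i)" if "i \<le> j" for i
    using that T0 by (intro member_le_sum) auto
  note bounds = line_pairing_bounds[OF \<theta> spos, of l l', folded a_def b_def]
  have "\<bar>line_pairing \<theta> s l l'\<bar> \<le> (\<Sum>i\<le>j. T i)"
  proof (cases "\<bar>b\<bar> > 3 * \<bar>a\<bar> + 8 / s")
    case True
    then show ?thesis using bounds(3) T0 by (simp add: sum_nonneg)
  next
    case False
    define I where "I = {i. i \<le> j \<and> \<bar>a\<bar> \<le> (1/2) ^ i}"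
    \<comment> \<open>The finest scale not above \<open>j\<close> at which the two slopes are still indistinguishable.\<close>
    define i where "i = Max I"
    have "finite I" "0 \<in> I" using a1 by (auto simp: I_def a_def)
    then have iI: "i \<in> I" and iMax: "\<And>k. k \<in> I \<Longrightarrow> k \<le> i"
      unfolding i_def by (auto intro!: Max_in)
    have ij: "i \<le> j" and ai: "\<bar>a\<bar> \<le> (1/2) ^ i" using iI by (auto simp: I_def)
    have "8 / s = 8 * (1/2) ^ j" unfolding s power_one_over by simp
    also have "\<dots> \<le> 8 * (1/2) ^ i" using ij by (intro mult_left_mono power_decreasing) auto
    finally have bi: "\<bar>b\<bar> \<le> 11 * (1/2) ^ i" using False ai by linarith
    have Ti: "T i = 1024 * K\<^sup>2 / s * (4 ^ i / 4 ^ j)" using ai bi by (simp add: T_def)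
    have "\<bar>line_pairing \<theta> s l l'\<bar> \<le> T i"
    proof (cases "i = j")
      case True
      have "64 * K\<^sup>2 / s \<le> 1024 * K\<^sup>2 / s" using spos by (intro divide_right_mono) auto
      then show ?thesis using bounds(1) True Ti by simp
    next
      case False
      then have "Suc i \<notin> I" "Suc i \<le> j" using ij iMax[of "Suc i"] by auto
      then have "\<bar>a\<bar> > (1/2) ^ Suc i" by (auto simp: I_def)
      then have "2 ^ j * (1/2) ^ Suc i < \<bar>s * a\<bar>" by (simp add: abs_mult s)
      then have "(2 ^ j * (1/2) ^ Suc i)\<^sup>2 \<le> \<bar>s * a\<bar>\<^sup>2" by (intro power_mono) auto
      also have "(2 ^ j * (1/2) ^ Suc i :: real)\<^sup>2 = 4 ^ j / (4 * 4 ^ i)"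
      proof -
        have "(2::real) ^ j * 2 ^ j = 4 ^ j" "(2::real) ^ i * 2 ^ i = 4 ^ i"
          by (simp_all flip: power_mult_distrib)
        then show ?thesis by (simp add: power2_eq_square power_one_over field_simps)
      qed
      finally have lb: "4 ^ j / (4 * 4 ^ i) \<le> (s * a)\<^sup>2" by simp
      have "a \<noteq> 0" using \<open>\<bar>a\<bar> > (1/2) ^ Suc i\<close> by auto
      then have "\<bar>line_pairing \<theta> s l l'\<bar> \<le> 256 * K\<^sup>2 / s / (s * a)\<^sup>2" by (rule bounds(2))
      also have "\<dots> \<le> 256 * K\<^sup>2 / s / (4 ^ j / (4 * 4 ^ i))"
        using lb spos \<open>a \<noteq> 0\<close> by (intro divide_left_mono mult_pos_pos) auto
      also have "\<dots> = T i" by (simp add: Ti)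
      finally show ?thesis .
    qed
    also have "\<dots> \<le> (\<Sum>i\<le>j. T i)" using ij by (rule member)
    finally show ?thesis .
  qed
  then show ?thesis by (simp only: T_def a_def b_def)
qed

definition wave_sum :: "(real \<times> real) set \<Rightarrow> (real \<times> real \<Rightarrow> real) \<Rightarrow> (real \<Rightarrow> real) \<Rightarrow> real \<Rightarrow> real \<times> real \<Rightarrow> real" where
  "wave_sum L a \<theta> s p = (\<Sum>l\<in>L. a l * \<theta> (s * (fst l * fst p + snd l - snd p)))"

lemma wave_sum_square:
  "tent (fst p) * (wave_sum L a \<theta> s p)\<^sup>2 = (\<Sum>l\<in>L. \<Sum>l'\<in>L. a l * a l' *
     (tent (fst p) * (\<theta> (s * (fst l * fst p + snd l - snd p)) * \<theta> (s * (fst l' * fst p + snd l' - snd p)))))"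
  unfolding wave_sum_def power2_eq_square
  unfolding sum_product
  unfolding sum_distrib_left
  by (intro sum.cong refl) (simp only: mult_ac)

lemma wave_sum_square_integrable:
  assumes "wavelet K \<theta>" "s > 0"
  shows "integrable lborel (\<lambda>p. tent (fst p) * (wave_sum L a \<theta> s p)\<^sup>2)"
  unfolding wave_sum_square
  by (intro Bochner_Integration.integrable_sum integrable_mult_right line_pairing_integrable[OF assms])

lemma geometric_sum_rev_le:
  fixes q :: real
  assumes "0 \<le> q" "q < 1"
  shows "(\<Sum>i\<le>j. q ^ (j - i)) \<le> 1 / (1 - q)"
proof -
  have "(\<Sum>i\<le>j. q ^ (j - i)) = (\<Sum>i\<le>j. q ^ i)"
    by (rule sum.reindex_bij_witness[of _ "\<lambda>i. j - i" "\<lambda>i. j - i"]) auto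
  also have "\<dots> \<le> (\<Sum>i. q ^ i)"
    using assms by (intro sum_le_suminf summable_geometric) auto
  also have "\<dots> = 1 / (1 - q)" using assms by (simp add: suminf_geometric)
  finally show ?thesis .
qed

text \<open>Schur's test for the matrix of pairings. The lines within distance \<open>2\<^sup>-\<^sup>i\<close> of a given one have mass at
  most \<open>A 2\<^bsup>-vi\<^esup>\<close>, and their pairings are of order \<open>4\<^bsup>i-j\<^esup> / s\<close>. Since \<open>v < 2\<close>, the sum over \<open>i\<close> is
  dominated by the nearly equal lines, \<open>i = j\<close>.\<close>

lemma wave_energy:
  assumes \<theta>: "wavelet K \<theta>" and s: "s = 2 ^ j" and L: "finite L" and v: "v < 2"
    and a: "\<And>l. l \<in> L \<Longrightarrow> \<bar>a l\<bar> \<le> w l"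
    and slope: "\<And>l l'. l \<in> L \<Longrightarrow> l' \<in> L \<Longrightarrow> \<bar>fst l - fst l'\<bar> \<le> 1"
    and frost: "\<And>l i. l \<in> L \<Longrightarrow> i \<le> j \<Longrightarrow>
      (\<Sum>l' | l' \<in> L \<and> \<bar>fst l - fst l'\<bar> \<le> (1/2) ^ i \<and> \<bar>snd l - snd l'\<bar> \<le> 11 * (1/2) ^ i. w l')
        \<le> A * 2 powr (- v * real i)"
  shows "(\<integral>p. tent (fst p) * (wave_sum L a \<theta> s p)\<^sup>2 \<partial>lborel)
     \<le> 1024 * K\<^sup>2 * A / (1 - 2 powr (v - 2)) * (\<Sum>l\<in>L. w l) * 2 powr (- (1 + v) * real j)"
proof -
  have spos: "s > 0" by (simp add: s)
  define q where "q = 2 powr (v - 2)"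
  have q: "0 < q" "q < 1" using v powr_less_mono[of "v - 2" 0 2] by (auto simp: q_def)
  define P where "P i l l' \<longleftrightarrow> \<bar>fst l - fst l'\<bar> \<le> (1/2) ^ i \<and> \<bar>snd l - snd l'\<bar> \<le> 11 * (1/2) ^ i"
    for i :: nat and l l' :: "real \<times> real"
  define c where "c = 1024 * K\<^sup>2 / s"
  have c: "c \<ge> 0" using spos by (simp add: c_def)
  have w0: "0 \<le> w l" if "l \<in> L" for l using a[OF that] by linarith
  have A0: "L = {} \<or> 0 \<le> A"
  proof (cases "L = {}")
    case False
    then obtain l where "l \<in> L" by blast
    have "0 \<le> (\<Sum>l' | l' \<in> L \<and> \<bar>fst l - fst l'\<bar> \<le> (1/2) ^ 0 \<and> \<bar>snd l - snd l'\<bar> \<le> 11 * (1/2) ^ 0. w l')"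
      using w0 by (intro sum_nonneg) auto
    also have "\<dots> \<le> A" using frost[OF \<open>l \<in> L\<close>, of 0] by simp
    finally show ?thesis by simp
  qed simp
  have "(\<integral>p. tent (fst p) * (wave_sum L a \<theta> s p)\<^sup>2 \<partial>lborel)
     = (\<Sum>l\<in>L. \<Sum>l'\<in>L. a l * a l' * line_pairing \<theta> s l l')"
    unfolding wave_sum_square line_pairing_def
    by (simp add: Bochner_Integration.integral_sum Bochner_Integration.integrable_sum
         line_pairing_integrable[OF \<theta> spos])
  also have "\<dots> \<le> (\<Sum>l\<in>L. \<Sum>l'\<in>L. w l * w l' * (\<Sum>i\<le>j. c * (4 ^ i / 4 ^ j) * of_bool (P i l l')))"
  proof (intro sum_mono)
    fix l l' assume l: "l \<in> L" "l' \<in> L"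
    have "a l * a l' * line_pairing \<theta> s l l' \<le> \<bar>a l\<bar> * \<bar>a l'\<bar> * \<bar>line_pairing \<theta> s l l'\<bar>"
      by (metis abs_ge_self abs_mult)
    also have "\<dots> \<le> w l * w l' * (\<Sum>i\<le>j. c * (4 ^ i / 4 ^ j) * of_bool (P i l l'))"
      using line_pairing_dyadic[OF \<theta> s slope[OF l]] a l w0
      by (intro mult_mono) (auto simp: c_def P_def)
    finally show "a l * a l' * line_pairing \<theta> s l l' \<le> w l * w l' * (\<Sum>i\<le>j. c * (4 ^ i / 4 ^ j) * of_bool (P i l l'))" .
  qed
  also have "\<dots> = (\<Sum>l\<in>L. w l * (\<Sum>i\<le>j. c * (4 ^ i / 4 ^ j) * (\<Sum>l'\<in>L. w l' * of_bool (P i l l'))))"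
  proof (rule sum.cong[OF refl])
    fix l
    have "(\<Sum>l'\<in>L. w l * w l' * (\<Sum>i\<le>j. c * (4 ^ i / 4 ^ j) * of_bool (P i l l')))
       = (\<Sum>l'\<in>L. \<Sum>i\<le>j. w l * (c * (4 ^ i / 4 ^ j) * (w l' * of_bool (P i l l'))))"
      unfolding sum_distrib_left by (intro sum.cong refl) (simp only: mult_ac)
    also have "\<dots> = (\<Sum>i\<le>j. \<Sum>l'\<in>L. w l * (c * (4 ^ i / 4 ^ j) * (w l' * of_bool (P i l l'))))"
      by (rule sum.swap)
    finally show "(\<Sum>l'\<in>L. w l * w l' * (\<Sum>i\<le>j. c * (4 ^ i / 4 ^ j) * of_bool (P i l l')))
      = w l * (\<Sum>i\<le>j. c * (4 ^ i / 4 ^ j) * (\<Sum>l'\<in>L. w l' * of_bool (P i l l')))"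
      by (simp only: sum_distrib_left)
  qed
  also have "\<dots> \<le> (\<Sum>l\<in>L. w l * (c * A * 2 powr (- v * real j) * (1 / (1 - q))))"
  proof (intro sum_mono mult_left_mono w0)
    fix l assume l: "l \<in> L"
    have A: "0 \<le> A" using A0 l by auto
    have "(\<Sum>i\<le>j. c * (4 ^ i / 4 ^ j) * (\<Sum>l'\<in>L. w l' * of_bool (P i l l')))
        \<le> (\<Sum>i\<le>j. c * A * 2 powr (- v * real j) * q ^ (j - i))"
    proof (rule sum_mono)
      fix i assume i: "i \<in> {..j}"
      have "(\<Sum>l'\<in>L. w l' * of_bool (P i l l')) = (\<Sum>l' | l' \<in> L \<and> P i l l'. w l')"
        unfolding sum.inter_filter[OF L] by (intro sum.cong refl) auto
      also have "\<dots> \<le> A * 2 powr (- v * real i)"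
        using frost[OF l, of i] i by (simp add: P_def)
      finally have "c * (4 ^ i / 4 ^ j) * (\<Sum>l'\<in>L. w l' * of_bool (P i l l'))
         \<le> c * (4 ^ i / 4 ^ j) * (A * 2 powr (- v * real i))"
        using c by (intro mult_left_mono) auto
      also have "\<dots> = c * A * ((4 ^ i / 4 ^ j) * 2 powr (- v * real i))" by simp
      also have "(4 ^ i / 4 ^ j) * 2 powr (- v * real i) = 2 powr (- v * real j) * q ^ (j - i)"
      proof -
        have "(4::real) ^ k = 2 powr (2 * real k)" for k
          by (simp add: powr_powr[symmetric] powr_realpow)
        moreover have "q ^ (j - i) = 2 powr ((v - 2) * real (j - i))"
          by (simp add: q_def powr_realpow[symmetric] powr_powr)
        ultimately show ?thesis using i
          by (simp add: powr_diff[symmetric] powr_add[symmetric] of_nat_diff algebra_simps)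
      qed
      finally show "c * (4 ^ i / 4 ^ j) * (\<Sum>l'\<in>L. w l' * of_bool (P i l l'))
         \<le> c * A * 2 powr (- v * real j) * q ^ (j - i)" by simp
    qed
    also have "\<dots> \<le> c * A * 2 powr (- v * real j) * (1 / (1 - q))"
      unfolding sum_distrib_left[symmetric]
      using c A q by (intro mult_left_mono geometric_sum_rev_le) auto
    finally show "(\<Sum>i\<le>j. c * (4 ^ i / 4 ^ j) * (\<Sum>l'\<in>L. w l' * of_bool (P i l l')))
       \<le> c * A * 2 powr (- v * real j) * (1 / (1 - q))" .
  qed
  also have "\<dots> = (\<Sum>l\<in>L. w l) * (c * A * 2 powr (- v * real j) * (1 / (1 - q)))"
    by (simp only: sum_distrib_right)
  also have "\<dots> = 1024 * K\<^sup>2 * A / (1 - q) * (\<Sum>l\<in>L. w l) * 2 powr (- (1 + v) * real j)"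
  proof -
    have "- (1 + v) * real j = - v * real j - real j" by (simp add: algebra_simps)
    then have "2 powr (- (1 + v) * real j) = 2 powr (- v * real j) / s"
      by (simp only: powr_diff) (simp add: s powr_realpow)
    then show ?thesis by (simp add: c_def mult_ac)
  qed
  finally show ?thesis by (simp add: q_def)
qed

text \<open>Fundamental theorem of calculus for the square of \<open>f\<close> times a linear cut-off, followed by
  \<open>2xy \<le> x\<^sup>2/L + L y\<^sup>2\<close>.\<close>

lemma sobolev_1d:
  fixes f f' :: "real \<Rightarrow> real"
  assumes f: "\<And>x. (f has_real_derivative f' x) (at x)" and f': "continuous_on UNIV f'" and L: "L > 0"
  shows "(f p)\<^sup>2 \<le> (\<integral>x. indicator {p..p+L} x * (2 / L * (f x)\<^sup>2 + L * (f' x)\<^sup>2) \<partial>lborel)"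
proof -
  have cf: "continuous_on UNIV f" using f DERIV_continuous_on by blast
  \<comment> \<open>A primitive that equals \<open>-(f p)\<^sup>2\<close> at \<open>p\<close> and vanishes at \<open>p + L\<close>.\<close>
  define G where "G t = - (1 - (t - p) / L) * (f t)\<^sup>2" for t
  define g where "g t = (f t)\<^sup>2 / L - (1 - (t - p) / L) * (2 * f t * f' t)" for t
  have DG: "DERIV G x :> g x" for x
    unfolding G_def g_def using L
    by (auto intro!: derivative_eq_intros f simp: field_simps)
  have cg: "isCont g x" for x
    unfolding g_def using cf f' L by (intro continuous_intros) (auto simp: continuous_on_eq_continuous_at)
  have "has_bochner_integral lborel (\<lambda>x. g x * indicator {p..p+L} x) (G (p + L) - G p)"
    by (rule has_bochner_integral_FTC_Icc_real) (use L DG cg in auto)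
  then have eq: "(f p)\<^sup>2 = (\<integral>x. g x * indicator {p..p+L} x \<partial>lborel)" and
    ig: "integrable lborel (\<lambda>x. g x * indicator {p..p+L} x)"
    using L by (auto simp: has_bochner_integral_iff G_def)
  show ?thesis unfolding eq
  proof (rule integral_mono[OF ig])
    have "integrable lborel (\<lambda>x. indicator {p..p+L} x *\<^sub>R (2 / L * (f x)\<^sup>2 + L * (f' x)\<^sup>2))"
      by (rule borel_integrable_compact)
        (use L in \<open>auto intro!: continuous_intros continuous_on_subset[OF cf] continuous_on_subset[OF f']\<close>)
    then show "integrable lborel (\<lambda>x. indicator {p..p+L} x * (2 / L * (f x)\<^sup>2 + L * (f' x)\<^sup>2))" by simp
    fix x
    show "g x * indicator {p..p+L} x \<le> indicator {p..p+L} x * (2 / L * (f x)\<^sup>2 + L * (f' x)\<^sup>2)"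
    proof (cases "x \<in> {p..p+L}")
      case True
      define c where "c = 1 - (x - p) / L"
      have c: "0 \<le> c" "c \<le> 1" using True L by (auto simp: c_def field_simps)
      have "- (c * (2 * f x * f' x)) \<le> \<bar>c * (2 * f x * f' x)\<bar>" by linarith
      also have "\<dots> \<le> 1 * \<bar>2 * f x * f' x\<bar>" unfolding abs_mult[of c] using c by (intro mult_right_mono) auto
      also have "\<dots> \<le> (f x)\<^sup>2 / L + L * (f' x)\<^sup>2"
      proof -
        have "0 \<le> (\<bar>f x\<bar> - L * \<bar>f' x\<bar>)\<^sup>2 / L" using L by simp
        also have "\<dots> = (f x)\<^sup>2 / L + L * (f' x)\<^sup>2 - 2 * \<bar>f x\<bar> * \<bar>f' x\<bar>"
          using L by (simp add: power2_eq_square field_simps)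
        finally show ?thesis by (simp add: abs_mult)
      qed
      finally have "g x \<le> 2 / L * (f x)\<^sup>2 + L * (f' x)\<^sup>2" by (simp add: g_def c_def)
      then show ?thesis using True by simp
    qed simp
  qed
qed

text \<open>The one-dimensional inequality is applied in \<open>x\<close>, and then in \<open>y\<close> to \<open>F\<close> and to its \<open>x\<close>-derivative.\<close>

lemma sobolev_2d:
  fixes F Fx Fy Fxy :: "real \<Rightarrow> real \<Rightarrow> real"
  assumes dx: "\<And>x y. ((\<lambda>x. F x y) has_real_derivative Fx x y) (at x)"
    and dy: "\<And>x y. ((\<lambda>y. F x y) has_real_derivative Fy x y) (at y)"
    and dxy: "\<And>x y. ((\<lambda>y. Fx x y) has_real_derivative Fxy x y) (at y)"
    and cont: "continuous_on UNIV (\<lambda>p. F (fst p) (snd p))" "continuous_on UNIV (\<lambda>p. Fx (fst p) (snd p))"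
      "continuous_on UNIV (\<lambda>p. Fy (fst p) (snd p))" "continuous_on UNIV (\<lambda>p. Fxy (fst p) (snd p))"
    and L: "L > 0"
  defines "\<Phi> \<equiv> \<lambda>p. 4 / L\<^sup>2 * (F (fst p) (snd p))\<^sup>2 + 2 * (Fy (fst p) (snd p))\<^sup>2
      + 2 * (Fx (fst p) (snd p))\<^sup>2 + L\<^sup>2 * (Fxy (fst p) (snd p))\<^sup>2"
  shows "(F p q)\<^sup>2 \<le> (\<integral>z. indicator ({p..p+L} \<times> {q..q+L}) z * \<Phi> z \<partial>lborel)"
    "integrable lborel (\<lambda>z. indicator ({p..p+L} \<times> {q..q+L}) z * \<Phi> z)"
proof -
  have c\<Phi>: "continuous_on UNIV \<Phi>" unfolding \<Phi>_def by (intro continuous_intros cont) (use L in auto)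
  have sec: "continuous_on UNIV (\<lambda>x. H x y)" "continuous_on UNIV (\<lambda>y. H x y)"
    if "continuous_on UNIV (\<lambda>p. H (fst p) (snd p))" for H :: "real \<Rightarrow> real \<Rightarrow> real" and x y
  proof -
    have "continuous_on UNIV (\<lambda>t. (\<lambda>p. H (fst p) (snd p)) (t, y))"
      by (rule continuous_on_compose2[OF that]) (intro continuous_intros, simp)
    then show "continuous_on UNIV (\<lambda>x. H x y)" by simp
    have "continuous_on UNIV (\<lambda>t. (\<lambda>p. H (fst p) (snd p)) (x, t))"
      by (rule continuous_on_compose2[OF that]) (intro continuous_intros, simp)
    then show "continuous_on UNIV (\<lambda>y. H x y)" by simp
  qed
  have "integrable lborel (\<lambda>z. indicator ({p..p+L} \<times> {q..q+L}) z *\<^sub>R \<Phi> z)"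
    by (rule borel_integrable_compact) (auto intro!: compact_Times continuous_on_subset[OF c\<Phi>])
  then show int: "integrable lborel (\<lambda>z. indicator ({p..p+L} \<times> {q..q+L}) z * \<Phi> z)" by simp
  have i: "integrable (lborel \<Otimes>\<^sub>M lborel) (\<lambda>(x, y). indicator ({p..p+L} \<times> {q..q+L}) (x, y) * \<Phi> (x, y))"
    using int by (simp add: lborel_prod split_def)
  have int1: "integrable lborel (\<lambda>x. indicator {a..a+L} x * h x)" if "continuous_on UNIV h" for a and h :: "real \<Rightarrow> real"
  proof -
    have "integrable lborel (\<lambda>x. indicator {a..a+L} x *\<^sub>R h x)"
      by (rule borel_integrable_compact) (auto intro!: continuous_on_subset[OF that])
    then show ?thesis by simp
  qed
  have "(F p q)\<^sup>2 \<le> (\<integral>x. indicator {p..p+L} x * (2 / L * (F x q)\<^sup>2 + L * (Fx x q)\<^sup>2) \<partial>lborel)"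
    by (rule sobolev_1d[OF dx sec(1)[OF cont(2)] L])
  also have "\<dots> \<le> (\<integral>x. \<integral>y. indicator ({p..p+L} \<times> {q..q+L}) (x, y) * \<Phi> (x, y) \<partial>lborel \<partial>lborel)"
  proof (rule integral_mono)
    show "integrable lborel (\<lambda>x. indicator {p..p+L} x * (2 / L * (F x q)\<^sup>2 + L * (Fx x q)\<^sup>2))"
      by (rule int1, intro continuous_intros sec cont) (use L in auto)
    show "integrable lborel (\<lambda>x. \<integral>y. indicator ({p..p+L} \<times> {q..q+L}) (x, y) * \<Phi> (x, y) \<partial>lborel)"
      using lborel_pair.integrable_fst[OF i] .
    fix x
    have "2 / L * (F x q)\<^sup>2 + L * (Fx x q)\<^sup>2 \<le>
       2 / L * (\<integral>y. indicator {q..q+L} y * (2 / L * (F x y)\<^sup>2 + L * (Fy x y)\<^sup>2) \<partial>lborel)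
       + L * (\<integral>y. indicator {q..q+L} y * (2 / L * (Fx x y)\<^sup>2 + L * (Fxy x y)\<^sup>2) \<partial>lborel)"
      using L by (intro add_mono mult_left_mono sobolev_1d dy dxy sec cont) auto
    also have "\<dots> = (\<integral>y. 2 / L * (indicator {q..q+L} y * (2 / L * (F x y)\<^sup>2 + L * (Fy x y)\<^sup>2))
       + L * (indicator {q..q+L} y * (2 / L * (Fx x y)\<^sup>2 + L * (Fxy x y)\<^sup>2)) \<partial>lborel)"
      by (subst Bochner_Integration.integral_add)
         (auto intro!: integrable_mult_right int1 continuous_intros sec cont simp del: integrable_mult_left_iff)
    also have "\<dots> = (\<integral>y. indicator {q..q+L} y * \<Phi> (x, y) \<partial>lborel)"
      using L by (intro Bochner_Integration.integral_cong refl)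
        (auto simp: \<Phi>_def power2_eq_square field_simps indicator_def)
    finally have "2 / L * (F x q)\<^sup>2 + L * (Fx x q)\<^sup>2 \<le> (\<integral>y. indicator {q..q+L} y * \<Phi> (x, y) \<partial>lborel)" .
    then show "indicator {p..p+L} x * (2 / L * (F x q)\<^sup>2 + L * (Fx x q)\<^sup>2)
       \<le> (\<integral>y. indicator ({p..p+L} \<times> {q..q+L}) (x, y) * \<Phi> (x, y) \<partial>lborel)"
      by (cases "x \<in> {p..p+L}") (auto simp: indicator_times)
  qed
  also have "\<dots> = (\<integral>z. indicator ({p..p+L} \<times> {q..q+L}) z * \<Phi> z \<partial>lborel)"
    using lborel_pair.integral_fst[OF i] by (simp add: lborel_prod split_def)
  finally show "(F p q)\<^sup>2 \<le> (\<integral>z. indicator ({p..p+L} \<times> {q..q+L}) z * \<Phi> z \<partial>lborel)" .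
qed

text \<open>The boxes that start at the points \<open>z c\<close> overlap at most \<open>n\<close> times, and the tent is at least 1 on all of
  them because \<open>L \<le> 1\<close>.\<close>

lemma sum_squares_le_sobolev:
  fixes F Fx Fy Fxy :: "real \<Rightarrow> real \<Rightarrow> real"
  assumes dx: "\<And>x y. ((\<lambda>x. F x y) has_real_derivative Fx x y) (at x)"
    and dy: "\<And>x y. ((\<lambda>y. F x y) has_real_derivative Fy x y) (at y)"
    and dxy: "\<And>x y. ((\<lambda>y. Fx x y) has_real_derivative Fxy x y) (at y)"
    and cont: "continuous_on UNIV (\<lambda>p. F (fst p) (snd p))" "continuous_on UNIV (\<lambda>p. Fx (fst p) (snd p))"
      "continuous_on UNIV (\<lambda>p. Fy (fst p) (snd p))" "continuous_on UNIV (\<lambda>p. Fxy (fst p) (snd p))"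
    and L: "0 < L" "L \<le> 1"
    and \<Phi>: "\<Phi> = (\<lambda>p. 4 / L\<^sup>2 * (F (fst p) (snd p))\<^sup>2 + 2 * (Fy (fst p) (snd p))\<^sup>2
      + 2 * (Fx (fst p) (snd p))\<^sup>2 + L\<^sup>2 * (Fxy (fst p) (snd p))\<^sup>2)"
    and int: "integrable lborel (\<lambda>p. tent (fst p) * \<Phi> p)"
    and D: "finite D" "\<And>c. c \<in> D \<Longrightarrow> fst (z c) \<in> {0..1}"
    and n: "\<And>x y. real (card {c\<in>D. x \<in> {fst (z c)..fst (z c) + L} \<and> y \<in> {snd (z c)..snd (z c) + L}}) \<le> n"
  shows "(\<Sum>c\<in>D. (F (fst (z c)) (snd (z c)))\<^sup>2) \<le> n * (\<integral>p. tent (fst p) * \<Phi> p \<partial>lborel)"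
proof -
  define B where "B c = {fst (z c)..fst (z c) + L} \<times> {snd (z c)..snd (z c) + L}" for c
  have sob: "(F p q)\<^sup>2 \<le> (\<integral>z. indicator ({p..p+L} \<times> {q..q+L}) z * \<Phi> z \<partial>lborel)"
    "integrable lborel (\<lambda>z. indicator ({p..p+L} \<times> {q..q+L}) z * \<Phi> z)" for p q
    unfolding \<Phi> by (rule sobolev_2d[OF dx dy dxy cont L(1)])+
  have \<Phi>0: "\<Phi> p \<ge> 0" for p by (simp add: \<Phi>)
  have n0: "n \<ge> 0" using n[of 0 0] by linarith
  have "(\<Sum>c\<in>D. (F (fst (z c)) (snd (z c)))\<^sup>2) \<le> (\<Sum>c\<in>D. \<integral>p. indicator (B c) p * \<Phi> p \<partial>lborel)"
    unfolding B_def by (intro sum_mono sob)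
  also have "\<dots> = (\<integral>p. (\<Sum>c\<in>D. indicator (B c) p * \<Phi> p) \<partial>lborel)"
    unfolding B_def by (rule Bochner_Integration.integral_sum[symmetric]) (rule sob)
  also have "\<dots> \<le> (\<integral>p. n * (tent (fst p) * \<Phi> p) \<partial>lborel)"
  proof (rule integral_mono)
    show "integrable lborel (\<lambda>p. \<Sum>c\<in>D. indicator (B c) p * \<Phi> p)"
      unfolding B_def by (rule Bochner_Integration.integrable_sum) (rule sob)
    show "integrable lborel (\<lambda>p. n * (tent (fst p) * \<Phi> p))" using int by simp
    fix p :: "real \<times> real"
    have "(\<Sum>c\<in>D. indicator (B c) p * \<Phi> p) = real (card {c\<in>D. p \<in> B c}) * \<Phi> p"
      using D(1) by (simp add: sum_distrib_right[symmetric] indicator_def of_bool_def sum.If_cases Int_def)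
    also have "\<dots> \<le> n * (tent (fst p) * \<Phi> p)"
    proof (cases "{c\<in>D. p \<in> B c} = {}")
      case True
      show ?thesis unfolding True using n0 \<Phi>0[of p] tent_bounds(1)[of "fst p"] by simp
    next
      case False
      then obtain c where "c \<in> D" "p \<in> B c" by blast
      then have "fst p \<in> {0..2}" using D(2)[of c] L by (auto simp: B_def)
      then have "1 \<le> tent (fst p)" by (rule tent_bounds)
      then have "1 * \<Phi> p \<le> tent (fst p) * \<Phi> p" using \<Phi>0 by (intro mult_right_mono)
      moreover have "real (card {c\<in>D. p \<in> B c}) \<le> n"
        using n[of "fst p" "snd p"] by (simp add: B_def mem_Times_iff)
      ultimately show ?thesis using \<Phi>0[of p] n0 by (intro mult_mono) auto
    qed
    finally show "(\<Sum>c\<in>D. indicator (B c) p * \<Phi> p) \<le> n * (tent (fst p) * \<Phi> p)" .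
  qed
  finally show ?thesis by simp
qed

lemma continuous_on_wave_sum:
  assumes "wavelet K \<theta>"
  shows "continuous_on UNIV (\<lambda>p. wave_sum L a \<theta> s (fst p, snd p))"
  unfolding wave_sum_def fst_conv snd_conv
  by (intro continuous_intros wavelet_continuous_compose[OF assms])

lemma wave_sum_deriv_x:
  assumes "\<And>t. (\<theta> has_real_derivative \<theta>' t) (at t)"
  shows "((\<lambda>x. wave_sum L a \<theta> s (x, y)) has_real_derivative s * wave_sum L (\<lambda>l. a l * fst l) \<theta>' s (x, y)) (at x)"
  unfolding wave_sum_def sum_distrib_left
  by (intro DERIV_sum) (auto intro!: derivative_eq_intros DERIV_chain2[OF assms])

lemma wave_sum_deriv_y:
  assumes "\<And>t. (\<theta> has_real_derivative \<theta>' t) (at t)"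
  shows "((\<lambda>y. wave_sum L a \<theta> s (x, y)) has_real_derivative - s * wave_sum L a \<theta>' s (x, y)) (at y)"
  unfolding wave_sum_def sum_distrib_left
  by (intro DERIV_sum) (auto intro!: derivative_eq_intros DERIV_chain2[OF assms])

text \<open>The derivatives of a wave sum of frequency \<open>s\<close> are \<open>s\<close> times wave sums with the differentiated profile,
  and slopes are at most 1. At the length scale \<open>1/s\<close> all four terms of the Sobolev inequality therefore
  obey the same energy bound. The factor 9 is \<open>4 + 2 + 2 + 1\<close>.\<close>

lemma level_estimate:
  assumes \<Psi>: "wavelet K \<Psi>" and \<Psi>': "wavelet K \<Psi>'" and \<Psi>'': "wavelet K \<Psi>''"
    and d1: "\<And>t. (\<Psi> has_real_derivative \<Psi>' t) (at t)"
    and d2: "\<And>t. (\<Psi>' has_real_derivative \<Psi>'' t) (at t)"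
    and s: "s = 2 ^ j" and L: "finite L" and v: "v < 2"
    and w: "\<And>l. l \<in> L \<Longrightarrow> 0 \<le> w l"
    and slope: "\<And>l l'. l \<in> L \<Longrightarrow> l' \<in> L \<Longrightarrow> \<bar>fst l - fst l'\<bar> \<le> 1" "\<And>l. l \<in> L \<Longrightarrow> \<bar>fst l\<bar> \<le> 1"
    and frost: "\<And>l i. l \<in> L \<Longrightarrow> i \<le> j \<Longrightarrow>
      (\<Sum>l' | l' \<in> L \<and> \<bar>fst l - fst l'\<bar> \<le> (1/2) ^ i \<and> \<bar>snd l - snd l'\<bar> \<le> 11 * (1/2) ^ i. w l')
        \<le> A * 2 powr (- v * real i)"
    and D: "finite D" "\<And>c. c \<in> D \<Longrightarrow> fst (z c) \<in> {0..1}"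
    and n: "\<And>x y. real (card {c\<in>D. x \<in> {fst (z c)..fst (z c) + 1/s} \<and> y \<in> {snd (z c)..snd (z c) + 1/s}}) \<le> n"
  shows "(\<Sum>c\<in>D. (wave_sum L w \<Psi> s (z c))\<^sup>2)
     \<le> 9 * n * s\<^sup>2 * (1024 * K\<^sup>2 * A / (1 - 2 powr (v - 2)) * (\<Sum>l\<in>L. w l) * 2 powr (- (1 + v) * real j))"
proof -
  define E where "E = 1024 * K\<^sup>2 * A / (1 - 2 powr (v - 2)) * (\<Sum>l\<in>L. w l) * 2 powr (- (1 + v) * real j)"
  have spos: "s > 0" "s \<ge> 1" by (simp_all add: s)
  have n0: "n \<ge> 0" using n[of 0 0] by linarith
  define m where "m = (\<lambda>l. w l * fst l)"
  have en: "(\<integral>p. tent (fst p) * (wave_sum L a \<theta> s p)\<^sup>2 \<partial>lborel) \<le> E"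
    if "wavelet K \<theta>" "a = w \<or> a = m" for a \<theta>
    unfolding E_def
  proof (rule wave_energy[OF that(1) s L v _ slope(1) frost])
    fix l assume l: "l \<in> L"
    have "w l * \<bar>fst l\<bar> \<le> w l * 1" using w[OF l] slope(2)[OF l] by (intro mult_left_mono)
    then show "\<bar>a l\<bar> \<le> w l" using that(2) w[OF l] by (auto simp: m_def abs_mult)
  qed auto
  define F where "F x y = wave_sum L w \<Psi> s (x, y)" for x y
  define Fx where "Fx x y = s * wave_sum L m \<Psi>' s (x, y)" for x y
  define Fy where "Fy x y = - s * wave_sum L w \<Psi>' s (x, y)" for x y
  define Fxy where "Fxy x y = s * (- s * wave_sum L m \<Psi>'' s (x, y))" for x y
  define \<Phi> where "\<Phi> = (\<lambda>p. 4 / (1/s)\<^sup>2 * (F (fst p) (snd p))\<^sup>2 + 2 * (Fy (fst p) (snd p))\<^sup>2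
      + 2 * (Fx (fst p) (snd p))\<^sup>2 + (1/s)\<^sup>2 * (Fxy (fst p) (snd p))\<^sup>2)"
  have \<Phi>_eq: "tent (fst p) * \<Phi> p = s\<^sup>2 * (4 * (tent (fst p) * (wave_sum L w \<Psi> s p)\<^sup>2)
     + 2 * (tent (fst p) * (wave_sum L w \<Psi>' s p)\<^sup>2) + 2 * (tent (fst p) * (wave_sum L m \<Psi>' s p)\<^sup>2)
     + tent (fst p) * (wave_sum L m \<Psi>'' s p)\<^sup>2)" for p
    using spos by (simp add: \<Phi>_def F_def Fx_def Fy_def Fxy_def power_mult_distrib power_divide field_simps power2_eq_square)
  note ints = wave_sum_square_integrable[OF _ spos(1)]
  have "(\<Sum>c\<in>D. (F (fst (z c)) (snd (z c)))\<^sup>2) \<le> n * (\<integral>p. tent (fst p) * \<Phi> p \<partial>lborel)"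
  proof (rule sum_squares_le_sobolev[where F = F and Fx = Fx and Fy = Fy and Fxy = Fxy and L = "1/s"])
    show "((\<lambda>x. F x y) has_real_derivative Fx x y) (at x)" for x y
      unfolding F_def Fx_def m_def by (rule wave_sum_deriv_x[OF d1])
    show "((\<lambda>y. F x y) has_real_derivative Fy x y) (at y)" for x y
      unfolding F_def Fy_def by (rule wave_sum_deriv_y[OF d1])
    show "((\<lambda>y. Fx x y) has_real_derivative Fxy x y) (at y)" for x y
      unfolding Fx_def Fxy_def by (rule DERIV_cmult[OF wave_sum_deriv_y[OF d2]])
    show "continuous_on UNIV (\<lambda>p. F (fst p) (snd p))" "continuous_on UNIV (\<lambda>p. Fx (fst p) (snd p))"
      "continuous_on UNIV (\<lambda>p. Fy (fst p) (snd p))" "continuous_on UNIV (\<lambda>p. Fxy (fst p) (snd p))"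
      unfolding F_def Fx_def Fy_def Fxy_def
      by (intro continuous_intros continuous_on_wave_sum[OF \<Psi>] continuous_on_wave_sum[OF \<Psi>'] continuous_on_wave_sum[OF \<Psi>''])+
    show "integrable lborel (\<lambda>p. tent (fst p) * \<Phi> p)"
      unfolding \<Phi>_eq by (intro integrable_mult_right Bochner_Integration.integrable_add ints[OF \<Psi>] ints[OF \<Psi>'] ints[OF \<Psi>''])
  qed (use spos D n \<Phi>_def in auto)
  also have "(\<integral>p. tent (fst p) * \<Phi> p \<partial>lborel) = s\<^sup>2 * (4 * (\<integral>p. tent (fst p) * (wave_sum L w \<Psi> s p)\<^sup>2 \<partial>lborel)
     + 2 * (\<integral>p. tent (fst p) * (wave_sum L w \<Psi>' s p)\<^sup>2 \<partial>lborel)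
     + 2 * (\<integral>p. tent (fst p) * (wave_sum L m \<Psi>' s p)\<^sup>2 \<partial>lborel)
     + (\<integral>p. tent (fst p) * (wave_sum L m \<Psi>'' s p)\<^sup>2 \<partial>lborel))"
    unfolding \<Phi>_eq using ints[OF \<Psi>] ints[OF \<Psi>'] ints[OF \<Psi>''] by simp
  also have "n * \<dots> \<le> n * (s\<^sup>2 * (9 * E))"
    using en[OF \<Psi>, of w] en[OF \<Psi>', of w] en[OF \<Psi>', of m] en[OF \<Psi>'', of m] n0
    by (intro mult_left_mono) auto
  finally show ?thesis by (simp add: F_def E_def mult_ac)
qed

section \<open>The incidence estimate\<close>

text \<open>The function has a kink in its highest derivative at 0. There the difference quotient is
  \<open>max 0 h ^ Suc n\<close>, which tends to 0.\<close>

lemma max_power_has_derivative: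
  "((\<lambda>z::real. max 0 z ^ Suc (Suc n)) has_real_derivative real (Suc (Suc n)) * max 0 z ^ Suc n) (at z)"
proof -
  consider "z < 0" | "z = 0" | "z > 0" by linarith
  then show ?thesis
  proof cases
    case 1
    have "((\<lambda>z::real. 0) has_real_derivative real (Suc (Suc n)) * max 0 z ^ Suc n) (at z)"
      using 1 by simp
    then show ?thesis
      by (rule has_field_derivative_transform_within_open[where S = "{..<0}"]) (use 1 in auto)
  next
    case 2
    have "((\<lambda>h::real. max 0 h ^ Suc n) \<longlongrightarrow> max 0 0 ^ Suc n) (at 0)"
      by (intro tendsto_intros)
    then have "((\<lambda>h::real. max 0 h ^ Suc n) \<longlongrightarrow> 0) (at 0)" by simp
    moreover have "\<forall>\<^sub>F h in at (0::real). max 0 h ^ Suc n = (max 0 (0 + h) ^ Suc (Suc n) - max 0 0 ^ Suc (Suc n)) / h"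
      by (auto simp: eventually_at_filter max_def)
    ultimately have "((\<lambda>h::real. (max 0 (0 + h) ^ Suc (Suc n) - max 0 0 ^ Suc (Suc n)) / h) \<longlongrightarrow> 0) (at 0)"
      by (rule Lim_transform_eventually)
    then show ?thesis unfolding 2 DERIV_def by simp
  next
    case 3
    have "((\<lambda>z::real. z ^ Suc (Suc n)) has_real_derivative real (Suc (Suc n)) * max 0 z ^ Suc n) (at z)"
      using 3 DERIV_pow[of "Suc (Suc n)" z] by simp
    then show ?thesis
      by (rule has_field_derivative_transform_within_open[where S = "{0<..}"]) (use 3 in auto)
  qed
qed

text \<open>A profile with two continuous derivatives that is at least 1 on the interval of radius \<open>3/2\<close>. A square
  that meets a line has the midpoint of its left edge within \<open>3/2\<close> sides of the line, measured
  vertically.\<close>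

definition bump :: "real \<Rightarrow> real" where "bump t = max 0 (4 - t\<^sup>2) ^ 3"
definition bump' :: "real \<Rightarrow> real" where "bump' t = - 6 * t * max 0 (4 - t\<^sup>2) ^ 2"
definition bump'' :: "real \<Rightarrow> real" where
  "bump'' t = - 6 * max 0 (4 - t\<^sup>2) ^ 2 + 24 * t\<^sup>2 * max 0 (4 - t\<^sup>2)"

lemma four_minus_square_deriv: "((\<lambda>t::real. 4 - t\<^sup>2) has_real_derivative - (2 * t)) (at t)"
  by (auto intro!: derivative_eq_intros)

lemma bump_deriv: "(bump has_real_derivative bump' t) (at t)"
proof -
  have "((\<lambda>t. max 0 (4 - t\<^sup>2) ^ 3) has_real_derivative (3 * max 0 (4 - t\<^sup>2) ^ 2) * (- (2 * t))) (at t)"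
    using DERIV_chain2[where f = "\<lambda>z. max 0 z ^ Suc (Suc 1)" and g = "\<lambda>t. 4 - t\<^sup>2",
        OF max_power_has_derivative four_minus_square_deriv]
    by (simp add: numeral_3_eq_3 numeral_2_eq_2)
  then show ?thesis by (simp add: bump_def[abs_def] bump'_def algebra_simps)
qed

lemma bump'_deriv: "(bump' has_real_derivative bump'' t) (at t)"
proof -
  have "((\<lambda>t. max 0 (4 - t\<^sup>2) ^ 2) has_real_derivative (2 * max 0 (4 - t\<^sup>2)) * (- (2 * t))) (at t)"
    using DERIV_chain2[where f = "\<lambda>z. max 0 z ^ Suc (Suc 0)" and g = "\<lambda>t. 4 - t\<^sup>2",
        OF max_power_has_derivative four_minus_square_deriv]
    by (simp add: numeral_2_eq_2)
  then have "((\<lambda>t. (- 6 * t) * max 0 (4 - t\<^sup>2) ^ 2) has_real_derivative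
      (- 6 * t) * ((2 * max 0 (4 - t\<^sup>2)) * (- (2 * t))) + (- 6) * max 0 (4 - t\<^sup>2) ^ 2) (at t)"
    by (intro DERIV_mult') (auto intro!: derivative_eq_intros)
  then show ?thesis by (simp add: bump'_def[abs_def] bump''_def power2_eq_square algebra_simps)
qed

lemma max4_eq_0: "t \<notin> {-2<..<2} \<Longrightarrow> max 0 (4 - t\<^sup>2) = (0::real)"
proof -
  assume "t \<notin> {-2<..<2}"
  then have "2 \<le> \<bar>t\<bar>" by auto
  then have "2\<^sup>2 \<le> \<bar>t\<bar>\<^sup>2" by (intro power_mono) auto
  then show ?thesis by simp
qed

lemma bump_support: "t \<notin> {-2<..<2} \<Longrightarrow> bump t = 0" "t \<notin> {-2<..<2} \<Longrightarrow> bump' t = 0"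
   "t \<notin> {-2<..<2} \<Longrightarrow> bump'' t = 0"
proof -
  assume "t \<notin> {-2<..<2}"
  from max4_eq_0[OF this] show "bump t = 0" "bump' t = 0" "bump'' t = 0"
    by (simp_all only: bump_def bump'_def bump''_def) simp_all
qed

lemma bump_bounds: "0 \<le> bump t" "bump t \<le> 64" "\<bar>t\<bar> \<le> 3/2 \<Longrightarrow> 1 \<le> bump t"
proof -
  show "0 \<le> bump t" by (simp add: bump_def)
  have "max 0 (4 - t\<^sup>2) ^ 3 \<le> 4 ^ 3" by (intro power_mono) auto
  then show "bump t \<le> 64" by (simp add: bump_def)
  assume "\<bar>t\<bar> \<le> 3/2"
  then have "\<bar>t\<bar>\<^sup>2 \<le> (3/2)\<^sup>2" by (intro power_mono) auto
  then have "1 \<le> 4 - t\<^sup>2" by (simp add: power2_eq_square)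
  then have "1 ^ 3 \<le> max 0 (4 - t\<^sup>2) ^ 3" by (intro power_mono) auto
  then show "1 \<le> bump t" by (simp add: bump_def)
qed

lemma bump_continuous:
  "continuous_on UNIV bump" "continuous_on UNIV bump'" "continuous_on UNIV bump''"
  unfolding bump_def[abs_def] bump'_def[abs_def] bump''_def[abs_def] by (intro continuous_intros)+

text \<open>The difference of the bump at two consecutive scales, both normalized to the same integral.\<close>

definition mother :: "real \<Rightarrow> real" where "mother t = bump t - bump (t / 2) / 2"
definition mother' :: "real \<Rightarrow> real" where "mother' t = bump' t - bump' (t / 2) / 4"
definition mother'' :: "real \<Rightarrow> real" where "mother'' t = bump'' t - bump'' (t / 2) / 8"

lemma mother_deriv: "(mother has_real_derivative mother' t) (at t)"
  unfolding mother_def[abs_def] mother'_def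
  by (auto intro!: derivative_eq_intros bump_deriv DERIV_chain2[OF bump_deriv])

lemma mother'_deriv: "(mother' has_real_derivative mother'' t) (at t)"
  unfolding mother'_def[abs_def] mother''_def
  by (auto intro!: derivative_eq_intros bump'_deriv DERIV_chain2[OF bump'_deriv])

lemma mother_support: "t \<notin> {-4<..<4} \<Longrightarrow> mother t = 0" "t \<notin> {-4<..<4} \<Longrightarrow> mother' t = 0"
   "t \<notin> {-4<..<4} \<Longrightarrow> mother'' t = 0"
proof -
  assume "t \<notin> {-4<..<4}"
  then have t: "t \<notin> {-2<..<2}" "t / 2 \<notin> {-2<..<2}" by auto
  show "mother t = 0" "mother' t = 0" "mother'' t = 0"
    using bump_support[OF t(1)] bump_support[OF t(2)]
    by (simp_all add: mother_def mother'_def mother''_def)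
qed

lemma mother_continuous:
  "continuous_on UNIV mother" "continuous_on UNIV mother'" "continuous_on UNIV mother''"
  unfolding mother_def[abs_def] mother'_def[abs_def] mother''_def[abs_def]
  by (intro continuous_intros bump_continuous continuous_on_compose2[OF bump_continuous(1)]
     continuous_on_compose2[OF bump_continuous(2)] continuous_on_compose2[OF bump_continuous(3)]; simp)+

lemma integral_derivative_zero:
  fixes f f' :: "real \<Rightarrow> real"
  assumes f: "\<And>t. (f has_real_derivative f' t) (at t)" and c: "continuous_on UNIV f'"
    and supp: "\<And>t. t \<notin> {-4<..<4} \<Longrightarrow> f t = 0" "\<And>t. t \<notin> {-4<..<4} \<Longrightarrow> f' t = 0"
  shows "(\<integral>t. f' t \<partial>lborel) = 0"
proof -
  have "has_bochner_integral lborel (\<lambda>x. f' x * indicator {-4..4} x) (f 4 - f (-4))"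
    by (rule has_bochner_integral_FTC_Icc_real) (use f c in \<open>auto simp: continuous_on_eq_continuous_at\<close>)
  moreover have "(\<lambda>x. f' x * indicator {-4..4} x) = f'"
  proof
    fix x
    show "f' x * indicator {-4..4} x = f' x"
      using supp(2)[of x] by (cases "x \<in> {-4<..<4}") (auto simp: indicator_def)
  qed
  ultimately show ?thesis using supp(1)[of 4] supp(1)[of "-4"] by (simp add: has_bochner_integral_iff)
qed

text \<open>Rescaling by 2 and halving preserves the integral of the bump.\<close>

lemma mother_mean_zero: "(\<integral>t. mother t \<partial>lborel) = 0"
proof -
  have int: "integrable lborel bump"
    by (rule integrable_continuous_compact_support[OF bump_continuous(1), of "{-2..2}"]) (auto intro: bump_support)
  have int2: "integrable lborel (\<lambda>t. bump (t / 2))"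
    by (rule integrable_continuous_compact_support[of _ "{-4..4}"])
      (auto intro!: bump_support continuous_on_compose2[OF bump_continuous(1)] continuous_intros)
  have "(\<integral>t. bump (t / 2) \<partial>lborel) = \<bar>2\<bar> *\<^sub>R (\<integral>t. bump ((0 + 2 * t) / 2) \<partial>lborel)"
    by (rule lborel_integral_real_affine) simp
  then show ?thesis using int int2 by (simp add: mother_def)
qed

lemma waveletI_compact_support:
  assumes "continuous_on UNIV \<theta>" "\<And>t. t \<notin> {-4<..<4} \<Longrightarrow> \<theta> t = 0" "(\<integral>t. \<theta> t \<partial>lborel) = 0"
  shows "\<exists>K. wavelet K \<theta>"
proof -
  have "compact (\<theta> ` {-4..4})"
    by (rule compact_continuous_image[OF continuous_on_subset[OF assms(1)]]) auto
  then have "bounded (\<theta> ` {-4..4})" by (rule compact_imp_bounded)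
  then obtain K where "\<forall>x\<in>\<theta> ` {-4..4}. norm x \<le> K" unfolding bounded_iff ..
  then have K: "\<And>t. t \<in> {-4..4} \<Longrightarrow> \<bar>\<theta> t\<bar> \<le> K" by simp
  have "\<bar>\<theta> t\<bar> \<le> K" for t
    using K[of t] K[of 0] assms(2)[of t] by (cases "t \<in> {-4..4}") auto
  then show ?thesis using assms by (auto simp: wavelet_def intro!: exI[of _ K])
qed

lemma mother_wavelets: "\<exists>K. wavelet K mother \<and> wavelet K mother' \<and> wavelet K mother''"
proof -
  obtain K1 where K1: "wavelet K1 mother"
    using waveletI_compact_support[OF mother_continuous(1) mother_support(1) mother_mean_zero] by blast
  obtain K2 where K2: "wavelet K2 mother'"
    using waveletI_compact_support[OF mother_continuous(2) mother_support(2)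
      integral_derivative_zero[OF mother_deriv mother_continuous(2) mother_support(1,2)]] by blast
  obtain K3 where K3: "wavelet K3 mother''"
    using waveletI_compact_support[OF mother_continuous(3) mother_support(3)
      integral_derivative_zero[OF mother'_deriv mother_continuous(3) mother_support(2,3)]] by blast
  show ?thesis
    by (rule exI[of _ "max K1 (max K2 K3)"]) (auto intro: wavelet_mono[OF K1] wavelet_mono[OF K2] wavelet_mono[OF K3])
qed

text \<open>The \<open>j\<close>-th summand is the difference of \<open>2 ^ j * bump (2 ^ j * t)\<close> and its predecessor.\<close>

lemma bump_telescope:
  "2 ^ J * bump (2 ^ J * t) = bump t + (\<Sum>j\<in>{1..J}. 2 ^ j * mother (2 ^ j * t))"
  by (induction J) (auto simp: mother_def algebra_simps)

lemma geometric_sum_le_last_term: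
  fixes r :: real
  assumes "r > 1"
  shows "(\<Sum>j\<in>{1..J}. r ^ j) \<le> r ^ J / (1 - 1 / r)"
proof -
  have "(\<Sum>j\<in>{1..J}. r ^ j) \<le> (\<Sum>j\<le>J. r ^ j)"
    using assms by (intro sum_mono2) auto
  also have "\<dots> = r ^ J * (\<Sum>j\<le>J. (1 / r) ^ (J - j))"
    unfolding sum_distrib_left
    by (intro sum.cong refl) (use assms in \<open>auto simp: power_one_over power_diff field_simps\<close>)
  also have "\<dots> \<le> r ^ J * (1 / (1 - 1 / r))"
    using assms by (intro mult_left_mono geometric_sum_rev_le) auto
  finally show ?thesis by simp
qed

text \<open>Weighted lines with a \<open>v\<close>-dimensional Frostman condition (constant \<open>A\<close>) and points \<open>z c\<close>
  that are \<open>t\<close>-dimensional down to the scale \<open>2\<^sup>-\<^sup>J\<close> (constant \<open>B\<close>). The constant 11 is the one of lemma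
  \<open>line_pairing_dyadic\<close>.\<close>

definition admissible_data ::
  "real \<Rightarrow> real \<Rightarrow> real \<Rightarrow> real \<Rightarrow> nat \<Rightarrow> (real \<times> real) set \<Rightarrow> (real \<times> real \<Rightarrow> real) \<Rightarrow> (int \<times> int) set
     \<Rightarrow> (int \<times> int \<Rightarrow> real \<times> real) \<Rightarrow> bool" where
  "admissible_data v t A B J L w D z \<longleftrightarrow>
     finite L \<and> (\<forall>l\<in>L. 0 \<le> w l \<and> \<bar>fst l\<bar> \<le> 1) \<and> (\<forall>l\<in>L. \<forall>l'\<in>L. \<bar>fst l - fst l'\<bar> \<le> 1) \<and> (\<Sum>l\<in>L. w l) \<le> A \<and>
     (\<forall>l\<in>L. \<forall>i\<le>J. (\<Sum>l' | l' \<in> L \<and> \<bar>fst l - fst l'\<bar> \<le> (1/2) ^ i \<and> \<bar>snd l - snd l'\<bar> \<le> 11 * (1/2) ^ i. w l')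
        \<le> A * 2 powr (- v * real i)) \<and>
     finite D \<and> (\<forall>c\<in>D. fst (z c) \<in> {0..1}) \<and> real (card D) \<le> B * 2 powr (t * real J) \<and>
     (\<forall>j\<le>J. \<forall>x y. real (card {c\<in>D. x \<in> {fst (z c)..fst (z c) + 1/2^j} \<and> y \<in> {snd (z c)..snd (z c) + 1/2^j}})
        \<le> B * 2 powr (t * real (J - j)))"

text \<open>Both sides of the estimate come from the weighted sum \<open>I\<close> of bumps of width \<open>2\<^sup>-\<^sup>J\<close> over all points and
  lines. It is at least \<open>2\<^sup>J M W\<close>. For the upper bound it is telescoped. By Cauchy and Schwarz and
  lemma \<open>level_estimate\<close>, the level \<open>j\<close> contributes at most a constant times
  \<open>sqrt (N W) * 2\<^bsup>tJ/2\<^esup> * r\<^sup>j\<close> with \<open>r = 2\<^bsup>(3-v-t)/2\<^esup>\<close>. Here \<open>r > 1\<close> is the hypothesis \<open>v + t < 3\<close>,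
  so the last level dominates. The lowest level is bounded trivially.\<close>

theorem incidence_bound:
  fixes v t A B :: real
  assumes v: "v < 2" and tv: "v + t < 3" and A: "A \<ge> 0" and B: "B \<ge> 0"
  obtains C where "C \<ge> 0"
    "\<And>J L w D z M. admissible_data v t A B J L w D z \<Longrightarrow> M \<ge> 0 \<Longrightarrow>
      (\<And>l. l \<in> L \<Longrightarrow> M \<le> real (card {c\<in>D. \<bar>fst l * fst (z c) + snd l - snd (z c)\<bar> \<le> 3/2 * (1/2) ^ J})) \<Longrightarrow>
      (\<Sum>l\<in>L. w l) * M\<^sup>2 \<le> C * real (card D) * 2 powr ((1 - v) * real J)"
proof -
  obtain K where K: "wavelet K mother" "wavelet K mother'" "wavelet K mother''"
    using mother_wavelets by blast
  define C1 where "C1 = 1024 * K\<^sup>2 * A / (1 - 2 powr (v - 2))"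
  have "2 powr (v - 2) < 1" using v powr_less_mono[of "v - 2" 0 2] by simp
  then have C1: "C1 \<ge> 0" using A by (simp add: C1_def)
  define r where "r = 2 powr ((3 - v - t) / 2)"
  have r: "r > 1" using tv powr_less_mono[of 0 "(3 - v - t) / 2" 2] by (simp add: r_def)
  define c0 where "c0 = 64 * sqrt (B * A) + sqrt (9 * B * C1) / (1 - 1 / r)"
  have c0: "c0 \<ge> 0" using A B C1 r by (auto simp: c0_def intro!: add_nonneg_nonneg divide_nonneg_nonneg)
  show thesis
  proof (rule that[of "c0\<^sup>2"])
    fix J L w D z and M :: real
    assume ad: "admissible_data v t A B J L w D z" and M: "M \<ge> 0"
      "\<And>l. l \<in> L \<Longrightarrow> M \<le> real (card {c\<in>D. \<bar>fst l * fst (z c) + snd l - snd (z c)\<bar> \<le> 3/2 * (1/2) ^ J})"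
    note ad = ad[unfolded admissible_data_def]
    define W where "W = (\<Sum>l\<in>L. w l)"
    define N where "N = real (card D)"
    define X where "X = sqrt (N * W) * 2 powr ((3 - v) / 2 * real J)"
    have finL: "finite L" and w0: "\<And>l. l \<in> L \<Longrightarrow> 0 \<le> w l" and finD: "finite D" using ad by auto
    have W: "0 \<le> W" "W \<le> A" using ad by (auto simp: W_def intro: sum_nonneg)
    have N: "0 \<le> N" "N \<le> B * 2 powr (t * real J)" using ad by (auto simp: N_def)
    define S where "S j = (\<Sum>c\<in>D. 2 ^ j * wave_sum L w mother (2 ^ j) (z c))" for j :: nat
    have Sbound: "S j \<le> sqrt (9 * B * C1) * (sqrt (N * W) * 2 powr (t / 2 * real J)) * r ^ j"
      if j: "j \<le> J" for j
    proof -
      have "(\<Sum>c\<in>D. (wave_sum L w mother (2 ^ j) (z c))\<^sup>2)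
        \<le> 9 * (B * 2 powr (t * real (J - j))) * (2 ^ j)\<^sup>2 * (1024 * K\<^sup>2 * A / (1 - 2 powr (v - 2)) * (\<Sum>l\<in>L. w l) * 2 powr (- (1 + v) * real j))"
        by (rule level_estimate[OF K mother_deriv mother'_deriv refl finL v])
          (use ad j in auto)
      then have le: "(\<Sum>c\<in>D. (wave_sum L w mother (2 ^ j) (z c))\<^sup>2)
        \<le> 9 * (B * 2 powr (t * real (J - j))) * (2 ^ j)\<^sup>2 * (C1 * W * 2 powr (- (1 + v) * real j))"
        by (simp only: C1_def W_def)
      have "(S j)\<^sup>2 = (2 ^ j)\<^sup>2 * (\<Sum>c\<in>D. wave_sum L w mother (2 ^ j) (z c) * 1)\<^sup>2"
        by (simp add: S_def sum_distrib_left[symmetric] power_mult_distrib)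
      also have "\<dots> \<le> (2 ^ j)\<^sup>2 * ((\<Sum>c\<in>D. (wave_sum L w mother (2 ^ j) (z c))\<^sup>2) * (\<Sum>c\<in>D. 1\<^sup>2))"
        by (intro mult_left_mono Cauchy_Schwarz_ineq_sum) auto
      also have "\<dots> \<le> (2 ^ j)\<^sup>2 * ((9 * (B * 2 powr (t * real (J - j))) * (2 ^ j)\<^sup>2 * (C1 * W * 2 powr (- (1 + v) * real j))) * N)"
        using le W B C1 by (intro mult_left_mono mult_mono) (auto simp: N_def intro: sum_nonneg)
      also have "\<dots> = 9 * B * C1 * (N * W) * ((2 ^ j)\<^sup>2 * (2 ^ j)\<^sup>2 * 2 powr (t * real (J - j)) * 2 powr (- (1 + v) * real j))"
        by (simp only: mult_ac)
      also have "(2 ^ j)\<^sup>2 * (2 ^ j)\<^sup>2 * 2 powr (t * real (J - j)) * 2 powr (- (1 + v) * real j)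
         = (2 powr (t / 2 * real J) * r ^ j)\<^sup>2"
      proof -
        have a: "(2::real) ^ j = 2 powr real j" by (simp add: powr_realpow)
        have b: "r ^ j = 2 powr ((3 - v - t) / 2 * real j)"
          by (simp add: r_def powr_powr flip: powr_realpow)
        show ?thesis unfolding a b power2_eq_square powr_add[symmetric]
          using j by (intro arg_cong[of _ _ "\<lambda>x. 2 powr x"]) (simp add: of_nat_diff field_simps)
      qed
      also have "9 * B * C1 * (N * W) * (2 powr (t / 2 * real J) * r ^ j)\<^sup>2
         = (sqrt (9 * B * C1) * (sqrt (N * W) * 2 powr (t / 2 * real J)) * r ^ j)\<^sup>2"
        using B C1 N W by (simp add: power_mult_distrib)
      finally show ?thesis
        by (rule power2_le_imp_le) (use B C1 N W r in auto)
    qed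
    have "(\<Sum>j\<in>{1..J}. S j) \<le> (\<Sum>j\<in>{1..J}. sqrt (9 * B * C1) * (sqrt (N * W) * 2 powr (t / 2 * real J)) * r ^ j)"
      by (intro sum_mono Sbound) auto
    also have "\<dots> \<le> sqrt (9 * B * C1) * (sqrt (N * W) * 2 powr (t / 2 * real J)) * (r ^ J / (1 - 1 / r))"
      unfolding sum_distrib_left[symmetric]
      using B C1 N W r by (intro mult_left_mono geometric_sum_le_last_term) auto
    also have "\<dots> = sqrt (9 * B * C1) / (1 - 1 / r) * (sqrt (N * W) * (2 powr (t / 2 * real J) * r ^ J))"
      by simp
    also have "2 powr (t / 2 * real J) * r ^ J = 2 powr ((3 - v) / 2 * real J)"
    proof -
      have b: "r ^ J = 2 powr ((3 - v - t) / 2 * real J)"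
        by (simp add: r_def powr_powr flip: powr_realpow)
      show ?thesis unfolding b powr_add[symmetric]
        by (intro arg_cong[of _ _ "\<lambda>x. 2 powr x"]) (simp add: field_simps)
    qed
    finally have high: "(\<Sum>j\<in>{1..J}. S j) \<le> sqrt (9 * B * C1) / (1 - 1 / r) * X" by (simp add: X_def)
    have "(\<Sum>c\<in>D. wave_sum L w bump 1 (z c)) \<le> (\<Sum>c\<in>D. 64 * W)"
    proof (intro sum_mono)
      fix c
      have "wave_sum L w bump 1 (z c) \<le> (\<Sum>l\<in>L. w l * 64)"
        unfolding wave_sum_def by (intro sum_mono mult_left_mono bump_bounds w0)
      then show "wave_sum L w bump 1 (z c) \<le> 64 * W" by (simp add: W_def sum_distrib_right[symmetric])
    qed
    also have "\<dots> = 64 * (sqrt (N * W) * sqrt (N * W))" using N W by (simp add: N_def)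
    also have "\<dots> \<le> 64 * (sqrt (N * W) * (sqrt (B * A) * 2 powr ((3 - v) / 2 * real J)))"
    proof -
      have "N * W \<le> (B * 2 powr (t * real J)) * A" using N W A B by (intro mult_mono) auto
      also have "\<dots> = (B * A) * 2 powr (t * real J)" by simp
      also have "\<dots> \<le> (B * A) * 2 powr ((3 - v) * real J)"
        using tv A B by (intro mult_left_mono powr_mono mult_right_mono) auto
      also have "\<dots> = (sqrt (B * A) * 2 powr ((3 - v) / 2 * real J))\<^sup>2"
        using A B by (simp add: power_mult_distrib power2_eq_square[of "2 powr _"] mult.commute[of "real J"] flip: powr_add)
      finally have "sqrt (N * W) \<le> sqrt (B * A) * 2 powr ((3 - v) / 2 * real J)"
        by (rule real_le_lsqrt[rotated -1]) (use A B N W in auto)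
      then show ?thesis using N W by (intro mult_left_mono) auto
    qed
    finally have low: "(\<Sum>c\<in>D. wave_sum L w bump 1 (z c)) \<le> 64 * sqrt (B * A) * X" by (simp add: X_def mult_ac)
    define I where "I = (\<Sum>l\<in>L. w l * (\<Sum>c\<in>D. 2 ^ J * bump (2 ^ J * (fst l * fst (z c) + snd l - snd (z c)))))"
    have "I = (\<Sum>l\<in>L. \<Sum>c\<in>D. w l * bump (1 * (fst l * fst (z c) + snd l - snd (z c))) +
        (\<Sum>j\<in>{1..J}. 2 ^ j * (w l * mother (2 ^ j * (fst l * fst (z c) + snd l - snd (z c))))))"
      unfolding I_def bump_telescope sum_distrib_left
      by (intro sum.cong refl) (simp add: distrib_left sum_distrib_left mult_ac)
    also have "\<dots> = (\<Sum>c\<in>D. \<Sum>l\<in>L. w l * bump (1 * (fst l * fst (z c) + snd l - snd (z c))) +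
        (\<Sum>j\<in>{1..J}. 2 ^ j * (w l * mother (2 ^ j * (fst l * fst (z c) + snd l - snd (z c))))))"
      by (rule sum.swap)
    also have "\<dots> = (\<Sum>c\<in>D. wave_sum L w bump 1 (z c) + (\<Sum>j\<in>{1..J}. 2 ^ j * wave_sum L w mother (2 ^ j) (z c)))"
      unfolding wave_sum_def sum.distrib sum_distrib_left
      by (intro sum.cong refl arg_cong2[of _ _ _ _ "(+)"] sum.swap)
    also have "\<dots> = (\<Sum>c\<in>D. wave_sum L w bump 1 (z c)) + (\<Sum>j\<in>{1..J}. S j)"
      unfolding sum.distrib S_def by (intro arg_cong2[of _ _ _ _ "(+)"] refl sum.swap)
    also have "\<dots> \<le> c0 * X" using low high by (simp add: c0_def distrib_right)
    finally have upper: "I \<le> c0 * X" .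
    have "2 ^ J * M * W \<le> I"
      unfolding I_def W_def sum_distrib_left
    proof (intro sum_mono)
      fix l assume l: "l \<in> L"
      define G where "G = {c\<in>D. \<bar>fst l * fst (z c) + snd l - snd (z c)\<bar> \<le> 3/2 * (1/2) ^ J}"
      have "2 ^ J * M \<le> (\<Sum>c\<in>G. 2 ^ J)" using M(2)[OF l] by (simp add: G_def)
      also have "\<dots> \<le> (\<Sum>c\<in>G. 2 ^ J * bump (2 ^ J * (fst l * fst (z c) + snd l - snd (z c))))"
      proof (intro sum_mono)
        fix c assume "c \<in> G"
        then have "2 ^ J * \<bar>fst l * fst (z c) + snd l - snd (z c)\<bar> \<le> 2 ^ J * (3/2 * (1/2) ^ J)"
          by (intro mult_left_mono) (auto simp: G_def)
        also have "\<dots> = 3/2" by (simp add: power_one_over)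
        finally have "1 \<le> bump (2 ^ J * (fst l * fst (z c) + snd l - snd (z c)))"
          by (intro bump_bounds(3)) (simp only: abs_mult, simp)
        then show "2 ^ J \<le> 2 ^ J * bump (2 ^ J * (fst l * fst (z c) + snd l - snd (z c)))" by simp
      qed
      also have "\<dots> \<le> (\<Sum>c\<in>D. 2 ^ J * bump (2 ^ J * (fst l * fst (z c) + snd l - snd (z c))))"
        using finD by (intro sum_mono2) (auto simp: G_def bump_bounds)
      finally have "2 ^ J * M * w l \<le> w l * (\<Sum>c\<in>D. 2 ^ J * bump (2 ^ J * (fst l * fst (z c) + snd l - snd (z c))))"
        using w0[OF l] by (subst mult.commute) (rule mult_left_mono)
      then show "2 ^ J * M * w l \<le> (\<Sum>c\<in>D. w l * (2 ^ J * bump (2 ^ J * (fst l * fst (z c) + snd l - snd (z c)))))"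
        by (simp only: sum_distrib_left)
    qed
    then have "(2 ^ J * M * W)\<^sup>2 \<le> (c0 * X)\<^sup>2"
      using upper M W by (intro power_mono) auto
    also have "(c0 * X)\<^sup>2 = c0\<^sup>2 * N * 2 powr ((3 - v) * real J) * W"
      using N W by (simp add: X_def power_mult_distrib power2_eq_square[of "2 powr _"]
          mult.commute[of "real J"] flip: powr_add)
    finally have "W * (W * M\<^sup>2) * (2 ^ J)\<^sup>2 \<le> W * (c0\<^sup>2 * N * 2 powr ((3 - v) * real J))"
      by (simp add: power_mult_distrib power2_eq_square mult_ac)
    also have "2 powr ((3 - v) * real J) = 2 powr ((1 - v) * real J) * (2 ^ J)\<^sup>2"
      by (simp add: powr_realpow[symmetric] power2_eq_square flip: powr_add) (simp add: algebra_simps)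
    finally have fin: "W * (W * M\<^sup>2) * (2 ^ J)\<^sup>2 \<le> W * (c0\<^sup>2 * N * 2 powr ((1 - v) * real J)) * (2 ^ J)\<^sup>2"
      by (simp only: mult_ac)
    show "(\<Sum>l\<in>L. w l) * M\<^sup>2 \<le> c0\<^sup>2 * real (card D) * 2 powr ((1 - v) * real J)"
    proof (cases "W = 0")
      case True
      then show ?thesis by (simp add: W_def)
    next
      case False
      then have "W > 0" using W by simp
      then show ?thesis using fin by (simp add: W_def N_def)
    qed
  qed simp
qed

section \<open>Dyadic covers of point sets and line sets\<close>

definition cell_of :: "nat \<Rightarrow> real \<times> real \<Rightarrow> int \<times> int" where
  "cell_of J p = (\<lfloor>2 ^ J * fst p\<rfloor>, \<lfloor>2 ^ J * snd p\<rfloor>)"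

lemma ancestor_cell_of: "k \<le> J \<Longrightarrow> ancestor k (cell_of J p) = cell_of (J - k) p"
proof -
  assume "k \<le> J"
  then have "2 ^ J * x / real_of_int (2 ^ k) = 2 ^ (J - k) * x" for x :: real
    by (simp add: power_diff)
  then have "\<lfloor>2 ^ J * x\<rfloor> div 2 ^ k = \<lfloor>2 ^ (J - k) * x\<rfloor>" for x :: real
    using floor_divide_real_eq_div[of "2 ^ k" "2 ^ J * x"] by simp
  then show ?thesis by (simp add: ancestor_def cell_of_def)
qed

lemma same_floor_scaled: "\<lfloor>2 ^ i * x\<rfloor> = \<lfloor>2 ^ i * y\<rfloor> \<Longrightarrow> \<bar>x - y\<bar> \<le> (1/2) ^ i" for x y :: real
proof -
  assume "\<lfloor>2 ^ i * x\<rfloor> = \<lfloor>2 ^ i * y\<rfloor>"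
  then have "\<bar>2 ^ i * x - 2 ^ i * y\<bar> \<le> 1" by linarith
  then have "2 ^ i * \<bar>x - y\<bar> \<le> 1" by (simp add: abs_mult flip: right_diff_distrib)
  then show ?thesis by (simp add: power_one_over field_simps)
qed

lemma near_floor_scaled:
  fixes x y :: real
  assumes "\<bar>x - y\<bar> \<le> real n * (1/2) ^ i"
  shows "\<lfloor>2 ^ i * x\<rfloor> \<in> {\<lfloor>2 ^ i * y\<rfloor> - int n .. \<lfloor>2 ^ i * y\<rfloor> + int n}"
proof -
  have "2 ^ i * \<bar>x - y\<bar> \<le> 2 ^ i * (real n * (1/2) ^ i)" using assms by (intro mult_left_mono) auto
  also have "\<dots> = real n" by (simp add: power_one_over)
  finally have "\<bar>2 ^ i * x - 2 ^ i * y\<bar> \<le> real n" by (simp add: abs_mult flip: right_diff_distrib)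
  then show ?thesis by (simp add: le_floor_iff floor_le_iff) linarith
qed

lemma cell_bounded: "bounded {p. cell_of i p = e}" and cell_diameter: "diameter {p. cell_of i p = e} \<le> 2 * (1/2) ^ i"
proof -
  have d: "dist p q \<le> 2 * (1/2) ^ i" if "cell_of i p = e" "cell_of i q = e" for p q
  proof -
    have "\<bar>fst p - fst q\<bar> \<le> (1/2) ^ i" "\<bar>snd p - snd q\<bar> \<le> (1/2) ^ i"
      using that by (auto simp: cell_of_def intro: same_floor_scaled)
    moreover have "dist p q \<le> \<bar>fst p - fst q\<bar> + \<bar>snd p - snd q\<bar>"
      using sqrt_sum_squares_le_sum_abs[of "fst p - fst q" "snd p - snd q"]
      by (simp add: dist_prod_def dist_real_def)
    ultimately show ?thesis by linarith
  qed
  then show "bounded {p. cell_of i p = e}"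
    unfolding bounded_def by (metis mem_Collect_eq)
  show "diameter {p. cell_of i p = e} \<le> 2 * (1/2) ^ i"
    by (rule diameter_le) (use d in \<open>auto simp: dist_norm\<close>)
qed

text \<open>The scale just above \<open>e\<close>.\<close>

lemma dyadic_scale:
  fixes e :: real
  assumes "0 < e" "e \<le> 1"
  shows "\<exists>J. e \<le> (1/2) ^ J \<and> (1/2) ^ J < 2 * e"
proof -
  obtain n where n: "(1/2) ^ n < e" using real_arch_pow_inv[of e "1/2"] assms by auto
  define m where "m = (LEAST n. (1/2) ^ n < e)"
  have m: "(1/2) ^ m < e" unfolding m_def using n by (rule LeastI)
  have "m \<noteq> 0" using m assms by (intro notI) simp
  then obtain J where J: "m = Suc J" by (cases m) auto
  have "\<not> (1/2) ^ J < e" using not_less_Least[of J "\<lambda>n. (1/2) ^ n < e"] J m_def by simp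
  then show ?thesis using m J by (intro exI[of _ J]) auto
qed

text \<open>A set of diameter at most \<open>2\<^sup>-\<^sup>J\<close> lies in the 3 by 3 block of cells of level \<open>J\<close> around any of its
  points.\<close>

lemma null_dim_dyadic_cover:
  fixes A :: "(real \<times> real) set"
  assumes A: "null_dim a A" and a: "a > 0" and \<eta>: "\<eta> > 0"
  shows "\<exists>\<Q> :: cell set. (\<forall>p\<in>A. \<exists>Q\<in>\<Q>. cell_of (fst Q) p = snd Q) \<and>
    (\<forall>F. finite F \<longrightarrow> F \<subseteq> \<Q> \<longrightarrow> (\<Sum>Q\<in>F. side_powr a Q) \<le> \<eta>)"
proof -
  \<comment> \<open>The factor 18 is twice the number of cells in a 3 by 3 block. The bound 1/2 keeps the
    scales \<open>e i\<close> at most 1, where dyadic scales start.\<close>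
  define \<eta>1 where "\<eta>1 = min (1/2) (\<eta> / (18 * 2 powr a))"
  have \<eta>1: "\<eta>1 > 0" "\<eta>1 \<le> 1/2" "18 * 2 powr a * \<eta>1 \<le> \<eta>"
    using \<eta> by (auto simp: \<eta>1_def min_def field_simps)
  obtain U where U: "cheap_cover a \<eta>1 A U" using A \<eta>1(1) unfolding null_dim_def by blast
  note U = cheap_coverD[OF U]
  \<comment> \<open>The second summand gives a positive scale also to the sets of diameter 0.\<close>
  define h where "h i = diameter (U i) powr a + \<eta>1 * (1/2) ^ Suc i" for i
  have h_sum: "(\<Sum>i\<in>I. h i) \<le> 2 * \<eta>1" if "finite I" for I
    using U(3)[OF that] sum_geometric_half_le[of \<eta>1 I] that \<eta>1 by (simp add: h_def sum.distrib)
  have h0: "h i > 0" for i using \<eta>1 by (simp add: h_def add_nonneg_pos)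
  have h1: "h i \<le> 1" for i using h_sum[of "{i}"] \<eta>1 by simp
  define e where "e i = h i powr (1 / a)" for i
  have e0: "e i > 0" for i using h0[of i] by (simp add: e_def)
  have e1: "e i \<le> 1" for i using h0[of i] h1[of i] a powr_mono2[of "1/a" "h i" 1] by (simp add: e_def)
  have ea: "e i powr a = h i" for i using h0[of i] a by (simp add: e_def powr_powr)
  have de: "diameter (U i) \<le> e i" for i
  proof (rule ccontr)
    assume "\<not> ?thesis"
    then have "e i powr a < diameter (U i) powr a" using e0[of i] a by (intro powr_less_mono2) auto
    moreover have "0 < \<eta>1 * (1/2) ^ Suc i" using \<eta>1(1) by (intro mult_pos_pos) auto
    ultimately show False unfolding ea h_def by linarith
  qed
  have "\<forall>i. \<exists>J. e i \<le> (1/2) ^ J \<and> (1/2) ^ J < 2 * e i" using dyadic_scale[OF e0 e1] by blast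
  from choice[OF this] obtain J where "\<forall>i. e i \<le> (1/2) ^ J i \<and> (1/2) ^ J i < 2 * e i" ..
  then have J: "e i \<le> (1/2) ^ J i" "(1/2) ^ J i < 2 * e i" for i by simp_all
  have Ja: "2 powr (- a * real (J i)) \<le> 2 powr a * h i" for i
  proof -
    have "2 powr (- a * real (J i)) = ((1/2) ^ J i) powr a"
      by (simp add: powr_realpow[symmetric] powr_powr powr_minus_divide powr_divide power_one_over mult.commute)
    also have "\<dots> \<le> (2 * e i) powr a" using J(2)[of i] a by (intro powr_mono2) auto
    also have "\<dots> = 2 powr a * h i" using e0[of i] by (simp add: powr_mult ea)
    finally show ?thesis .
  qed
  define p where "p i = (SOME p. p \<in> U i)" for i
  define \<N> where "\<N> i = {J i} \<times> ({fst (cell_of (J i) (p i)) - 1..fst (cell_of (J i) (p i)) + 1} \<times>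
      {snd (cell_of (J i) (p i)) - 1..snd (cell_of (J i) (p i)) + 1})" for i
  have cardN: "finite (\<N> i)" "card (\<N> i) = 9" for i by (simp_all add: \<N>_def card_cartesian_product)
  show ?thesis
  proof (intro exI[of _ "\<Union>i. \<N> i"] conjI ballI allI impI)
    fix x assume "x \<in> A"
    then obtain i where i: "x \<in> U i" using U(1) by blast
    then have "p i \<in> U i" unfolding p_def by (rule someI)
    then have "dist x (p i) \<le> 1 * (1/2) ^ J i"
      using diameter_bounded_bound[OF U(2) i] de[of i] J(1)[of i] by fastforce
    then have "\<bar>fst x - fst (p i)\<bar> \<le> real 1 * (1/2) ^ J i" "\<bar>snd x - snd (p i)\<bar> \<le> real 1 * (1/2) ^ J i"
      using dist_fst_le[of x "p i"] dist_snd_le[of x "p i"] by (simp_all add: dist_real_def)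
    then have "(J i, cell_of (J i) x) \<in> \<N> i"
      using near_floor_scaled[of "fst x" "fst (p i)" 1 "J i"] near_floor_scaled[of "snd x" "snd (p i)" 1 "J i"]
      by (simp add: \<N>_def cell_of_def)
    then show "\<exists>Q\<in>\<Union>i. \<N> i. cell_of (fst Q) x = snd Q" by force
  next
    fix F assume F: "finite F" "F \<subseteq> (\<Union>i. \<N> i)"
    then obtain I where I: "finite I" "F \<subseteq> (\<Union>i\<in>I. \<N> i)"
      using finite_subset_Union[of F "range \<N>"] by (metis finite_subset_image subset_UNIV)
    have "(\<Sum>Q\<in>F. side_powr a Q) \<le> (\<Sum>Q\<in>(\<Union>i\<in>I. \<N> i). side_powr a Q)"
      using I cardN by (intro sum_mono2) auto
    also have "\<dots> \<le> (\<Sum>i\<in>I. \<Sum>Q\<in>\<N> i. side_powr a Q)"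
      using I cardN by (intro sum_UN_le) auto
    also have "\<dots> \<le> (\<Sum>i\<in>I. 9 * (2 powr a * h i))"
    proof (intro sum_mono)
      fix i
      have "(\<Sum>Q\<in>\<N> i. side_powr a Q) = (\<Sum>Q\<in>\<N> i. 2 powr (- a * real (J i)))"
        by (intro sum.cong refl) (auto simp: \<N>_def)
      then show "(\<Sum>Q\<in>\<N> i. side_powr a Q) \<le> 9 * (2 powr a * h i)" using Ja[of i] cardN(2)[of i] by simp
    qed
    also have "\<dots> = 9 * 2 powr a * (\<Sum>i\<in>I. h i)" by (simp add: sum_distrib_left mult.assoc)
    also have "\<dots> \<le> 9 * 2 powr a * (2 * \<eta>1)" by (intro mult_left_mono h_sum I) auto
    also have "\<dots> \<le> \<eta>" using \<eta>1(3) by simp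
    finally show "(\<Sum>Q\<in>F. side_powr a Q) \<le> \<eta>" .
  qed
qed

text \<open>A cheap dyadic cover, made sparse by passing to its maximal heavy squares.\<close>

lemma regular_dyadic_cover:
  fixes A :: "(real \<times> real) set"
  assumes A: "null_dim a A" and a: "a > 0" "a \<le> t" and \<eta>: "\<eta> > 0"
  obtains \<R> :: "cell set" where "\<And>p. p \<in> A \<Longrightarrow> \<exists>R\<in>\<R>. cell_of (fst R) p = snd R"
    "\<And>J. finite {c. (J, c) \<in> \<R>}" "\<And>J. real (card {c. (J, c) \<in> \<R>}) \<le> \<eta> * 2 powr (a * real J)"
    "\<And>J i e D. i \<le> J \<Longrightarrow> D \<subseteq> {c. (J, c) \<in> \<R> \<and> ancestor (J - i) c = e} \<Longrightarrow> real (card D) \<le> 2 powr (t * real (J - i))"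
proof -
  obtain \<Q> :: "cell set" where Q: "\<forall>p\<in>A. \<exists>Q\<in>\<Q>. cell_of (fst Q) p = snd Q"
    and Qs: "\<forall>F. finite F \<longrightarrow> F \<subseteq> \<Q> \<longrightarrow> (\<Sum>Q\<in>F. side_powr a Q) \<le> \<eta>"
    using null_dim_dyadic_cover[OF A a(1) \<eta>] by blast
  define \<R> where "\<R> = coarsen t \<Q>"
  have cov: "\<exists>R\<in>\<R>. cell_of (fst R) p = snd R" if p: "p \<in> A" for p
  proof -
    obtain Q where Q: "Q \<in> \<Q>" "cell_of (fst Q) p = snd Q" using bspec[OF Q p] by blast
    obtain R where R: "R \<in> \<R>" "Q \<sqsubseteq> R"
      using below_coarsen[OF heavy_member[OF Q(1), of t]] unfolding \<R>_def by blast
    have "cell_of (fst R) p = snd R"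
      using R(2) Q(2) ancestor_cell_of[of "fst Q - fst R" "fst Q" p] by (simp add: below_def)
    then show ?thesis using R(1) by blast
  qed
  have card_le: "real (card G) \<le> \<eta> * 2 powr (a * real J)" if "finite G" "G \<subseteq> {c. (J, c) \<in> \<R>}" for G J
  proof -
    have "(\<Sum>R\<in>Pair J ` G. side_powr a R) \<le> \<eta>"
      by (rule coarsen_sum[of \<Q> a \<eta> t]) (use Qs a that \<R>_def in auto)
    then have "real (card G) * 2 powr (- a * real J) \<le> \<eta>"
      by (subst (asm) sum.reindex) (auto simp: inj_on_def)
    then have "real (card G) * 2 powr (- a * real J) * 2 powr (a * real J) \<le> \<eta> * 2 powr (a * real J)"
      by (intro mult_right_mono) auto
    then show ?thesis by (simp add: mult.assoc flip: powr_add)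
  qed
  have fin: "finite {c. (J, c) \<in> \<R>}" for J
  proof (rule ccontr)
    assume inf: "infinite {c. (J, c) \<in> \<R>}"
    obtain n where n: "\<eta> * 2 powr (a * real J) < real n" using reals_Archimedean2 by blast
    obtain G where "G \<subseteq> {c. (J, c) \<in> \<R>}" "finite G" "card G = n"
      using infinite_arbitrarily_large[OF inf] by blast
    then show False using card_le[of G J] n by simp
  qed
  show thesis
  proof (rule that[of \<R>])
    show "real (card D) \<le> 2 powr (t * real (J - i))"
      if "i \<le> J" "D \<subseteq> {c. (J, c) \<in> \<R> \<and> ancestor (J - i) c = e}" for J i e D
    proof (rule coarsen_card)
      show "finite D" using that(2) fin[of J] by (auto intro: finite_subset)
      show "(J, c) \<in> coarsen t \<Q> \<and> ancestor (J - i) c = e" if "c \<in> D" for c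
        using that \<open>D \<subseteq> _\<close> unfolding \<R>_def by blast
    qed (rule that(1))
  qed (use cov fin card_le in auto)
qed

text \<open>Frostman's lemma on the cells of level \<open>J\<close> that contain parameters from \<open>P\<close>, with one line chosen from
  each of them. The lines near a given one, in the sense of the incidence estimate, lie in
  \<open>3 * 23 = 69\<close> cells of level \<open>i\<close>.\<close>

lemma frostman_lines:
  fixes P :: "(real \<times> real) set"
  assumes P: "\<forall>p\<in>P. cell_of 0 p = e0"
  shows "\<exists>L w (\<C> :: cell set). finite L \<and> L \<subseteq> P \<and> (\<forall>l\<in>L. 0 \<le> w l) \<and> (\<Sum>l\<in>L. w l) \<le> 1 \<and>
     (\<forall>l\<in>L. \<forall>i\<le>J. (\<Sum>l' | l' \<in> L \<and> \<bar>fst l - fst l'\<bar> \<le> (1/2) ^ i \<and> \<bar>snd l - snd l'\<bar> \<le> 11 * (1/2) ^ i. w l')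
        \<le> 69 * 2 powr (- v * real i)) \<and>
     finite \<C> \<and> (\<forall>p\<in>P. \<exists>Q\<in>\<C>. cell_of (fst Q) p = snd Q) \<and> (\<Sum>Q\<in>\<C>. side_powr v Q) \<le> (\<Sum>l\<in>L. w l)"
proof -
  define X where "X = cell_of J ` P"
  define \<rho> where "\<rho> k = 2 powr (- v * real (J - k))" for k
  have upX: "ancestor J c = e0" if "c \<in> X" for c
    using that P ancestor_cell_of[of J J] by (auto simp: X_def)
  have "X \<subseteq> {fst e0 * 2 ^ J..fst e0 * 2 ^ J + 2 ^ J} \<times> {snd e0 * 2 ^ J..snd e0 * 2 ^ J + 2 ^ J}"
  proof
    fix c assume "c \<in> X"
    then have "fst c div 2 ^ J = fst e0" "snd c div 2 ^ J = snd e0" using upX[of c] by (auto simp: ancestor_def)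
    moreover have "fst c = fst c div 2 ^ J * 2 ^ J + fst c mod 2 ^ J" "snd c = snd c div 2 ^ J * 2 ^ J + snd c mod 2 ^ J"
      by (rule div_mult_mod_eq[symmetric])+
    moreover have "0 \<le> fst c mod 2 ^ J" "fst c mod 2 ^ J < 2 ^ J" "0 \<le> snd c mod 2 ^ J" "snd c mod 2 ^ J < 2 ^ J"
      by simp_all
    ultimately have "fst c \<in> {fst e0 * 2 ^ J..fst e0 * 2 ^ J + 2 ^ J}" "snd c \<in> {snd e0 * 2 ^ J..snd e0 * 2 ^ J + 2 ^ J}"
      unfolding atLeastAtMost_iff by (smt (verit))+
    then show "c \<in> {fst e0 * 2 ^ J..fst e0 * 2 ^ J + 2 ^ J} \<times> {snd e0 * 2 ^ J..snd e0 * 2 ^ J + 2 ^ J}"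
      by (simp add: mem_Times_iff)
  qed
  then have finX: "finite X" by (rule finite_subset) auto
  have \<rho>: "\<rho> k > 0" for k by (simp add: \<rho>_def)
  obtain w \<C> where fw: "frostman_weight \<rho> X J e0 w \<C>"
    using dyadic_frostman[where \<rho> = \<rho> and d = J and c = e0, OF finX \<rho>] by blast
  have wC: "\<forall>f. 0 \<le> w f \<and> (w f > 0 \<longrightarrow> f \<in> X \<and> ancestor J f = e0)"
     "\<forall>k\<le>J. \<forall>e. (\<Sum>f | f \<in> X \<and> ancestor k f = e. w f) \<le> \<rho> k"
     "finite \<C>" "\<forall>(k,e)\<in>\<C>. k \<le> J"
     "\<forall>f\<in>X. ancestor J f = e0 \<longrightarrow> (\<exists>(k,e)\<in>\<C>. ancestor k f = e)"
     "(\<Sum>(k,e)\<in>\<C>. \<rho> k) \<le> (\<Sum>f\<in>X. w f)"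
    using fw unfolding frostman_weight_def by - (elim conjE, assumption)+
  define rep where "rep c = (SOME p. p \<in> P \<and> cell_of J p = c)" for c
  have rep: "rep c \<in> P" "cell_of J (rep c) = c" if "c \<in> X" for c
    using that someI_ex[of "\<lambda>p. p \<in> P \<and> cell_of J p = c"] unfolding X_def rep_def by auto
  have inj: "inj_on rep X" by (metis inj_onI rep(2))
  define L where "L = rep ` X"
  define w' where "w' l = w (cell_of J l)" for l
  \<comment> \<open>Heights above level \<open>J\<close> become levels.\<close>
  define \<D> where "\<D> = (\<lambda>(k, e). (J - k, e)) ` \<C>"
  have sumL: "(\<Sum>l\<in>L. w' l) = (\<Sum>c\<in>X. w c)"
    unfolding L_def w'_def by (subst sum.reindex[OF inj]) (simp add: rep)
  have w0: "0 \<le> w f" for f using wC(1) by blast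
  have Lrep: "cell_of J l' \<in> X" "rep (cell_of J l') = l'" if l': "l' \<in> L" for l'
  proof -
    obtain c where "c \<in> X" "l' = rep c" using l' unfolding L_def by blast
    then show "cell_of J l' \<in> X" "rep (cell_of J l') = l'" by (simp_all add: rep(2))
  qed
  show ?thesis
  proof (intro exI[of _ L] exI[of _ w'] exI[of _ \<D>] conjI ballI allI impI)
    show "finite L" "L \<subseteq> P" using finX rep by (auto simp: L_def)
    show "0 \<le> w' l" for l by (simp add: w'_def w0)
    have "{f. f \<in> X \<and> ancestor J f = e0} = X" using upX by auto
    then have "(\<Sum>c\<in>X. w c) \<le> \<rho> J" using wC(2)[rule_format, of J e0] by simp
    then show "(\<Sum>l\<in>L. w' l) \<le> 1" by (simp add: sumL \<rho>_def)
  next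
    fix l i assume l: "l \<in> L" and i: "i \<le> J"
    define S where "S = {l'. l' \<in> L \<and> \<bar>fst l - fst l'\<bar> \<le> (1/2) ^ i \<and> \<bar>snd l - snd l'\<bar> \<le> 11 * (1/2) ^ i}"
    define E where "E = {\<lfloor>2 ^ i * fst l\<rfloor> - int 1..\<lfloor>2 ^ i * fst l\<rfloor> + int 1} \<times> {\<lfloor>2 ^ i * snd l\<rfloor> - int 11..\<lfloor>2 ^ i * snd l\<rfloor> + int 11}"
    have injS: "inj_on (cell_of J) S"
      by (rule inj_on_inverseI[of _ rep]) (use Lrep S_def in blast)
    have sub: "cell_of J ` S \<subseteq> (\<Union>e\<in>E. {f. f \<in> X \<and> ancestor (J - i) f = e})"
    proof
      fix c assume "c \<in> cell_of J ` S"
      then obtain l' where l': "l' \<in> S" "c = cell_of J l'" by blast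
      have "c \<in> X" using l' Lrep(1) unfolding S_def by blast
      moreover have "ancestor (J - i) c = cell_of i l'" using i by (simp add: l'(2) ancestor_cell_of)
      moreover have "cell_of i l' \<in> E"
        using l'(1) near_floor_scaled[of "fst l'" "fst l" 1 i] near_floor_scaled[of "snd l'" "snd l" 11 i]
        by (simp add: S_def E_def cell_of_def abs_minus_commute)
      ultimately show "c \<in> (\<Union>e\<in>E. {f. f \<in> X \<and> ancestor (J - i) f = e})" by blast
    qed
    have "(\<Sum>l'\<in>S. w' l') = (\<Sum>c\<in>cell_of J ` S. w c)"
      unfolding w'_def by (rule sum.reindex[OF injS, symmetric, unfolded o_def])
    also have "\<dots> \<le> (\<Sum>c\<in>(\<Union>e\<in>E. {f. f \<in> X \<and> ancestor (J - i) f = e}). w c)"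
      using sub finX w0 by (intro sum_mono2) (auto simp: E_def)
    also have "\<dots> \<le> (\<Sum>e\<in>E. \<Sum>c | c \<in> X \<and> ancestor (J - i) c = e. w c)"
      using finX w0 by (intro sum_UN_le) (auto simp: E_def)
    also have "\<dots> \<le> (\<Sum>e\<in>E. 2 powr (- v * real i))"
    proof (intro sum_mono)
      fix e
      have "(\<Sum>c | c \<in> X \<and> ancestor (J - i) c = e. w c) \<le> \<rho> (J - i)"
        using wC(2)[rule_format, of "J - i" e] by simp
      then show "(\<Sum>c | c \<in> X \<and> ancestor (J - i) c = e. w c) \<le> 2 powr (- v * real i)" using i by (simp add: \<rho>_def)
    qed
    also have "\<dots> = 69 * 2 powr (- v * real i)" by (simp add: E_def card_cartesian_product)
    finally show "(\<Sum>l' | l' \<in> L \<and> \<bar>fst l - fst l'\<bar> \<le> (1/2) ^ i \<and> \<bar>snd l - snd l'\<bar> \<le> 11 * (1/2) ^ i. w' l')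
        \<le> 69 * 2 powr (- v * real i)" by (simp add: S_def)
  next
    show "finite \<D>" using wC(3) by (simp add: \<D>_def)
  next
    fix p assume p: "p \<in> P"
    then have "cell_of J p \<in> X" by (simp add: X_def)
    then obtain k e where ke: "(k, e) \<in> \<C>" "ancestor k (cell_of J p) = e" using wC(5) upX by blast
    then have "cell_of (J - k) p = e" using wC(4) ancestor_cell_of[of k J p] by auto
    then show "\<exists>Q\<in>\<D>. cell_of (fst Q) p = snd Q" using ke(1) by (force simp: \<D>_def)
  next
    have "(\<Sum>Q\<in>\<D>. side_powr v Q) \<le> (\<Sum>x\<in>\<C>. side_powr v (case x of (k, e) \<Rightarrow> (J - k, e)))"
      unfolding \<D>_def using wC(3) sum_image_le[of \<C> "side_powr v" "\<lambda>(k, e). (J - k, e)"] by (simp add: o_def)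
    also have "\<dots> = (\<Sum>(k,e)\<in>\<C>. \<rho> k)" by (intro sum.cong refl) (auto simp: \<rho>_def)
    also have "\<dots> \<le> (\<Sum>l\<in>L. w' l)" using wC(6) by (simp add: sumL)
    finally show "(\<Sum>Q\<in>\<D>. side_powr v Q) \<le> (\<Sum>l\<in>L. w' l)" .
  qed
qed

section \<open>Lines with large slices\<close>

text \<open>The part of \<open>A\<close> on a line, described by its abscissas. The restriction to one unit of length is
  harmless because the lower bound decomposes the plane into strips.\<close>

definition line_slice :: "(real \<times> real) set \<Rightarrow> real \<times> real \<Rightarrow> real set" where
  "line_slice A l = {x \<in> {0..<1}. (x, fst l * x + snd l) \<in> A}"

text \<open>The midpoint of the left edge of a cell.\<close>

definition cell_point :: "nat \<Rightarrow> int \<times> int \<Rightarrow> real \<times> real" where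
  "cell_point J c = (real_of_int (fst c) / 2 ^ J, (real_of_int (snd c) + 1/2) / 2 ^ J)"

lemma cell_of_cell_point: "cell_of J (cell_point J c) = c"
  by (simp add: cell_of_def cell_point_def prod_eq_iff floor_eq_iff)

text \<open>Moving to the left edge changes the height of the line by at most one side, since its slope is at
  most 1. The midpoint costs another half.\<close>

lemma cell_point_near_line:
  assumes "\<bar>m\<bar> \<le> 1" "cell_of J (x, m * x + k) = c"
  shows "\<bar>m * fst (cell_point J c) + k - snd (cell_point J c)\<bar> \<le> 3/2 * (1/2) ^ J"
proof -
  define s :: real where "s = 2 ^ J"
  have s: "s > 0" by (simp add: s_def)
  have c: "fst c = \<lfloor>s * x\<rfloor>" "snd c = \<lfloor>s * (m * x + k)\<rfloor>" using assms(2) by (auto simp: cell_of_def s_def)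
  have "\<bar>m * (s * x - fst c)\<bar> \<le> 1 * 1"
    unfolding abs_mult using assms(1) by (intro mult_mono) (auto simp: c abs_le_iff intro: less_imp_le, linarith+)
  moreover have "\<bar>s * (m * x + k) - snd c - 1/2\<bar> \<le> 1/2" unfolding c by linarith
  moreover have "s * (m * fst (cell_point J c) + k - snd (cell_point J c))
     = (s * (m * x + k) - snd c - 1/2) - m * (s * x - fst c)"
    using s by (simp add: cell_point_def s_def[symmetric] field_simps)
  ultimately have "\<bar>s * (m * fst (cell_point J c) + k - snd (cell_point J c))\<bar> \<le> 3/2" by linarith
  then have "s * \<bar>m * fst (cell_point J c) + k - snd (cell_point J c)\<bar> \<le> 3/2" using s by (simp add: abs_mult)
  then show ?thesis using s by (simp add: s_def power_one_over field_simps)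
qed

lemma card_le_by_fibers:
  fixes f :: "'c \<Rightarrow> 'e"
  assumes "finite E" "\<And>c. c \<in> G \<Longrightarrow> f c \<in> E" "\<And>e. e \<in> E \<Longrightarrow> real (card {c\<in>G. f c = e}) \<le> n" "n \<ge> 0"
  shows "real (card G) \<le> real (card E) * n"
proof -
  have "G = (\<Union>e\<in>E. {c\<in>G. f c = e})" using assms(2) by blast
  then have "card G \<le> (\<Sum>e\<in>E. card {c\<in>G. f c = e})"
    using card_UN_le[OF assms(1), of "\<lambda>e. {c\<in>G. f c = e}"] by simp
  then have "real (card G) \<le> (\<Sum>e\<in>E. real (card {c\<in>G. f c = e}))" by (simp flip: of_nat_sum)
  also have "\<dots> \<le> (\<Sum>e\<in>E. n)" by (intro sum_mono assms)
  finally show ?thesis by simp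
qed

definition met_cells :: "(int \<times> int) set \<Rightarrow> nat \<Rightarrow> real \<times> real \<Rightarrow> (int \<times> int) set" where
  "met_cells D J l = {c\<in>D. \<exists>x\<in>{0..<1}. cell_of J (x, fst l * x + snd l) = c}"

text \<open>The incidence estimate at one level, combined with Frostman's lemma. Among the given cells only
  those that meet a chosen line are kept. This confines them to the strip \<open>0 \<le> x < 1\<close> and to three unit
  squares. A box of side \<open>2\<^sup>-\<^sup>j\<close> meets at most four cells of level \<open>j\<close>, hence the constant 4.\<close>

lemma level_cover:
  fixes P :: "(real \<times> real) set" and D :: "(int \<times> int) set"
  assumes C: "\<And>J L w D z M. admissible_data v t 69 4 J L w D z \<Longrightarrow> M \<ge> 0 \<Longrightarrow>
      (\<And>l. l \<in> L \<Longrightarrow> M \<le> real (card {c\<in>D. \<bar>fst l * fst (z c) + snd l - snd (z c)\<bar> \<le> 3/2 * (1/2) ^ J})) \<Longrightarrow>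
      (\<Sum>l\<in>L. w l) * M\<^sup>2 \<le> C * real (card D) * 2 powr ((1 - v) * real J)"
    and C0: "C \<ge> 0"
    and P: "\<And>p. p \<in> P \<Longrightarrow> cell_of 0 p = e0" "\<And>p. p \<in> P \<Longrightarrow> \<bar>fst p\<bar> \<le> 1"
    and D: "finite D" "\<And>i e G. i \<le> J \<Longrightarrow> G \<subseteq> {c\<in>D. ancestor (J - i) c = e} \<Longrightarrow> real (card G) \<le> 2 powr (t * real (J - i))"
    and M: "M > 0" "\<And>p. p \<in> P \<Longrightarrow> M \<le> real (card (met_cells D J p))"
  shows "\<exists>\<C> :: cell set. finite \<C> \<and> (\<forall>p\<in>P. \<exists>Q\<in>\<C>. cell_of (fst Q) p = snd Q) \<and>
     (\<Sum>Q\<in>\<C>. side_powr v Q) \<le> C * real (card D) * 2 powr ((1 - v) * real J) / M\<^sup>2"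
proof -
  have P0: "\<forall>p\<in>P. cell_of 0 p = e0" using P(1) by blast
  obtain L w and \<C> :: "cell set" where L: "finite L" "L \<subseteq> P" "\<forall>l\<in>L. 0 \<le> w l" "(\<Sum>l\<in>L. w l) \<le> 1"
     "\<forall>l\<in>L. \<forall>i\<le>J. (\<Sum>l' | l' \<in> L \<and> \<bar>fst l - fst l'\<bar> \<le> (1/2) ^ i \<and> \<bar>snd l - snd l'\<bar> \<le> 11 * (1/2) ^ i. w l')
        \<le> 69 * 2 powr (- v * real i)"
    and \<C>: "finite \<C>" "\<forall>p\<in>P. \<exists>Q\<in>\<C>. cell_of (fst Q) p = snd Q" "(\<Sum>Q\<in>\<C>. side_powr v Q) \<le> (\<Sum>l\<in>L. w l)"
    using frostman_lines[of P e0 J v, OF P0]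
    by (elim exE conjE) (rule that)
  define D' where "D' = (\<Union>l\<in>L. met_cells D J l)"
  define z where "z = cell_point J"
  have D'D: "D' \<subseteq> D" by (auto simp: D'_def met_cells_def)
  then have finD': "finite D'" using D(1) finite_subset by blast
  have meet: "\<exists>l x. l \<in> L \<and> x \<in> {0..<1} \<and> cell_of J (x, fst l * x + snd l) = c" if "c \<in> D'" for c
    using that unfolding D'_def met_cells_def by blast
  have fst_z: "fst (z c) \<in> {0..1}" if c: "c \<in> D'" for c
  proof -
    obtain l x where x: "x \<in> {0..<1}" "cell_of J (x, fst l * x + snd l) = c" using meet[OF c] by blast
    have "fst c = \<lfloor>2 ^ J * x\<rfloor>" using x(2) by (auto simp: cell_of_def)
    then have "real_of_int (fst c) \<le> 2 ^ J * x" "0 \<le> fst c" using x(1) by auto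
    moreover have "2 ^ J * x \<le> 2 ^ J" using x(1) by simp
    ultimately have "real_of_int (fst c) \<le> 2 ^ J" "0 \<le> fst c" by linarith+
    then show ?thesis by (simp add: z_def cell_point_def)
  qed
  have up_z: "ancestor (J - i) c = cell_of i (z c)" if "i \<le> J" for i c
    using ancestor_cell_of[of "J - i" J "z c"] that by (simp add: z_def cell_of_cell_point)
  have fiber: "real (card {c\<in>D'. c \<in> G \<and> ancestor (J - i) c = e}) \<le> 2 powr (t * real (J - i))" if "i \<le> J" for G i e
    by (rule D(2)[OF that, where e = e]) (use D'D in blast)
  have cardD': "real (card D') \<le> 4 * 2 powr (t * real J)"
  proof -
    \<comment> \<open>Over \<open>0 \<le> x < 1\<close> a line of slope at most 1 stays within three unit squares.\<close>
    define E where "E = {0::int} \<times> {snd e0 - 1..snd e0 + 1}"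
    have "real (card D') \<le> real (card E) * 2 powr (t * real (J - 0))"
    proof (rule card_le_by_fibers[where f = "ancestor (J - 0)"])
      fix c assume c: "c \<in> D'"
      obtain l x where lx: "l \<in> L" "x \<in> {0..<1}" "cell_of J (x, fst l * x + snd l) = c" using meet[OF c] by blast
      have l: "cell_of 0 l = e0" "\<bar>fst l\<bar> \<le> 1" using lx(1) L(2) P by blast+
      have "ancestor (J - 0) c = cell_of 0 (x, fst l * x + snd l)" using lx(3) ancestor_cell_of[of J J] by auto
      moreover have "\<bar>fst l * x\<bar> \<le> 1 * 1" unfolding abs_mult using l(2) lx(2) by (intro mult_mono) auto
      moreover have "\<lfloor>snd l\<rfloor> = snd e0" using l(1) by (auto simp: cell_of_def)
      moreover have "\<lfloor>x\<rfloor> = 0" using lx(2) by (simp add: floor_eq_iff)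
      ultimately show "ancestor (J - 0) c \<in> E" by (simp add: E_def cell_of_def) linarith
    next
      show "real (card {c\<in>D'. ancestor (J - 0) c = e}) \<le> 2 powr (t * real (J - 0))" for e
        using fiber[of 0 UNIV e] by simp
    qed (auto simp: E_def)
    also have "\<dots> \<le> 4 * 2 powr (t * real J)" by (simp add: E_def)
    finally show ?thesis .
  qed
  have column: "real (card {c\<in>D'. x \<in> {fst (z c)..fst (z c) + 1/2^j} \<and> y \<in> {snd (z c)..snd (z c) + 1/2^j}})
        \<le> 4 * 2 powr (t * real (J - j))" if j: "j \<le> J" for j x y
  proof -
    define G where "G = {c\<in>D'. x \<in> {fst (z c)..fst (z c) + 1/2^j} \<and> y \<in> {snd (z c)..snd (z c) + 1/2^j}}"
    define E where "E = {\<lfloor>2 ^ j * x\<rfloor> - 1..\<lfloor>2 ^ j * x\<rfloor>} \<times> {\<lfloor>2 ^ j * y\<rfloor> - 1..\<lfloor>2 ^ j * y\<rfloor>}"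
    have fl: "\<lfloor>2 ^ j * a\<rfloor> \<in> {\<lfloor>2 ^ j * b\<rfloor> - 1..\<lfloor>2 ^ j * b\<rfloor>}" if "b \<in> {a..a + 1/2^j}" for a b :: real
    proof -
      have "2 ^ j * a \<le> 2 ^ j * b" "2 ^ j * b \<le> 2 ^ j * (a + 1/2^j)" using that by (auto intro!: mult_left_mono)
      moreover have "2 ^ j * (a + 1/2^j) = 2 ^ j * a + 1" by (simp add: distrib_left)
      ultimately have "\<lfloor>2 ^ j * b\<rfloor> - 1 \<le> \<lfloor>2 ^ j * a\<rfloor>" "\<lfloor>2 ^ j * a\<rfloor> \<le> \<lfloor>2 ^ j * b\<rfloor>" by linarith+
      then show ?thesis by simp
    qed
    have "real (card G) \<le> real (card E) * 2 powr (t * real (J - j))"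
    proof (rule card_le_by_fibers[where f = "ancestor (J - j)"])
      show "ancestor (J - j) c \<in> E" if "c \<in> G" for c
        using that fl[of x "fst (z c)"] fl[of y "snd (z c)"] by (simp add: up_z[OF j] E_def G_def cell_of_def)
      have "{c\<in>G. ancestor (J - j) c = e} = {c\<in>D'. c \<in> G \<and> ancestor (J - j) c = e}" for e by (auto simp: G_def)
      then show "real (card {c\<in>G. ancestor (J - j) c = e}) \<le> 2 powr (t * real (J - j))" for e
        using fiber[OF j, of G e] by simp
    qed (auto simp: E_def)
    also have "\<dots> = 4 * 2 powr (t * real (J - j))" by (simp add: E_def card_cartesian_product)
    finally show ?thesis by (simp add: G_def)
  qed
  have slope: "\<bar>fst l - fst l'\<bar> \<le> 1" if "l \<in> L" "l' \<in> L" for l l'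
  proof -
    have "cell_of 0 l = cell_of 0 l'" using that L(2) P(1) by (metis subsetD)
    then show ?thesis using same_floor_scaled[of 0 "fst l" "fst l'"] by (simp add: cell_of_def)
  qed
  have "admissible_data v t 69 4 J L w D' z"
    unfolding admissible_data_def
    using L P slope finD' fst_z cardD' column by (intro conjI ballI allI impI) (auto simp del: split_paired_All split_paired_Ex)
  then have "(\<Sum>l\<in>L. w l) * M\<^sup>2 \<le> C * real (card D') * 2 powr ((1 - v) * real J)"
  proof (rule C)
    fix l assume l: "l \<in> L"
    have sub: "met_cells D J l \<subseteq> {c\<in>D'. \<bar>fst l * fst (z c) + snd l - snd (z c)\<bar> \<le> 3/2 * (1/2) ^ J}"
    proof
      fix c assume c: "c \<in> met_cells D J l"
      then obtain x where "cell_of J (x, fst l * x + snd l) = c" by (auto simp: met_cells_def)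
      from cell_point_near_line[OF _ this] have "\<bar>fst l * fst (z c) + snd l - snd (z c)\<bar> \<le> 3/2 * (1/2) ^ J"
        using l L(2) P(2) unfolding z_def by blast
      then show "c \<in> {c\<in>D'. \<bar>fst l * fst (z c) + snd l - snd (z c)\<bar> \<le> 3/2 * (1/2) ^ J}"
        using c l unfolding D'_def by blast
    qed
    have "M \<le> real (card (met_cells D J l))" using l M(2) L(2) by blast
    also have "real (card (met_cells D J l)) \<le> real (card {c\<in>D'. \<bar>fst l * fst (z c) + snd l - snd (z c)\<bar> \<le> 3/2 * (1/2) ^ J})"
      using finD' sub by (intro of_nat_mono card_mono) auto
    finally show "M \<le> real (card {c\<in>D'. \<bar>fst l * fst (z c) + snd l - snd (z c)\<bar> \<le> 3/2 * (1/2) ^ J})" .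
  qed (use M in simp)
  also have "\<dots> \<le> C * real (card D) * 2 powr ((1 - v) * real J)"
    using D'D D(1) C0 by (intro mult_right_mono mult_left_mono of_nat_mono card_mono) auto
  finally have "(\<Sum>l\<in>L. w l) \<le> C * real (card D) * 2 powr ((1 - v) * real J) / M\<^sup>2"
    using M(1) by (simp add: pos_le_divide_eq)
  then show ?thesis using \<C> order_trans by blast
qed

lemma cheap_cover_mono: "cheap_cover s \<eta> X U \<Longrightarrow> \<eta> \<le> \<eta>' \<Longrightarrow> cheap_cover s \<eta>' X U"
  unfolding cheap_cover_def by (meson order_trans)

lemma sum_Sigma_le:
  fixes g :: "'a \<Rightarrow> 'b \<Rightarrow> real"
  assumes "finite F" "F \<subseteq> Sigma UNIV S" "\<And>j. finite (S j)" "\<And>j x. 0 \<le> g j x"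
  shows "(\<Sum>p\<in>F. g (fst p) (snd p)) \<le> (\<Sum>j\<in>fst ` F. \<Sum>x\<in>S j. g j x)"
proof -
  have "(\<Sum>p\<in>F. g (fst p) (snd p)) \<le> (\<Sum>p\<in>Sigma (fst ` F) S. g (fst p) (snd p))"
  proof (rule sum_mono2)
    show "finite (Sigma (fst ` F) S)" using assms by auto
    show "F \<subseteq> Sigma (fst ` F) S"
    proof
      fix p assume p: "p \<in> F"
      then have "snd p \<in> S (fst p)" using assms(2) by auto
      moreover have "fst p \<in> fst ` F" using p by (rule imageI)
      ultimately have "(fst p, snd p) \<in> Sigma (fst ` F) S" by (intro SigmaI)
      then show "p \<in> Sigma (fst ` F) S" by simp
    qed
  qed (use assms in auto)
  also have "\<dots> = (\<Sum>j\<in>fst ` F. \<Sum>x\<in>S j. g j x)"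
    using assms by (subst sum.Sigma) (auto simp: split_def)
  finally show ?thesis .
qed

lemma sum_geometric_le:
  fixes q :: real
  assumes "0 \<le> q" "q < 1" "finite F"
  shows "(\<Sum>j\<in>F. q ^ j) \<le> 1 / (1 - q)"
  using sum_le_suminf[OF summable_geometric, of q F] assms by (simp add: suminf_geometric)

text \<open>Pigeonholing over the levels, in contrapositive form: if on every level the line meets few cells, then
  the cells that it meets give a cheap cover of its slice.\<close>

lemma slice_cheap_cover:
  assumes u: "u > 0" and q: "0 \<le> q" "q < 1" and \<kappa>: "\<kappa> \<ge> 0"
    and cov: "\<And>p. p \<in> A \<Longrightarrow> \<exists>J c. c \<in> D J \<and> cell_of J p = c"
    and finD: "\<And>J. finite (D J)"
    and few: "\<And>J. real (card (met_cells (D J) J l)) \<le> \<kappa> * q ^ J * 2 powr (u * real J)"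
  shows "\<exists>U. cheap_cover u (\<kappa> / (1 - q)) (line_slice A l) U"
proof -
  define V where "V p = {x\<in>{0..<1}. cell_of (fst p) (x, fst l * x + snd l) = snd p}" for p :: cell
  define I where "I = Sigma UNIV (\<lambda>J. met_cells (D J) J l)"
  show ?thesis
  proof (rule cheap_cover_countable[where I = I and V = V])
    show "line_slice A l \<subseteq> (\<Union>p\<in>I. V p)"
    proof
      fix x assume x: "x \<in> line_slice A l"
      then obtain J c where Jc: "c \<in> D J" "cell_of J (x, fst l * x + snd l) = c"
        using cov unfolding line_slice_def by blast
      have x01: "x \<in> {0..<1}" using x by (simp add: line_slice_def)
      have "(J, c) \<in> I"
        unfolding I_def met_cells_def using Jc x01 by blast
      then show "x \<in> (\<Union>p\<in>I. V p)"
        by (rule UN_I) (use Jc x01 in \<open>simp add: V_def\<close>)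
    qed
    show bdd: "bounded (V p)" for p
      by (rule bounded_subset[of "{0..1}"]) (auto simp: V_def)
    have diam: "diameter (V p) \<le> (1/2) ^ fst p" for p :: cell
    proof (rule diameter_le)
      fix x y assume "x \<in> V p"
        "y \<in> V p"
      then have "cell_of (fst p) (x, fst l * x + snd l) = cell_of (fst p) (y, fst l * y + snd l)" by (simp add: V_def)
      then have "\<lfloor>2 ^ fst p * x\<rfloor> = \<lfloor>2 ^ fst p * y\<rfloor>" by (simp add: cell_of_def)
      then show "norm (x - y) \<le> (1/2) ^ fst p" using same_floor_scaled by simp
    qed simp
    fix F assume F: "finite F" "F \<subseteq> I"
    have half: "((1/2) ^ J) powr u = 2 powr (- (u * real J))" for J :: nat
      by (simp add: powr_realpow[symmetric] powr_powr powr_minus_divide powr_divide power_one_over mult.commute)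
    have "(\<Sum>p\<in>F. diameter (V p) powr u)
       \<le> (\<Sum>p\<in>F. ((1/2) ^ fst p) powr u)"
      by (intro sum_mono powr_mono2 diam diameter_ge_0 bdd) (use u in simp)
    also have "\<dots> \<le> (\<Sum>J\<in>fst ` F. \<Sum>c\<in>met_cells (D J) J l. ((1/2) ^ J) powr u)"
      by (rule sum_Sigma_le[OF F(1) F(2)[unfolded I_def], where g = "\<lambda>J c. ((1/2) ^ J) powr u"]) (use finD in \<open>simp_all add: met_cells_def\<close>)
    also have "\<dots> \<le> (\<Sum>J\<in>fst ` F. \<kappa> * q ^ J)"
    proof (rule sum_mono)
      fix J
      have "(\<Sum>c\<in>met_cells (D J) J l. ((1/2) ^ J) powr u) = real (card (met_cells (D J) J l)) * 2 powr (- (u * real J))"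
        by (simp add: half)
      also have "\<dots> \<le> (\<kappa> * q ^ J * 2 powr (u * real J)) * 2 powr (- (u * real J))"
        by (intro mult_right_mono few) auto
      also have "\<dots> = \<kappa> * q ^ J" by (simp add: mult.assoc flip: powr_add)
      finally show "(\<Sum>c\<in>met_cells (D J) J l. ((1/2) ^ J) powr u) \<le> \<kappa> * q ^ J" .
    qed
    also have "\<dots> = \<kappa> * (\<Sum>J\<in>fst ` F. q ^ J)" by (simp add: sum_distrib_left)
    also have "\<dots> \<le> \<kappa> * (1 / (1 - q))"
      by (intro mult_left_mono sum_geometric_le q \<kappa>) (use F in auto)
    finally show "(\<Sum>p\<in>F. diameter (V p) powr u) \<le> \<kappa> / (1 - q)"
      by simp
  qed
qed

text \<open>Every line of \<open>P\<close> meets many cells of the sparse cover on some level. The lines that do so on level \<open>J\<close>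
  are covered by lemma \<open>level_cover\<close>, and the costs of these covers decay geometrically in \<open>J\<close>. They are
  proportional to the cost of the cover of \<open>A\<close>, which is arbitrarily small.\<close>

theorem null_dim_of_rich_lines:
  fixes A P :: "(real \<times> real) set"
  assumes uv: "0 < u" "0 < v" "u + v < 2" and a: "0 < a" "a < 2 * u + v - 1"
    and A: "null_dim a A"
    and P: "\<And>p. p \<in> P \<Longrightarrow> cell_of 0 p = e0" "\<And>p. p \<in> P \<Longrightarrow> \<bar>fst p\<bar> \<le> 1"
      "\<And>p. p \<in> P \<Longrightarrow> \<not> null_dim u (line_slice A p)"
  shows "null_dim v P"
proof -
  define t where "t = 1 + u"
  \<comment> \<open>The incidence estimate leaves room for \<open>2\<^bsup>-3\<epsilon>J\<^esup>\<close>. Two of these factors pay for the pigeonholing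
    over \<open>J\<close>, and the third makes the final sum over \<open>J\<close> converge.\<close>
  define \<epsilon> where "\<epsilon> = (2 * u + v - 1 - a) / 3"
  define q where "q = 2 powr (- \<epsilon>)"
  have \<epsilon>: "\<epsilon> > 0" using a by (simp add: \<epsilon>_def)
  have q: "0 < q" "q < 1" using \<epsilon> powr_less_mono[of "- \<epsilon>" 0 2] by (auto simp: q_def)
  have qpow: "q ^ J = 2 powr (- \<epsilon> * real J)" for J
    by (simp add: q_def powr_powr flip: powr_realpow)
  have v2: "v < 2" "v + t < 3" using uv by (auto simp: t_def)
  obtain C where C0: "C \<ge> 0" and C: "\<And>J L w D z M. admissible_data v t 69 4 J L w D z \<Longrightarrow> M \<ge> 0 \<Longrightarrow>
      (\<And>l. l \<in> L \<Longrightarrow> M \<le> real (card {c\<in>D. \<bar>fst l * fst (z c) + snd l - snd (z c)\<bar> \<le> 3/2 * (1/2) ^ J})) \<Longrightarrow>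
      (\<Sum>l\<in>L. w l) * M\<^sup>2 \<le> C * real (card D) * 2 powr ((1 - v) * real J)"
    using incidence_bound[OF v2, of 69 4] by auto
  \<comment> \<open>A set that is not null has covering sums bounded away from 0, but not uniformly in the line.\<close>
  define P_large where "P_large n = {p\<in>P. \<not> (\<exists>U. cheap_cover u (1 / real (Suc n)) (line_slice A p) U)}" for n
  have "null_dim v (P_large n)" for n
    unfolding null_dim_def
  proof (intro allI impI)
    fix \<eta> :: real assume \<eta>: "\<eta> > 0"
    define \<kappa> where "\<kappa> = (1 - q) / real (Suc n)"
    define \<eta>' where "\<eta>' = \<eta> * \<kappa>\<^sup>2 * (1 - q) / (2 powr v * (C + 1))"
    have \<kappa>: "\<kappa> > 0" using q by (simp add: \<kappa>_def)
    have \<eta>': "\<eta>' > 0" using \<eta> \<kappa> q C0 by (simp add: \<eta>'_def)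
    have at: "a \<le> t" using a uv by (simp add: t_def)
    obtain \<R> :: "cell set" where cov: "\<And>p. p \<in> A \<Longrightarrow> \<exists>R\<in>\<R>. cell_of (fst R) p = snd R"
      and fin: "\<And>J. finite {c. (J, c) \<in> \<R>}"
      and cardD: "\<And>J. real (card {c. (J, c) \<in> \<R>}) \<le> \<eta>' * 2 powr (a * real J)"
      and reg: "\<And>J i e D. i \<le> J \<Longrightarrow> D \<subseteq> {c. (J, c) \<in> \<R> \<and> ancestor (J - i) c = e} \<Longrightarrow> real (card D) \<le> 2 powr (t * real (J - i))"
      by (rule regular_dyadic_cover[OF A a(1) at \<eta>']) (rule that)
    define D where "D J = {c. (J, c) \<in> \<R>}" for J
    define M where "M J = \<kappa> * q ^ J * 2 powr (u * real J)" for J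
    have M: "M J > 0" for J using \<kappa> q by (simp add: M_def)
    define P_level where "P_level J = {p\<in>P_large n. M J \<le> real (card (met_cells (D J) J p))}" for J
    have P_level_cover: "\<exists>J. p \<in> P_level J" if p: "p \<in> P_large n" for p
    proof (rule ccontr)
      assume neg: "\<nexists>J. p \<in> P_level J"
      have "\<exists>U. cheap_cover u (\<kappa> / (1 - q)) (line_slice A p) U"
      proof (rule slice_cheap_cover[where D = D])
        show "\<exists>J c. c \<in> D J \<and> cell_of J x = c" if x: "x \<in> A" for x
        proof -
          obtain R where "R \<in> \<R>" "cell_of (fst R) x = snd R" using cov[OF x] by blast
          then have "snd R \<in> D (fst R) \<and> cell_of (fst R) x = snd R" by (simp add: D_def)
          then show ?thesis by blast
        qed
        show "real (card (met_cells (D J) J p)) \<le> \<kappa> * q ^ J * 2 powr (u * real J)" for J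
          using neg p unfolding P_level_def M_def[symmetric] by (simp add: not_le less_imp_le)
      qed (use uv q \<kappa> fin in \<open>auto simp: D_def\<close>)
      moreover have "\<kappa> / (1 - q) = 1 / real (Suc n)" using q by (simp add: \<kappa>_def)
      ultimately show False using p by (simp add: P_large_def)
    qed
    have "\<exists>\<C> :: cell set. finite \<C> \<and> (\<forall>p\<in>P_level J. \<exists>Q\<in>\<C>. cell_of (fst Q) p = snd Q) \<and>
     (\<Sum>Q\<in>\<C>. side_powr v Q) \<le> C * real (card (D J)) * 2 powr ((1 - v) * real J) / (M J)\<^sup>2" for J
    proof (rule level_cover[OF C C0])
      show "real (card G) \<le> 2 powr (t * real (J - i))" if "i \<le> J" "G \<subseteq> {c\<in>D J. ancestor (J - i) c = e}" for i e G
        by (rule reg[OF that(1), of _ e]) (use that(2) D_def in blast)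
    qed (use P fin M in \<open>auto simp: P_level_def P_large_def D_def\<close>)
    then have "\<forall>J. \<exists>\<C> :: cell set. finite \<C> \<and> (\<forall>p\<in>P_level J. \<exists>Q\<in>\<C>. cell_of (fst Q) p = snd Q) \<and>
     (\<Sum>Q\<in>\<C>. side_powr v Q) \<le> C * real (card (D J)) * 2 powr ((1 - v) * real J) / (M J)\<^sup>2" ..
    from choice[OF this] obtain \<C> :: "nat \<Rightarrow> cell set" where
      "\<forall>J. finite (\<C> J) \<and> (\<forall>p\<in>P_level J. \<exists>Q\<in>\<C> J. cell_of (fst Q) p = snd Q) \<and>
     (\<Sum>Q\<in>\<C> J. side_powr v Q) \<le> C * real (card (D J)) * 2 powr ((1 - v) * real J) / (M J)\<^sup>2" ..
    then have \<C>: "\<And>J. finite (\<C> J)" "\<And>J. \<forall>p\<in>P_level J. \<exists>Q\<in>\<C> J. cell_of (fst Q) p = snd Q"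
      "\<And>J. (\<Sum>Q\<in>\<C> J. side_powr v Q) \<le> C * real (card (D J)) * 2 powr ((1 - v) * real J) / (M J)\<^sup>2" by simp_all
    have level_sum: "(\<Sum>Q\<in>\<C> J. side_powr v Q) \<le> C * \<eta>' / \<kappa>\<^sup>2 * q ^ J" for J
    proof -
      note \<C>(3)[of J]
      also have "C * real (card (D J)) * 2 powr ((1 - v) * real J) / (M J)\<^sup>2
         \<le> C * (\<eta>' * 2 powr (a * real J)) * 2 powr ((1 - v) * real J) / (M J)\<^sup>2"
        using cardD[of J] C0 by (intro divide_right_mono mult_right_mono mult_left_mono) (auto simp: D_def)
      also have "\<dots> = C * \<eta>' / \<kappa>\<^sup>2 * (2 powr (a * real J) * 2 powr ((1 - v) * real J) / (q ^ J * 2 powr (u * real J))\<^sup>2)"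
        by (simp add: M_def power_mult_distrib mult.assoc)
      also have "2 powr (a * real J) * 2 powr ((1 - v) * real J) / (q ^ J * 2 powr (u * real J))\<^sup>2 = q ^ J"
        unfolding qpow power2_eq_square powr_add[symmetric] powr_diff[symmetric]
        by (intro arg_cong[of _ _ "\<lambda>x. 2 powr x"]) (simp add: \<epsilon>_def field_simps)
      finally show ?thesis .
    qed
    show "\<exists>U. cheap_cover v \<eta> (P_large n) U"
    proof (rule cheap_cover_countable[where I = "Sigma UNIV \<C>" and V = "\<lambda>x. {p. cell_of (fst (snd x)) p = snd (snd x)}"])
      show "P_large n \<subseteq> (\<Union>x\<in>Sigma UNIV \<C>. {p. cell_of (fst (snd x)) p = snd (snd x)})"
      proof
        fix p assume "p \<in> P_large n"
        then obtain J where "p \<in> P_level J" using P_level_cover by blast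
        then obtain Q where Q: "Q \<in> \<C> J" "cell_of (fst Q) p = snd Q" using \<C>(2) by blast
        have "(J, Q) \<in> Sigma UNIV \<C>" using Q(1) by blast
        then show "p \<in> (\<Union>x\<in>Sigma UNIV \<C>. {p. cell_of (fst (snd x)) p = snd (snd x)})"
          by (rule UN_I) (use Q(2) in simp)
      qed
      show "bounded {p. cell_of (fst (snd x)) p = snd (snd x)}" for x :: "nat \<times> cell" by (rule cell_bounded)
      fix F :: "(nat \<times> cell) set" assume F: "finite F" "F \<subseteq> Sigma UNIV \<C>"
      have diam: "diameter {p. cell_of (fst Q) p = snd Q} powr v \<le> 2 powr v * side_powr v Q" for Q :: cell
      proof -
        have "diameter {p. cell_of (fst Q) p = snd Q} powr v \<le> (2 * (1/2) ^ fst Q) powr v"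
          by (intro powr_mono2 cell_diameter diameter_ge_0 cell_bounded) (use uv in auto)
        also have "\<dots> = 2 powr v * side_powr v Q"
          by (simp add: powr_mult powr_realpow[symmetric] powr_powr powr_minus_divide powr_divide power_one_over mult.commute)
        finally show ?thesis .
      qed
      have "(\<Sum>x\<in>F. diameter {p. cell_of (fst (snd x)) p = snd (snd x)} powr v)
         \<le> (\<Sum>x\<in>F. 2 powr v * side_powr v (snd x))"
        by (intro sum_mono diam)
      also have "\<dots> \<le> (\<Sum>J\<in>fst ` F. \<Sum>Q\<in>\<C> J. 2 powr v * side_powr v Q)"
        by (rule sum_Sigma_le[OF F \<C>(1), where g = "\<lambda>J Q. 2 powr v * side_powr v Q"]) simp
      also have "\<dots> \<le> (\<Sum>J\<in>fst ` F. 2 powr v * (C * \<eta>' / \<kappa>\<^sup>2 * q ^ J))"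
      proof (rule sum_mono)
        fix J
        have "(\<Sum>Q\<in>\<C> J. 2 powr v * side_powr v Q) = 2 powr v * (\<Sum>Q\<in>\<C> J. side_powr v Q)"
          by (rule sum_distrib_left[symmetric])
        also have "\<dots> \<le> 2 powr v * (C * \<eta>' / \<kappa>\<^sup>2 * q ^ J)" by (intro mult_left_mono level_sum) simp
        finally show "(\<Sum>Q\<in>\<C> J. 2 powr v * side_powr v Q) \<le> 2 powr v * (C * \<eta>' / \<kappa>\<^sup>2 * q ^ J)" .
      qed
      also have "\<dots> = 2 powr v * (C * \<eta>' / \<kappa>\<^sup>2) * (\<Sum>J\<in>fst ` F. q ^ J)"
        by (simp add: sum_distrib_left mult.assoc)
      also have "\<dots> \<le> 2 powr v * (C * \<eta>' / \<kappa>\<^sup>2) * (1 / (1 - q))"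
        using F q C0 \<eta>' by (intro mult_left_mono sum_geometric_le) auto
      also have "\<dots> = \<eta> * (C / (C + 1))"
      proof -
        have "Z * (C * (\<eta> * X * Y / (Z * E)) / X) * (1 / Y) = \<eta> * (C / E)"
          if "X \<noteq> 0" "Y \<noteq> 0" "Z \<noteq> 0" "E \<noteq> 0" for X Y Z E :: real
          using that by (simp add: field_simps)
        from this[of "\<kappa>\<^sup>2" "1 - q" "2 powr v" "C + 1"] show ?thesis using \<kappa> q C0 by (simp add: \<eta>'_def)
      qed
      also have "\<dots> \<le> \<eta>" using \<eta> C0 by (simp add: field_simps)
      finally show "(\<Sum>x\<in>F. diameter {p. cell_of (fst (snd x)) p = snd (snd x)} powr v) \<le> \<eta>" .
    qed
  qed
  then have "null_dim v (\<Union>n. P_large n)" by (rule null_dim_UN_nat)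
  moreover have "P \<subseteq> (\<Union>n. P_large n)"
  proof
    fix p assume p: "p \<in> P"
    obtain \<eta> where \<eta>: "\<eta> > 0" "\<nexists>U. cheap_cover u \<eta> (line_slice A p) U"
      using P(3)[OF p] unfolding null_dim_def by blast
    obtain n where "inverse (real (Suc n)) < \<eta>" using reals_Archimedean[OF \<eta>(1)] by blast
    then have "1 / real (Suc n) \<le> \<eta>" by (simp add: inverse_eq_divide)
    then have "p \<in> P_large n" using \<eta>(2) cheap_cover_mono p unfolding P_large_def by blast
    then show "p \<in> (\<Union>n. P_large n)" by blast
  qed
  ultimately show ?thesis by (rule null_dim_subset)
qed

section \<open>The lower bound for Furstenberg sets\<close>

text \<open>An orthonormal basis, given with its coordinate expansion.\<close>

definition frame :: "real^2 \<Rightarrow> real^2 \<Rightarrow> bool" where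
  "frame a b \<longleftrightarrow> a \<bullet> a = 1 \<and> b \<bullet> b = 1 \<and> a \<bullet> b = 0 \<and> (\<forall>x. x = (a \<bullet> x) *\<^sub>R a + (b \<bullet> x) *\<^sub>R b)"

lemma frame_axes: "frame (axis 1 1) (axis 2 1)" "frame (axis 2 1) (axis 1 1)"
  by (auto simp: frame_def inner_vec_def sum_2 vec_eq_iff forall_2 axis_def)

definition graph_line :: "real^2 \<Rightarrow> real^2 \<Rightarrow> real \<times> real \<Rightarrow> line" where
  "graph_line a b l = Line {x. b \<bullet> x = fst l * (a \<bullet> x) + snd l}"

lemma graph_hyperplane: "{x. b \<bullet> x = fst l * (a \<bullet> x) + snd l} = {x::real^2. (b - fst l *\<^sub>R a) \<bullet> x = snd l}"
  by (auto simp: inner_diff_left)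

text \<open>For a line of slope \<open>m\<close> and angle \<open>\<phi>\<close> the next two functions are \<open>cos\<^sup>2 \<phi>\<close> and \<open>sin \<phi> cos \<phi>\<close>,
  the entries of the orthogonal projection onto its direction.\<close>

definition cos_sq :: "real \<Rightarrow> real" where "cos_sq m = 1 / (1 + m\<^sup>2)"
definition sin_cos :: "real \<Rightarrow> real" where "sin_cos m = m / (1 + m\<^sup>2)"

lemma slope_terms: "0 \<le> cos_sq m" "cos_sq m \<le> 1" "\<bar>sin_cos m\<bar> \<le> 1" "m * sin_cos m = 1 - cos_sq m" "sin_cos m = m * cos_sq m"
proof -
  have pos: "1 + m\<^sup>2 > 0" by (simp add: add_pos_nonneg)
  then show "0 \<le> cos_sq m" "cos_sq m \<le> 1" "m * sin_cos m = 1 - cos_sq m" "sin_cos m = m * cos_sq m"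
    by (simp_all add: cos_sq_def sin_cos_def divide_le_eq field_simps power2_eq_square)
  have "0 \<le> (\<bar>m\<bar> - 1)\<^sup>2" by simp
  then have "2 * \<bar>m\<bar> \<le> 1 + m\<^sup>2" by (simp add: power2_diff)
  then have "\<bar>m\<bar> \<le> 1 + m\<^sup>2" by linarith
  then show "\<bar>sin_cos m\<bar> \<le> 1" using pos by (simp add: sin_cos_def abs_divide divide_le_eq)
qed

context
  fixes a b :: "real^2"
  assumes fr: "frame a b"
begin

lemma frame_simps: "a \<bullet> a = 1" "b \<bullet> b = 1" "a \<bullet> b = 0" "b \<bullet> a = 0"
  using fr by (auto simp: frame_def inner_commute)

lemma frame_expand: "x = (a \<bullet> x) *\<^sub>R a + (b \<bullet> x) *\<^sub>R b"
  using fr by (auto simp: frame_def)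

lemma points_of_graph_line: "points_of (graph_line a b l) = {x. b \<bullet> x = fst l * (a \<bullet> x) + snd l}"
  unfolding graph_line_def
proof (rule Line_inverse)
  have "b - fst l *\<^sub>R a \<noteq> 0"
  proof
    assume "b - fst l *\<^sub>R a = 0"
    then have "b \<bullet> (b - fst l *\<^sub>R a) = 0" by simp
    then show False by (simp add: inner_diff_right frame_simps)
  qed
  then show "{x. b \<bullet> x = fst l * (a \<bullet> x) + snd l} \<in> {l. affine l \<and> aff_dim l = 1}"
    unfolding graph_hyperplane by (simp add: affine_hyperplane aff_dim_hyperplane)
qed

lemma foot_graph_line:
  "foot (graph_line a b l) = (- (snd l * sin_cos (fst l))) *\<^sub>R a + (snd l * cos_sq (fst l)) *\<^sub>R b"
proof -
  define m k where "m = fst l" and "k = snd l"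
  define n where "n = b - m *\<^sub>R a"
  define f where "f = (k / (1 + m\<^sup>2)) *\<^sub>R n"
  have m: "1 + m\<^sup>2 > 0" by (simp add: add_pos_nonneg)
  have nn: "n \<bullet> n = 1 + m\<^sup>2"
    by (simp add: n_def inner_diff_left inner_diff_right frame_simps power2_eq_square)
  have S: "points_of (graph_line a b l) = {x. n \<bullet> x = k}"
    unfolding points_of_graph_line graph_hyperplane by (simp add: n_def m_def k_def)
  have "f = closest_point {x. n \<bullet> x = k} 0"
  proof (rule closest_point_unique)
    show "convex {x. n \<bullet> x = k}" by (rule convex_hyperplane)
    show "closed {x. n \<bullet> x = k}" by (rule closed_hyperplane)
    show "f \<in> {x. n \<bullet> x = k}" using m by (simp add: f_def nn)
    show "\<forall>z\<in>{x. n \<bullet> x = k}. dist 0 f \<le> dist 0 z"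
    proof
      fix z assume "z \<in> {x. n \<bullet> x = k}"
      then have "f \<bullet> f = f \<bullet> z" using m by (simp add: f_def nn)
      also have "\<dots> \<le> norm f * norm z" by (rule norm_cauchy_schwarz)
      finally have "norm f * norm f \<le> norm f * norm z" by (simp add: dot_square_norm power2_eq_square)
      then show "dist 0 f \<le> dist 0 z" by (cases "norm f = 0") auto
    qed
  qed
  then show ?thesis
    by (simp add: foot_def S f_def n_def m_def k_def cos_sq_def sin_cos_def algebra_simps)
qed

lemma line_proj_graph_line:
  "line_proj (graph_line a b l) x = (cos_sq (fst l) * (a \<bullet> x) + sin_cos (fst l) * (b \<bullet> x)) *\<^sub>R a
     + (sin_cos (fst l) * (a \<bullet> x) + (1 - cos_sq (fst l)) * (b \<bullet> x)) *\<^sub>R b"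
proof -
  define m where "m = fst l"
  define d where "d = a + m *\<^sub>R b"
  have m: "1 + m\<^sup>2 > 0" by (simp add: add_pos_nonneg)
  have dd: "d \<bullet> d = 1 + m\<^sup>2"
    by (simp add: d_def inner_add_left inner_add_right frame_simps power2_eq_square)
  have dir: "direction (graph_line a b l) = {y. b \<bullet> y = m * (a \<bullet> y)}"
  proof -
    have f: "b \<bullet> foot (graph_line a b l) = m * (a \<bullet> foot (graph_line a b l)) + snd l"
      using foot_in[of "graph_line a b l"] by (simp add: points_of_graph_line m_def)
    show ?thesis
    proof (intro set_eqI iffI)
      fix y assume "y \<in> direction (graph_line a b l)"
      then show "y \<in> {y. b \<bullet> y = m * (a \<bullet> y)}"
        using f by (auto simp: direction_def points_of_graph_line inner_diff_right m_def algebra_simps)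
    next
      fix y assume "y \<in> {y. b \<bullet> y = m * (a \<bullet> y)}"
      then have "y + foot (graph_line a b l) \<in> points_of (graph_line a b l)"
        using f by (simp add: points_of_graph_line inner_add_right m_def algebra_simps)
      then show "y \<in> direction (graph_line a b l)"
        unfolding direction_def by (rule rev_image_eqI) simp
    qed
  qed
  have "closest_point (direction (graph_line a b l)) x = ((d \<bullet> x) / (1 + m\<^sup>2)) *\<^sub>R d"
  proof (rule closest_point_subspace_eqI[OF subspace_direction])
    show "((d \<bullet> x) / (1 + m\<^sup>2)) *\<^sub>R d \<in> direction (graph_line a b l)"
      by (simp add: dir d_def inner_add_right frame_simps)
    fix z assume "z \<in> direction (graph_line a b l)"
    then have "b \<bullet> z = m * (a \<bullet> z)" by (simp add: dir)
    then have "z = (a \<bullet> z) *\<^sub>R d"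
      using frame_expand[of z] by (simp add: d_def scaleR_add_right mult.commute)
    moreover have "(x - ((d \<bullet> x) / (1 + m\<^sup>2)) *\<^sub>R d) \<bullet> d = 0"
      using m by (simp add: inner_diff_left dd inner_commute[of x d])
    ultimately show "(x - ((d \<bullet> x) / (1 + m\<^sup>2)) *\<^sub>R d) \<bullet> z = 0"
      by (metis inner_scaleR_right mult_zero_right)
  qed
  also have "(d \<bullet> x) / (1 + m\<^sup>2) = cos_sq m * (a \<bullet> x) + sin_cos m * (b \<bullet> x)"
    by (simp add: d_def cos_sq_def sin_cos_def inner_add_left add_divide_distrib)
  also have "\<dots> *\<^sub>R d = \<dots> *\<^sub>R a + (sin_cos m * (a \<bullet> x) + (m * sin_cos m) * (b \<bullet> x)) *\<^sub>R b"
    by (simp add: d_def slope_terms(5) scaleR_add_right algebra_simps)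
  finally show ?thesis by (simp add: line_proj_def m_def slope_terms(4))
qed

lemma norm_frame_le: "norm (p *\<^sub>R a + q *\<^sub>R b) \<le> \<bar>p\<bar> + \<bar>q\<bar>"
proof -
  have "norm a = 1" "norm b = 1" by (simp_all add: norm_eq_sqrt_inner frame_simps)
  then show ?thesis using norm_triangle_ineq[of "p *\<^sub>R a" "q *\<^sub>R b"] by simp
qed

lemma abs_inner_frame_le: "\<bar>a \<bullet> x\<bar> \<le> norm x" "\<bar>b \<bullet> x\<bar> \<le> norm x"
  using Cauchy_Schwarz_ineq2[of a x] Cauchy_Schwarz_ineq2[of b x] by (simp_all add: norm_eq_sqrt_inner frame_simps)

end

lemma slope_terms_lipschitz:
  fixes m m' :: real
  assumes "\<bar>m\<bar> \<le> 1" "\<bar>m'\<bar> \<le> 1"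
  shows "\<bar>cos_sq m - cos_sq m'\<bar> \<le> 2 * \<bar>m - m'\<bar>" "\<bar>sin_cos m - sin_cos m'\<bar> \<le> 2 * \<bar>m - m'\<bar>"
  unfolding cos_sq_def sin_cos_def
proof -
  have pos: "1 + m\<^sup>2 > 0" "1 + m'\<^sup>2 > 0" by (simp_all add: add_pos_nonneg)
  have ge: "1 \<le> (1 + m\<^sup>2) * (1 + m'\<^sup>2)"
    using mult_mono[of 1 "1 + m\<^sup>2" 1 "1 + m'\<^sup>2"] by simp
  have div: "\<bar>z / ((1 + m\<^sup>2) * (1 + m'\<^sup>2))\<bar> \<le> \<bar>z\<bar>" for z
  proof -
    define Q where "Q = (1 + m\<^sup>2) * (1 + m'\<^sup>2)"
    have Q: "Q \<ge> 1" using ge by (simp add: Q_def)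
    have "\<bar>z / Q\<bar> = \<bar>z\<bar> / Q" using Q by (simp add: abs_divide)
    also have "\<dots> \<le> \<bar>z\<bar> / 1" using Q by (intro divide_left_mono) auto
    finally show ?thesis by (simp add: Q_def)
  qed
  have "1 / (1 + m\<^sup>2) - 1 / (1 + m'\<^sup>2) = ((m' - m) * (m' + m)) / ((1 + m\<^sup>2) * (1 + m'\<^sup>2))"
    using pos by (simp add: diff_frac_eq) (simp add: power2_eq_square algebra_simps)
  then have "\<bar>1 / (1 + m\<^sup>2) - 1 / (1 + m'\<^sup>2)\<bar> \<le> \<bar>(m' - m) * (m' + m)\<bar>" using div by simp
  also have "\<dots> \<le> \<bar>m' - m\<bar> * 2" unfolding abs_mult using assms by (intro mult_left_mono) linarith+
  finally show "\<bar>1 / (1 + m\<^sup>2) - 1 / (1 + m'\<^sup>2)\<bar> \<le> 2 * \<bar>m - m'\<bar>"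
    by (simp only: abs_minus_commute[of m' m] mult.commute)
  have "m / (1 + m\<^sup>2) - m' / (1 + m'\<^sup>2) = ((m - m') * (1 - m * m')) / ((1 + m\<^sup>2) * (1 + m'\<^sup>2))"
    using pos by (simp add: diff_frac_eq) (simp add: power2_eq_square algebra_simps)
  then have "\<bar>m / (1 + m\<^sup>2) - m' / (1 + m'\<^sup>2)\<bar> \<le> \<bar>(m - m') * (1 - m * m')\<bar>" using div by simp
  also have "\<dots> \<le> \<bar>m - m'\<bar> * 2"
  proof -
    have "\<bar>m * m'\<bar> \<le> 1 * 1" unfolding abs_mult using assms by (intro mult_mono) auto
    then have "\<bar>1 - m * m'\<bar> \<le> 2" by linarith
    then show ?thesis unfolding abs_mult[of "m - m'"] by (intro mult_left_mono) auto
  qed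
  finally show "\<bar>m / (1 + m\<^sup>2) - m' / (1 + m'\<^sup>2)\<bar> \<le> 2 * \<bar>m - m'\<bar>"
    by (simp only: mult.commute)
qed

text \<open>The matrix entries of the projection and the coordinates of the foot are Lipschitz functions of slope and
  intercept, as long as the intercept stays bounded.\<close>

lemma dist_graph_line_le:
  assumes fr: "frame a b" and m: "\<bar>fst l\<bar> \<le> 1" "\<bar>fst l'\<bar> \<le> 1" and k: "\<bar>snd l'\<bar> \<le> K"
  shows "dist (graph_line a b l) (graph_line a b l') \<le> (10 + 4 * K) * dist l l'"
proof -
  define h where "h l = cos_sq (fst l)" for l :: "real \<times> real"
  define g where "g l = sin_cos (fst l)" for l :: "real \<times> real"
  define dm where "dm = \<bar>fst l - fst l'\<bar>"
  define dk where "dk = \<bar>snd l - snd l'\<bar>"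
  have hg: "\<bar>h l - h l'\<bar> \<le> 2 * dm" "\<bar>g l - g l'\<bar> \<le> 2 * dm"
    using slope_terms_lipschitz[OF m] by (simp_all add: h_def g_def dm_def)
  have h1: "\<bar>h l\<bar> \<le> 1" and g1: "\<bar>g l\<bar> \<le> 1" using slope_terms by (simp_all add: h_def g_def)
  note proj = line_proj_graph_line[OF fr, folded h_def g_def]
  have "onorm (\<lambda>x. line_proj (graph_line a b l) x - line_proj (graph_line a b l') x) \<le> 8 * dm"
  proof (rule onorm_le)
    fix x
    have "line_proj (graph_line a b l) x - line_proj (graph_line a b l') x
      = ((h l - h l') * (a \<bullet> x) + (g l - g l') * (b \<bullet> x)) *\<^sub>R a + ((g l - g l') * (a \<bullet> x) + (h l' - h l) * (b \<bullet> x)) *\<^sub>R b"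
      unfolding proj by (simp add: algebra_simps)
    then have "norm (line_proj (graph_line a b l) x - line_proj (graph_line a b l') x)
       \<le> \<bar>(h l - h l') * (a \<bullet> x) + (g l - g l') * (b \<bullet> x)\<bar> + \<bar>(g l - g l') * (a \<bullet> x) + (h l' - h l) * (b \<bullet> x)\<bar>"
      using norm_frame_le[OF fr] by simp
    also have "\<dots> \<le> \<bar>(h l - h l') * (a \<bullet> x)\<bar> + \<bar>(g l - g l') * (b \<bullet> x)\<bar> + (\<bar>(g l - g l') * (a \<bullet> x)\<bar> + \<bar>(h l' - h l) * (b \<bullet> x)\<bar>)"
      by (intro add_mono abs_triangle_ineq)
    also have "\<dots> \<le> 2 * dm * norm x + 2 * dm * norm x + (2 * dm * norm x + 2 * dm * norm x)"
      unfolding abs_mult using hg abs_inner_frame_le[OF fr, of x]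
      by (intro add_mono mult_mono) (auto simp: abs_minus_commute dm_def)
    finally show "norm (line_proj (graph_line a b l) x - line_proj (graph_line a b l') x) \<le> 8 * dm * norm x" by simp
  qed
  moreover have "norm (foot (graph_line a b l) - foot (graph_line a b l')) \<le> 2 * dk + 4 * K * dm"
  proof -
    note ft = foot_graph_line[OF fr, folded h_def g_def]
    have "foot (graph_line a b l) - foot (graph_line a b l') =
       (snd l' * g l' - snd l * g l) *\<^sub>R a + (snd l * h l - snd l' * h l') *\<^sub>R b"
      unfolding ft by (simp add: algebra_simps)
    then have "norm (foot (graph_line a b l) - foot (graph_line a b l'))
       \<le> \<bar>snd l' * g l' - snd l * g l\<bar> + \<bar>snd l * h l - snd l' * h l'\<bar>"
      using norm_frame_le[OF fr] by simp
    also have "\<dots> = \<bar>(snd l - snd l') * g l + snd l' * (g l - g l')\<bar> + \<bar>(snd l - snd l') * h l + snd l' * (h l - h l')\<bar>"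
      by (simp add: algebra_simps abs_minus_commute)
    also have "\<dots> \<le> (\<bar>(snd l - snd l') * g l\<bar> + \<bar>snd l' * (g l - g l')\<bar>) + (\<bar>(snd l - snd l') * h l\<bar> + \<bar>snd l' * (h l - h l')\<bar>)"
      by (intro add_mono abs_triangle_ineq)
    also have "\<dots> \<le> (dk * 1 + K * (2 * dm)) + (dk * 1 + K * (2 * dm))"
      unfolding abs_mult using hg g1 h1 k by (intro add_mono mult_mono) (auto simp: dk_def)
    finally show ?thesis by simp
  qed
  ultimately have "dist (graph_line a b l) (graph_line a b l') \<le> 8 * dm + (2 * dk + 4 * K * dm)"
    unfolding dist_line_def by linarith
  also have "\<dots> \<le> 8 * dist l l' + (2 * dist l l' + 4 * K * dist l l')"
    using dist_fst_le[of l l'] dist_snd_le[of l l'] k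
    by (intro add_mono mult_left_mono) (auto simp: dm_def dk_def dist_real_def)
  finally show ?thesis by (simp add: algebra_simps)
qed

text \<open>Of the two coordinate axes, one makes an angle of at most 45 degrees with the line.\<close>

lemma line_is_graph:
  obtains a b p where "(a, b) \<in> {(axis 1 1, axis 2 1), (axis 2 1, axis 1 1)}" "\<bar>fst p\<bar> \<le> 1" "l = graph_line a b p"
proof -
  have hull: "affine hull points_of l = points_of l" and dim: "aff_dim (points_of l) = 1"
    using points_of[of l] by (auto simp: hull_same)
  have "\<exists>n c. n \<noteq> 0 \<and> points_of l = {x. n \<bullet> x = c}"
    using aff_dim_eq_hyperplane[of "points_of l", unfolded hull] dim by simp
  then obtain n c where n: "n \<noteq> 0" "points_of l = {x. n \<bullet> x = c}" by blast
  have nx: "n \<bullet> x = n $ 1 * x $ 1 + n $ 2 * x $ 2" for x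
    by (simp add: inner_vec_def sum_2)
  have ne: "n $ 1 \<noteq> 0 \<or> n $ 2 \<noteq> 0" using n(1) by (auto simp: vec_eq_iff forall_2)
  have eqI: "l = graph_line a b p" if "frame a b" "points_of l = {x. b \<bullet> x = fst p * (a \<bullet> x) + snd p}" for a b p
    using points_of_graph_line[OF that(1), of p] that(2) points_of_inject by metis
  show thesis
  proof (cases "\<bar>n $ 1\<bar> \<le> \<bar>n $ 2\<bar>")
    case True
    then have n2: "n $ 2 \<noteq> 0" using ne by auto
    show thesis
    proof (rule that[of "axis 1 1" "axis 2 1" "(- (n $ 1) / n $ 2, c / n $ 2)"])
      show "l = graph_line (axis 1 1) (axis 2 1) (- (n $ 1) / n $ 2, c / n $ 2)"
        by (rule eqI[OF frame_axes(1)]) (use n2 in \<open>auto simp: n(2) nx inner_axis' field_simps\<close>)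
    qed (use True n2 in auto)
  next
    case False
    then have n1: "n $ 1 \<noteq> 0" by auto
    show thesis
    proof (rule that[of "axis 2 1" "axis 1 1" "(- (n $ 2) / n $ 1, c / n $ 1)"])
      show "l = graph_line (axis 2 1) (axis 1 1) (- (n $ 2) / n $ 1, c / n $ 1)"
        by (rule eqI[OF frame_axes(2)]) (use n1 in \<open>auto simp: n(2) nx inner_axis' field_simps\<close>)
    qed (use False n1 in auto)
  qed
qed

text \<open>Coordinates in a frame, translated so that the \<open>i\<close>-th strip becomes the strip \<open>0 \<le> x < 1\<close>.\<close>

definition frame_coords :: "real^2 \<Rightarrow> real^2 \<Rightarrow> int \<Rightarrow> real^2 \<Rightarrow> real \<times> real" where
  "frame_coords a b i x = (a \<bullet> x - real_of_int i, b \<bullet> x)"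

lemma null_dim_frame_coords:
  assumes fr: "frame a b" and A: "null_dim s A" and s: "s > 0"
  shows "null_dim s (frame_coords a b i ` A)"
proof (rule null_dim_lipschitz_image[OF A s, of 2])
  fix x y :: "real^2"
  have "dist (frame_coords a b i x) (frame_coords a b i y) \<le> \<bar>a \<bullet> (x - y)\<bar> + \<bar>b \<bullet> (x - y)\<bar>"
    using sqrt_sum_squares_le_sum_abs[of "a \<bullet> (x - y)" "b \<bullet> (x - y)"]
    by (simp add: frame_coords_def dist_prod_def dist_real_def inner_diff_right)
  also have "\<dots> \<le> 2 * dist x y" using abs_inner_frame_le[OF fr, of "x - y"] by (simp add: dist_norm)
  finally show "dist (frame_coords a b i x) (frame_coords a b i y) \<le> 2 * dist x y" .
qed simp

text \<open>The line is a countable union of pieces of unit length in the first coordinate, and a countable union of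
  null sets is null.\<close>

lemma rich_slice_exists:
  assumes fr: "frame a b" and m: "\<bar>fst p\<bar> \<le> 1" and u: "u > 0"
    and rich: "\<not> null_dim u (A \<inter> points_of (graph_line a b p))"
  shows "\<exists>i. \<not> null_dim u (line_slice (frame_coords a b i ` A) (fst p, snd p + fst p * real_of_int i))"
proof (rule ccontr)
  assume neg: "\<nexists>i. \<not> null_dim u (line_slice (frame_coords a b i ` A) (fst p, snd p + fst p * real_of_int i))"
  define pt where "pt i x = (x + real_of_int i) *\<^sub>R a + (fst p * (x + real_of_int i) + snd p) *\<^sub>R b" for i x
  define S where "S i = line_slice (frame_coords a b i ` A) (fst p, snd p + fst p * real_of_int i)" for i
  have "null_dim u (pt i ` S i)" for i
  proof (rule null_dim_lipschitz_image[OF _ u, of _ 2])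
    show "null_dim u (S i)" using neg by (simp add: S_def)
    fix x y :: real
    have "pt i x - pt i y = (x - y) *\<^sub>R a + (fst p * (x - y)) *\<^sub>R b"
      by (simp add: pt_def algebra_simps)
    then have "dist (pt i x) (pt i y) \<le> \<bar>x - y\<bar> + \<bar>fst p\<bar> * \<bar>x - y\<bar>"
      using norm_frame_le[OF fr, of "x - y" "fst p * (x - y)"] by (simp add: dist_norm abs_mult)
    also have "\<dots> \<le> \<bar>x - y\<bar> + 1 * \<bar>x - y\<bar>" using m by (intro add_mono mult_right_mono) auto
    finally show "dist (pt i x) (pt i y) \<le> 2 * dist x y" by (simp add: dist_real_def)
  qed simp
  then have "null_dim u (\<Union>i. pt i ` S i)" by (rule null_dim_UN)
  moreover have "A \<inter> points_of (graph_line a b p) \<subseteq> (\<Union>i. pt i ` S i)"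
  proof
    fix z assume z: "z \<in> A \<inter> points_of (graph_line a b p)"
    define i where "i = \<lfloor>a \<bullet> z\<rfloor>"
    define x where "x = a \<bullet> z - real_of_int i"
    have bz: "b \<bullet> z = fst p * (a \<bullet> z) + snd p" using z by (simp add: points_of_graph_line[OF fr])
    have "x \<in> {0..<1}" unfolding x_def i_def by (simp, linarith)
    moreover have "(x, fst p * x + (snd p + fst p * real_of_int i)) = frame_coords a b i z"
      by (simp add: frame_coords_def x_def bz algebra_simps)
    ultimately have "x \<in> S i" using z by (simp add: S_def line_slice_def)
    moreover have "z = pt i x"
      using frame_expand[OF fr, of z] by (simp add: pt_def x_def bz)
    ultimately show "z \<in> (\<Union>i. pt i ` S i)" by blast
  qed
  ultimately show False using rich null_dim_subset by blast
qed

text \<open>The family is a countable union over the two frames, the strips and the unit squares of parameters.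
  Each piece is a Lipschitz image of a set of parameters to which theorem \<open>null_dim_of_rich_lines\<close> applies.\<close>

theorem null_dim_lines:
  fixes A :: "(real^2) set" and \<L> :: "line set"
  assumes uv: "0 < u" "0 < v" "u + v < 2" and s: "0 < s" "s < 2 * u + v - 1"
    and A: "null_dim s A" and rich: "\<And>l. l \<in> \<L> \<Longrightarrow> \<not> null_dim u (A \<inter> points_of l)"
  shows "null_dim v \<L>"
proof -
  \<comment> \<open>The Boolean tells the two frames apart, so that the decomposition below has a countable index.\<close>
  define fr_of :: "bool \<Rightarrow> (real^2) \<times> (real^2)" where
    "fr_of c = (if c then (axis 1 1, axis 2 1) else (axis 2 1, axis 1 1))" for c
  have fr: "frame (fst (fr_of c)) (snd (fr_of c))" for c
    using frame_axes by (simp add: fr_of_def)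
  define P where "P c i e = {p. cell_of 0 p = e \<and> \<bar>fst p\<bar> \<le> 1 \<and>
     \<not> null_dim u (line_slice (frame_coords (fst (fr_of c)) (snd (fr_of c)) i ` A) p)}" for c i e
  define g where "g c i p = graph_line (fst (fr_of c)) (snd (fr_of c)) (fst p, snd p - fst p * real_of_int i)"
    for c i and p :: "real \<times> real"
  have "null_dim v (g c i ` P c i e)" for c i e
  proof -
    have nP: "null_dim v (P c i e)"
      by (rule null_dim_of_rich_lines[OF uv s null_dim_frame_coords[OF fr A s(1)]])
         (auto simp: P_def)
    define K where "K = \<bar>real_of_int (snd e)\<bar> + 1 + \<bar>real_of_int i\<bar>"
    have K0: "K \<ge> 0" by (simp add: K_def)
    show ?thesis
    proof (rule null_dim_lipschitz_image[OF nP uv(2), of "(10 + 4 * K) * (2 + \<bar>real_of_int i\<bar>)"])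
      show "(10 + 4 * K) * (2 + \<bar>real_of_int i\<bar>) > 0" using K0 by (intro mult_pos_pos) auto
      fix p q assume pq: "p \<in> P c i e" "q \<in> P c i e"
      have m: "\<bar>fst p\<bar> \<le> 1" "\<bar>fst q\<bar> \<le> 1" using pq by (auto simp: P_def)
      have "cell_of 0 q = e" using pq by (simp add: P_def)
      then have "\<lfloor>snd q\<rfloor> = snd e" by (auto simp: cell_of_def)
      then have "\<bar>snd q\<bar> \<le> \<bar>real_of_int (snd e)\<bar> + 1" by linarith
      moreover have "\<bar>fst q * real_of_int i\<bar> \<le> 1 * \<bar>real_of_int i\<bar>" unfolding abs_mult using m by (intro mult_right_mono) auto
      ultimately have k: "\<bar>snd q - fst q * real_of_int i\<bar> \<le> K" unfolding K_def by linarith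
      have "dist (g c i p) (g c i q) \<le> (10 + 4 * K) * dist (fst p, snd p - fst p * real_of_int i) (fst q, snd q - fst q * real_of_int i)"
        unfolding g_def by (rule dist_graph_line_le[OF fr]) (use m k in auto)
      also have "\<dots> \<le> (10 + 4 * K) * ((2 + \<bar>real_of_int i\<bar>) * dist p q)"
      proof (rule mult_left_mono)
        have "dist (fst p, snd p - fst p * real_of_int i) (fst q, snd q - fst q * real_of_int i)
           \<le> \<bar>fst p - fst q\<bar> + \<bar>(snd p - fst p * real_of_int i) - (snd q - fst q * real_of_int i)\<bar>"
          using sqrt_sum_squares_le_sum_abs by (simp add: dist_prod_def dist_real_def)
        also have "(snd p - fst p * real_of_int i) - (snd q - fst q * real_of_int i) = (snd p - snd q) - (fst p - fst q) * real_of_int i"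
          by (simp add: algebra_simps)
        also have "\<bar>fst p - fst q\<bar> + \<bar>(snd p - snd q) - (fst p - fst q) * real_of_int i\<bar>
           \<le> dist p q + (dist p q + dist p q * \<bar>real_of_int i\<bar>)"
        proof -
          have d: "\<bar>fst p - fst q\<bar> \<le> dist p q" "\<bar>snd p - snd q\<bar> \<le> dist p q"
            using dist_fst_le[of p q] dist_snd_le[of p q] by (simp_all add: dist_real_def)
          moreover have "\<bar>(fst p - fst q) * real_of_int i\<bar> \<le> dist p q * \<bar>real_of_int i\<bar>"
            unfolding abs_mult using d by (intro mult_right_mono) auto
          ultimately show ?thesis
            using abs_triangle_ineq4[of "snd p - snd q" "(fst p - fst q) * real_of_int i"] by linarith
        qed
        also have "\<dots> = (2 + \<bar>real_of_int i\<bar>) * dist p q" by (simp add: algebra_simps)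
        finally show "dist (fst p, snd p - fst p * real_of_int i) (fst q, snd q - fst q * real_of_int i)
           \<le> (2 + \<bar>real_of_int i\<bar>) * dist p q" .
      qed (use K0 in simp)
      finally show "dist (g c i p) (g c i q) \<le> (10 + 4 * K) * (2 + \<bar>real_of_int i\<bar>) * dist p q" by simp
    qed
  qed
  then have "null_dim v (\<Union>(c, i, e). g c i ` P c i e)"
    by (intro null_dim_UN) (simp add: split_def)
  moreover have "\<L> \<subseteq> (\<Union>(c, i, e). g c i ` P c i e)"
  proof
    fix l assume l: "l \<in> \<L>"
    obtain a b p where abp: "(a, b) \<in> {(axis 1 1, axis 2 1), (axis 2 1, axis 1 1)}" "\<bar>fst p\<bar> \<le> 1" "l = graph_line a b p"
      by (rule line_is_graph[of l])
    then obtain c where c: "a = fst (fr_of c)" "b = snd (fr_of c)"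
      by (metis (no_types) fr_of_def fst_conv insertE prod.inject singletonD snd_conv)
    have frab: "frame a b" using fr c by simp
    obtain i where i: "\<not> null_dim u (line_slice (frame_coords a b i ` A) (fst p, snd p + fst p * real_of_int i))"
      using rich_slice_exists[OF frab abp(2) uv(1)] rich[OF l] abp(3) by blast
    define q where "q = (fst p, snd p + fst p * real_of_int i)"
    have "q \<in> P c i (cell_of 0 q)" using i abp(2) by (simp add: P_def q_def c)
    moreover have "g c i q = l" by (simp add: g_def q_def abp(3) c)
    ultimately have "l \<in> g c i ` P c i (cell_of 0 q)" by blast
    then show "l \<in> (\<Union>(c, i, e). g c i ` P c i e)" by blast
  qed
  ultimately show ?thesis by (rule null_dim_subset)
qed

theorem furstenberg_lower_bound:
  assumes uv: "1 \<le> v" "v \<le> 2" "0 < u" "u \<le> 1" and A: "furstenberg u v A"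
  shows "hausdorff_dim A \<ge> ereal (min (2 * u + v - 1) (u + 1))"
proof (rule ccontr)
  define s where "s = min (2 * u + v - 1) (u + 1)"
  assume "\<not> ?thesis"
  then have "hausdorff_dim A < ereal s" unfolding s_def by (simp only: not_le)
  then obtain r where r: "r < s" "null_dim r A" "0 < r" by (rule hausdorff_dim_less_imp_null_dim)
  obtain \<L> where L: "hausdorff_dim \<L> = ereal v" "\<And>l. l \<in> \<L> \<Longrightarrow> hausdorff_dim (A \<inter> points_of l) \<ge> ereal u"
    using A unfolding furstenberg_def by blast
  \<comment> \<open>The bound never improves once \<open>v\<close> exceeds \<open>2 - u\<close>, so \<open>v\<close> may be lowered to that value. The
    numbers \<open>u\<close> and \<open>v0\<close> are then decreased by a small \<open>\<tau>\<close> that keeps \<open>r\<close> below the bound.\<close>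
  define v0 where "v0 = min v (2 - u)"
  have v0: "v0 \<le> v" "u + v0 \<le> 2" "1 \<le> v0" "2 * u + v0 - 1 = s"
    using uv by (auto simp: v0_def s_def)
  define \<tau> where "\<tau> = min ((s - r) / 4) (min (u / 2) (1 / 2))"
  have \<tau>: "\<tau> > 0" "\<tau> \<le> (s - r) / 4" "\<tau> \<le> u / 2" "\<tau> \<le> 1 / 2"
    using r uv unfolding \<tau>_def by (simp, simp_all only: min_le_iff_disj) auto
  have "null_dim (v0 - \<tau>) \<L>"
  proof (rule null_dim_lines[of "u - \<tau>" "v0 - \<tau>" r A])
    fix l assume "l \<in> \<L>"
    then have dim: "hausdorff_dim (A \<inter> points_of l) \<ge> ereal u" by (rule L)
    show "\<not> null_dim (u - \<tau>) (A \<inter> points_of l)"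
    proof
      assume "null_dim (u - \<tau>) (A \<inter> points_of l)"
      then have "hausdorff_dim (A \<inter> points_of l) \<le> ereal (u - \<tau>)"
        by (rule null_dim_imp_hausdorff_dim_le) (use \<tau> uv in linarith)
      then have "ereal u \<le> ereal (u - \<tau>)" using dim by (rule order_trans[rotated])
      then show False using \<tau> by simp
    qed
  qed (use \<tau> v0 uv r in \<open>linarith | simp\<close>)+
  then have "hausdorff_dim \<L> \<le> ereal (v0 - \<tau>)"
    by (rule null_dim_imp_hausdorff_dim_le) (use \<tau> v0 in linarith)
  then show False using L(1) \<tau> v0 by simp
qed

section \<open>Cantor sets and sharpness\<close>

lemma null_dim_mono_exponent:
  assumes "null_dim s X" "0 < s" "s \<le> t"
  shows "null_dim t X"
proof (cases "s = t")
  case False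
  then show ?thesis
    using outer_measure_0_imp_null_dim[OF null_dim_imp_outer_measure_0[OF assms(1,2)], of t] assms by simp
qed (use assms in simp)

lemma hausdorff_dim_ge_if_not_null: "\<not> null_dim t X \<Longrightarrow> hausdorff_dim X \<ge> ereal t"
  using null_dim_mono_exponent[of _ X t] by (intro hausdorff_dim_geI) (meson less_imp_le)

text \<open>The mass distribution principle, with Lebesgue measure pulled back along \<open>f\<close>. Both \<open>g\<close> and \<open>f\<close> start from a
  common parameter space, later that of digit sequences, on which the Cantor function is evaluation in a
  second base.\<close>

lemma mass_distribution:
  fixes g :: "'s \<Rightarrow> 'a::metric_space" and f :: "'s \<Rightarrow> 'b::euclidean_space"
  assumes K: "K \<ge> 0" and s: "s > 0"
    and small: "\<And>T. T \<subseteq> S \<Longrightarrow> bounded (g ` T) \<Longrightarrow>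
      \<exists>B\<in>sets lborel. f ` T \<subseteq> B \<and> emeasure lborel B \<le> ennreal (K * diameter (g ` T) powr s)"
    and Z: "Z \<in> sets lborel" "emeasure lborel Z = 1" "Z \<subseteq> f ` S"
  shows "\<not> null_dim s (g ` S)"
proof
  assume "null_dim s (g ` S)"
  moreover have "1 / (2 * (K + 1)) > 0" using K by simp
  ultimately obtain U where U: "cheap_cover s (1 / (2 * (K + 1))) (g ` S) U" unfolding null_dim_def by blast
  note U = cheap_coverD[OF U]
  define T where "T i = {x\<in>S. g x \<in> U i}" for i
  have gT: "g ` T i \<subseteq> U i" for i by (auto simp: T_def)
  have "\<exists>B\<in>sets lborel. f ` T i \<subseteq> B \<and> emeasure lborel B \<le> ennreal (K * diameter (g ` T i) powr s)" for i
    by (rule small[OF _ bounded_subset[OF U(2) gT]]) (auto simp: T_def)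
  then have "\<forall>i. \<exists>B. B \<in> sets lborel \<and> f ` T i \<subseteq> B \<and> emeasure lborel B \<le> ennreal (K * diameter (g ` T i) powr s)"
    by blast
  from choice[OF this] obtain B where
    "\<forall>i. B i \<in> sets lborel \<and> f ` T i \<subseteq> B i \<and> emeasure lborel (B i) \<le> ennreal (K * diameter (g ` T i) powr s)" ..
  then have B: "\<And>i. B i \<in> sets lborel" "\<And>i. f ` T i \<subseteq> B i"
    "\<And>i. emeasure lborel (B i) \<le> ennreal (K * diameter (g ` T i) powr s)" by simp_all
  have le: "emeasure lborel (B i) \<le> ennreal (K * diameter (U i) powr s)" for i
  proof (rule order_trans[OF B(3)], intro ennreal_leI mult_left_mono powr_mono2)
    show "diameter (g ` T i) \<le> diameter (U i)" by (rule diameter_subset[OF gT U(2)])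
    show "0 \<le> diameter (g ` T i)" by (rule diameter_ge_0[OF bounded_subset[OF U(2) gT]])
  qed (use s K in auto)
  have "Z \<subseteq> (\<Union>i. B i)"
  proof
    fix z assume "z \<in> Z"
    then obtain x where x: "x \<in> S" "z = f x" using Z(3) by blast
    then obtain i where "g x \<in> U i" using U(1) by blast
    then have "z \<in> f ` T i" using x by (auto simp: T_def)
    then show "z \<in> (\<Union>i. B i)" using B(2) by blast
  qed
  then have "1 \<le> emeasure lborel (\<Union>i. B i)"
    unfolding Z(2)[symmetric] by (intro emeasure_mono) (use B(1) in auto)
  also have "\<dots> \<le> (\<Sum>i. emeasure lborel (B i))"
    by (rule emeasure_subadditive_countably) (use B(1) in auto)
  also have "\<dots> \<le> (\<Sum>i. ennreal (K * diameter (U i) powr s))"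
    by (intro suminf_le le) auto
  also have "\<dots> = (SUP n. \<Sum>i<n. ennreal (K * diameter (U i) powr s))" by (rule suminf_eq_SUP)
  also have "\<dots> \<le> ennreal (1 / 2)"
  proof (rule SUP_least)
    fix n
    have "(\<Sum>i<n. K * diameter (U i) powr s) \<le> K * (1 / (2 * (K + 1)))"
      unfolding sum_distrib_left[symmetric] by (intro mult_left_mono U K) auto
    also have "\<dots> \<le> 1 / 2" using K by (simp add: field_simps)
    finally have "ennreal (\<Sum>i<n. K * diameter (U i) powr s) \<le> ennreal (1 / 2)" by (rule ennreal_leI)
    moreover have "(\<Sum>i<n. ennreal (K * diameter (U i) powr s)) = ennreal (\<Sum>i<n. K * diameter (U i) powr s)"
      using K by (simp add: sum_ennreal)
    ultimately show "(\<Sum>i<n. ennreal (K * diameter (U i) powr s)) \<le> ennreal (1 / 2)" by (simp only:)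
  qed
  also have "\<dots> < ennreal 1" by (rule ennreal_lessI) auto
  finally show False by simp
qed

lemma null_dim_box_covers:
  fixes X :: "(real \<times> real) set"
  assumes s: "s > 0" and cov: "\<And>\<eta>. \<eta> > 0 \<Longrightarrow> \<exists>E r. finite E \<and> r \<ge> 0 \<and>
      (\<forall>p\<in>X. \<exists>e\<in>E. \<bar>fst p - fst e\<bar> \<le> r \<and> \<bar>snd p - snd e\<bar> \<le> r) \<and> real (card E) * (4 * r) powr s \<le> \<eta>"
  shows "null_dim s X"
  unfolding null_dim_def
proof (intro allI impI)
  fix \<eta> :: real assume "\<eta> > 0"
  then obtain E r where E: "finite E" "r \<ge> 0" "\<forall>p\<in>X. \<exists>e\<in>E. \<bar>fst p - fst e\<bar> \<le> r \<and> \<bar>snd p - snd e\<bar> \<le> r"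
    "real (card E) * (4 * r) powr s \<le> \<eta>" using cov by blast
  obtain h where h: "bij_betw h {0..<card E} E" using ex_bij_betw_nat_finite[OF E(1)] by blast
  define V where "V i = {p :: real \<times> real. \<bar>fst p - fst (h i)\<bar> \<le> r \<and> \<bar>snd p - snd (h i)\<bar> \<le> r}" for i
  have d: "dist p q \<le> 4 * r" if "p \<in> V i" "q \<in> V i" for p q i
  proof -
    have "\<bar>fst p - fst q\<bar> \<le> 2 * r" "\<bar>snd p - snd q\<bar> \<le> 2 * r" using that by (auto simp: V_def)
    moreover have "dist p q \<le> \<bar>fst p - fst q\<bar> + \<bar>snd p - snd q\<bar>"
      using sqrt_sum_squares_le_sum_abs[of "fst p - fst q" "snd p - snd q"]
      by (simp add: dist_prod_def dist_real_def)
    ultimately show ?thesis by linarith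
  qed
  have bd: "bounded (V i)" for i unfolding bounded_def using d by blast
  have dm: "diameter (V i) \<le> 4 * r" for i
    by (rule diameter_le) (use d E(2) in \<open>auto simp: dist_norm\<close>)
  show "\<exists>U. cheap_cover s \<eta> X U"
  proof (rule cheap_cover_countable[where I = "{0..<card E}" and V = V])
    show "X \<subseteq> (\<Union>i\<in>{0..<card E}. V i)"
    proof
      fix p assume "p \<in> X"
      then obtain e where e: "e \<in> E" "\<bar>fst p - fst e\<bar> \<le> r" "\<bar>snd p - snd e\<bar> \<le> r" using E(3) by blast
      then obtain i where "i \<in> {0..<card E}" "e = h i" using h unfolding bij_betw_def by blast
      then show "p \<in> (\<Union>i\<in>{0..<card E}. V i)" using e by (auto simp: V_def)
    qed
    fix F assume F: "finite F" "F \<subseteq> {0..<card E}"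
    have "(\<Sum>i\<in>F. diameter (V i) powr s) \<le> (\<Sum>i\<in>F. (4 * r) powr s)"
      by (intro sum_mono powr_mono2 dm diameter_ge_0 bd) (use s in auto)
    also have "\<dots> = real (card F) * (4 * r) powr s" by simp
    also have "\<dots> \<le> real (card E) * (4 * r) powr s"
      using card_mono[OF _ F(2)] by (intro mult_right_mono) auto
    finally show "(\<Sum>i\<in>F. diameter (V i) powr s) \<le> \<eta>" using E(4) by linarith
  qed (rule bd)
qed

text \<open>The digits 0 and 1 are used with ratio \<open>q\<close>. The factor 1/2 keeps the values in the unit interval for
  \<open>q \<le> 1/2\<close>, and for \<open>q = 1/2\<close> the function evaluates binary expansions.\<close>

definition cantor :: "real \<Rightarrow> (nat \<Rightarrow> bool) \<Rightarrow> real" where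
  "cantor q b = (\<Sum>i. of_bool (b i) * q ^ i) / 2"

lemma cantor_summable:
  assumes "0 \<le> q" "q \<le> 1/2"
  shows "summable (\<lambda>i. of_bool (b i) * q ^ i :: real)"
  by (rule summable_comparison_test'[of "\<lambda>i. q ^ i" 0]) (use assms in \<open>auto intro: summable_geometric\<close>)

lemma cantor_tail:
  fixes d :: "nat \<Rightarrow> real"
  assumes q: "0 \<le> q" "q \<le> 1/2" and d: "\<And>i. \<bar>d i\<bar> \<le> q ^ i"
  shows "\<bar>\<Sum>i. d (i + n)\<bar> \<le> q ^ n / (1 - q)" "summable d"
proof -
  show "summable d"
    by (rule summable_comparison_test'[of "\<lambda>i. q ^ i" 0]) (use q d in \<open>auto intro: summable_geometric\<close>)
  have s: "summable (\<lambda>i. q ^ n * q ^ i)" using q by (intro summable_mult summable_geometric) auto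
  have dn: "\<bar>d (i + n)\<bar> \<le> q ^ n * q ^ i" for i using d[of "i + n"] by (simp add: power_add mult.commute)
  then have sa: "summable (\<lambda>i. \<bar>d (i + n)\<bar>)" by (intro summable_comparison_test'[OF s, of 0]) auto
  have "\<bar>\<Sum>i. d (i + n)\<bar> \<le> (\<Sum>i. \<bar>d (i + n)\<bar>)" by (rule summable_rabs[OF sa])
  also have "\<dots> \<le> (\<Sum>i. q ^ n * q ^ i)" by (rule suminf_le[OF dn sa s])
  also have "\<dots> = q ^ n / (1 - q)" using q by (simp add: suminf_mult summable_geometric suminf_geometric)
  finally show "\<bar>\<Sum>i. d (i + n)\<bar> \<le> q ^ n / (1 - q)" .
qed

lemma cantor_bounds:
  assumes q: "0 \<le> q" "q \<le> 1/2"
  shows "0 \<le> cantor q b" "cantor q b \<le> 1"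
proof -
  show "0 \<le> cantor q b" unfolding cantor_def using q by (intro divide_nonneg_nonneg suminf_nonneg cantor_summable) auto
  have "\<bar>\<Sum>i. of_bool (b (i + 0)) * q ^ (i + 0)\<bar> \<le> q ^ 0 / (1 - q)"
    by (rule cantor_tail(1)[OF q, of "\<lambda>i. of_bool (b i) * q ^ i"]) (use q in auto)
  also have "\<dots> \<le> 1 / (1 / 2)" using q by (intro frac_le) auto
  finally show "cantor q b \<le> 1" by (simp add: cantor_def)
qed

text \<open>The first differing digit decides: it contributes \<open>q ^ n / 2\<close>, and all later digits together at most
  \<open>q ^ n * q / (1 - q) / 2\<close>.\<close>

lemma cantor_diff:
  assumes q: "0 \<le> q" "q \<le> 1/2" and n: "b n \<noteq> b' n" "\<And>i. i < n \<Longrightarrow> b i = b' i"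
  shows "\<bar>cantor q b - cantor q b'\<bar> \<le> q ^ n" "q ^ n * (1 - 2 * q) / 2 \<le> \<bar>cantor q b - cantor q b'\<bar>"
proof -
  define d where "d i = (of_bool (b i) - of_bool (b' i)) * q ^ i" for i
  have d: "\<bar>d i\<bar> \<le> q ^ i" for i using q by (auto simp: d_def abs_mult)
  note tail = cantor_tail[OF q d]
  have eq: "cantor q b - cantor q b' = (\<Sum>i. d i) / 2"
    using suminf_diff[OF cantor_summable[OF q, of b] cantor_summable[OF q, of b']]
    by (simp add: cantor_def d_def left_diff_distrib diff_divide_distrib)
  have "(\<Sum>i<n. d i) = 0" using n(2) by (intro sum.neutral) (simp add: d_def)
  then have eqn: "(\<Sum>i. d i) = (\<Sum>i. d (i + n))" using suminf_split_initial_segment[OF tail(2), of n] by simp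
  also have "\<dots> = d n + (\<Sum>i. d (i + Suc n))"
    using suminf_split_head[of "\<lambda>i. d (i + n)"] tail(2) summable_ignore_initial_segment by auto
  finally have eqS: "(\<Sum>i. d i) = d n + (\<Sum>i. d (i + Suc n))" .
  have half: "1 / (1 - q) \<le> 2" using q by (simp add: field_simps)
  have qn: "q ^ n \<ge> 0" using q by simp
  have "\<bar>\<Sum>i. d i\<bar> \<le> q ^ n * (1 / (1 - q))" using tail(1)[of n] eqn by simp
  also have "\<dots> \<le> q ^ n * 2" using half qn by (intro mult_left_mono) auto
  finally show "\<bar>cantor q b - cantor q b'\<bar> \<le> q ^ n" by (simp add: eq)
  have "\<bar>d n\<bar> = q ^ n" using n(1) q by (auto simp: d_def abs_mult)
  moreover have "\<bar>\<Sum>i. d (i + Suc n)\<bar> \<le> q ^ n * (2 * q)"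
  proof -
    have "\<bar>\<Sum>i. d (i + Suc n)\<bar> \<le> q ^ n * (q * (1 / (1 - q)))" using tail(1)[of "Suc n"] by (simp add: mult_ac)
    also have "\<dots> \<le> q ^ n * (q * 2)" using half qn q by (intro mult_left_mono) auto
    finally show ?thesis by (simp add: mult_ac)
  qed
  ultimately have "q ^ n - q ^ n * (2 * q) \<le> \<bar>\<Sum>i. d i\<bar>" unfolding eqS by linarith
  then show "q ^ n * (1 - 2 * q) / 2 \<le> \<bar>cantor q b - cantor q b'\<bar>" by (simp add: eq right_diff_distrib)
qed

lemma cantor_half_onto:
  assumes x: "x \<in> {0..<1}"
  shows "\<exists>b. cantor (1/2) b = x"
proof -
  define b where "b i = odd \<lfloor>2 ^ Suc i * x\<rfloor>" for i
  have "(\<Sum>i<n. of_bool (b i) * (1/2) ^ i) / 2 = real_of_int \<lfloor>2 ^ n * x\<rfloor> / 2 ^ n" for n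
  proof (induction n)
    case 0
    have "\<lfloor>x\<rfloor> = 0" using x by (simp add: floor_eq_iff)
    then show ?case by simp
  next
    case (Suc n)
    \<comment> \<open>Doubling \<open>2 ^ n * x\<close> appends one binary digit to its integer part.\<close>
    define k where "k = \<lfloor>2 ^ Suc n * x\<rfloor>"
    define j where "j = \<lfloor>2 ^ n * x\<rfloor>"
    have "k div 2 = j"
      using floor_divide_real_eq_div[of 2 "2 ^ Suc n * x"] by (simp add: k_def j_def)
    moreover have "2 * (k div 2) + of_bool (odd k) = k" by (cases "odd k") auto
    ultimately have "j * 2 + of_bool (b n) = k"
      unfolding b_def k_def[symmetric] by simp
    then have "real_of_int k = real_of_int j * 2 + of_bool (b n)"
      by (metis of_int_add of_int_mult of_int_numeral of_int_of_bool)
    then show ?case using Suc unfolding k_def[symmetric] j_def[symmetric]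
      by (simp add: field_simps power_one_over)
  qed
  moreover have "(\<lambda>n. (\<Sum>i<n. of_bool (b i) * (1/2) ^ i) / 2) \<longlonglongrightarrow> cantor (1/2) b"
    unfolding cantor_def by (intro tendsto_divide summable_LIMSEQ cantor_summable tendsto_const) auto
  ultimately have 1: "(\<lambda>n. real_of_int \<lfloor>2 ^ n * x\<rfloor> / 2 ^ n) \<longlonglongrightarrow> cantor (1/2) b" by simp
  have "(\<lambda>n. real_of_int \<lfloor>2 ^ n * x\<rfloor> / 2 ^ n) \<longlonglongrightarrow> x"
  proof (rule tendsto_sandwich[of "\<lambda>n. x - (1/2) ^ n" _ _ "\<lambda>n. x"])
    show "\<forall>\<^sub>F n in sequentially. x - (1/2) ^ n \<le> real_of_int \<lfloor>2 ^ n * x\<rfloor> / 2 ^ n"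
    proof (intro always_eventually allI)
      fix n
      have "2 ^ n * x - 1 \<le> real_of_int \<lfloor>2 ^ n * x\<rfloor>" by linarith
      then have "(2 ^ n * x - 1) / 2 ^ n \<le> real_of_int \<lfloor>2 ^ n * x\<rfloor> / 2 ^ n" by (intro divide_right_mono) auto
      then show "x - (1/2) ^ n \<le> real_of_int \<lfloor>2 ^ n * x\<rfloor> / 2 ^ n" by (simp add: diff_divide_distrib power_one_over)
    qed
    show "\<forall>\<^sub>F n in sequentially. real_of_int \<lfloor>2 ^ n * x\<rfloor> / 2 ^ n \<le> x"
    proof (intro always_eventually allI)
      fix n
      have "real_of_int \<lfloor>2 ^ n * x\<rfloor> \<le> 2 ^ n * x" by linarith
      then show "real_of_int \<lfloor>2 ^ n * x\<rfloor> / 2 ^ n \<le> x" by (simp add: divide_le_eq mult.commute)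
    qed
    have "(\<lambda>n. x - (1/2) ^ n) \<longlonglongrightarrow> x - 0" by (intro tendsto_intros) auto
    then show "(\<lambda>n. x - (1/2) ^ n) \<longlonglongrightarrow> x" by simp
  qed simp
  then have "cantor (1/2) b = x" using 1 LIMSEQ_unique by blast
  then show ?thesis by blast
qed

text \<open>The contraction ratio for which two copies give similarity dimension \<open>\<sigma>\<close>.\<close>

definition ratio :: "real \<Rightarrow> real" where "ratio \<sigma> = 2 powr (- 1 / \<sigma>)"

lemma ratio_bounds:
  assumes "0 < \<sigma>" "\<sigma> \<le> 1"
  shows "0 < ratio \<sigma>" "ratio \<sigma> \<le> 1/2" "\<sigma> < 1 \<Longrightarrow> ratio \<sigma> < 1/2"
proof -
  show "0 < ratio \<sigma>" by (simp add: ratio_def)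
  have half: "2 powr (-1) = (1/2::real)" by (simp add: powr_minus_divide)
  show "ratio \<sigma> \<le> 1/2" unfolding ratio_def half[symmetric] using assms by (intro powr_mono) (auto simp: field_simps)
  show "\<sigma> < 1 \<Longrightarrow> ratio \<sigma> < 1/2" unfolding ratio_def half[symmetric] using assms by (intro powr_less_mono) (auto simp: field_simps)
qed

lemma ratio_1: "ratio 1 = 1/2"
  by (simp add: ratio_def powr_minus_divide)

lemma ratio_powr: "0 < \<sigma> \<Longrightarrow> (ratio \<sigma> ^ n) powr s = (2 powr (- s / \<sigma>)) ^ n"
  by (simp add: ratio_def powr_realpow[symmetric] powr_powr mult_ac)

text \<open>The Cantor function is Hoelder continuous of exponent \<open>\<sigma>\<close>. For \<open>\<sigma> = 1\<close> the lower bound of lemma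
  \<open>cantor_diff\<close> degenerates, but there the two sides are equal.\<close>

lemma cantor_holder:
  assumes \<sigma>: "0 < \<sigma>" "\<sigma> \<le> 1"
  obtains K where "K \<ge> 0" "\<And>b b'. \<bar>cantor (1/2) b - cantor (1/2) b'\<bar> \<le> K * \<bar>cantor (ratio \<sigma>) b - cantor (ratio \<sigma>) b'\<bar> powr \<sigma>"
proof (cases "\<sigma> = 1")
  case True
  show thesis by (rule that[of 1]) (simp_all add: True ratio_1)
next
  case False
  define q where "q = ratio \<sigma>"
  have q: "0 < q" "q < 1/2" using ratio_bounds[OF \<sigma>] False \<sigma> by (auto simp: q_def)
  define c where "c = (1 - 2 * q) / 2"
  have c: "c > 0" using q by (simp add: c_def)
  show thesis
  proof (rule that[of "1 / c powr \<sigma>"])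
    fix b b' :: "nat \<Rightarrow> bool"
    show "\<bar>cantor (1/2) b - cantor (1/2) b'\<bar> \<le> 1 / c powr \<sigma> * \<bar>cantor (ratio \<sigma>) b - cantor (ratio \<sigma>) b'\<bar> powr \<sigma>"
    proof (cases "b = b'")
      case False
      define n where "n = (LEAST n. b n \<noteq> b' n)"
      have ex: "\<exists>n. b n \<noteq> b' n" using False by auto
      have n: "b n \<noteq> b' n" unfolding n_def by (rule LeastI_ex[OF ex])
      have less: "b i = b' i" if "i < n" for i using not_less_Least[of i "\<lambda>n. b n \<noteq> b' n"] that n_def by blast
      have "\<bar>cantor (1/2) b - cantor (1/2) b'\<bar> \<le> (1/2) ^ n" by (rule cantor_diff(1)[where n = n and b = b and b' = b', OF _ _ n less]) auto
      also have "\<dots> = (q ^ n) powr \<sigma>" using ratio_powr[of \<sigma> n \<sigma>] \<sigma> by (simp add: q_def powr_minus_divide)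
      also have "\<dots> = 1 / c powr \<sigma> * (q ^ n * c) powr \<sigma>" using c q by (simp add: powr_mult)
      also have "\<dots> \<le> 1 / c powr \<sigma> * \<bar>cantor q b - cantor q b'\<bar> powr \<sigma>"
        using cantor_diff(2)[where n = n and b = b and b' = b' and q = q, OF _ _ n less] q c \<sigma>
        by (intro mult_left_mono powr_mono2) (auto simp: c_def)
      finally show ?thesis by (simp add: q_def)
    qed simp
  qed simp
qed

lemma cantor_net:
  assumes q: "0 \<le> q" "q \<le> 1/2"
  shows "\<exists>E. finite E \<and> card E \<le> 2 ^ n \<and> (\<forall>b. \<exists>e\<in>E. \<bar>cantor q b - e\<bar> \<le> q ^ n)"
proof -
  \<comment> \<open>The net consists of the points whose digits vanish from place \<open>n\<close> on.\<close>
  define h where "h S = (\<Sum>i\<in>S. q ^ i) / 2" for S :: "nat set"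
  have "\<bar>cantor q b - h {i. i < n \<and> b i}\<bar> \<le> q ^ n" for b
  proof -
    have "(\<Sum>i<n. of_bool (b i) * q ^ i) = (\<Sum>i | i < n \<and> b i. q ^ i)"
      by (intro sum.mono_neutral_cong_right) auto
    then have "cantor q b - h {i. i < n \<and> b i} = (\<Sum>i. of_bool (b (i + n)) * q ^ (i + n)) / 2"
      using suminf_split_initial_segment[OF cantor_summable[OF q, of b], of n]
      by (simp add: cantor_def h_def add_divide_distrib)
    moreover have "\<bar>\<Sum>i. of_bool (b (i + n)) * q ^ (i + n)\<bar> \<le> q ^ n / (1 - q)"
      by (rule cantor_tail(1)[OF q, of "\<lambda>i. of_bool (b i) * q ^ i"]) (use q in auto)
    moreover have "q ^ n / (1 - q) \<le> q ^ n / (1 / 2)" using q by (intro divide_left_mono) auto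
    ultimately show ?thesis by simp
  qed
  then have "\<forall>b. \<exists>e\<in>h ` Pow {..<n}. \<bar>cantor q b - e\<bar> \<le> q ^ n" by blast
  moreover have "card (h ` Pow {..<n}) \<le> 2 ^ n"
    using card_image_le[of "Pow {..<n}" h] by (simp add: card_Pow)
  ultimately show ?thesis by (intro exI[of _ "h ` Pow {..<n}"]) auto
qed

lemma powers_small:
  fixes r :: real
  assumes "0 \<le> r" "r < 1" "\<eta> > 0" "c \<ge> 0"
  shows "\<exists>n. c * r ^ n \<le> \<eta>"
proof -
  have "\<eta> / (c + 1) > 0" using assms by simp
  then obtain n where n: "r ^ n < \<eta> / (c + 1)" using real_arch_pow_inv[of _ r] assms by blast
  have "c * r ^ n \<le> (c + 1) * r ^ n" using assms by (intro mult_right_mono) auto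
  also have "\<dots> \<le> \<eta>" using n assms by (simp add: field_simps)
  finally show ?thesis ..
qed

text \<open>The Hoelder bound confines the image of a piece of diameter \<open>D\<close> to an interval of length
  \<open>2 K D\<^sup>\<sigma>\<close>.\<close>

lemma cantor_not_null:
  assumes \<sigma>: "0 < \<sigma>" "\<sigma> \<le> 1"
  shows "\<not> null_dim \<sigma> (range (cantor (ratio \<sigma>)))"
proof -
  obtain K where K: "K \<ge> 0"
    "\<And>b b'. \<bar>cantor (1/2) b - cantor (1/2) b'\<bar> \<le> K * \<bar>cantor (ratio \<sigma>) b - cantor (ratio \<sigma>) b'\<bar> powr \<sigma>"
    by (rule cantor_holder[OF \<sigma>]) (rule that)
  show ?thesis
  proof (rule mass_distribution[where K = "2 * K" and f = "cantor (1/2)" and Z = "{0..<1}"])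
    fix T assume T: "bounded (cantor (ratio \<sigma>) ` T)"
    define D where "D = diameter (cantor (ratio \<sigma>) ` T)"
    have D: "D \<ge> 0" unfolding D_def by (rule diameter_ge_0[OF T])
    show "\<exists>B\<in>sets lborel. cantor (1/2) ` T \<subseteq> B \<and> emeasure lborel B \<le> ennreal (2 * K * diameter (cantor (ratio \<sigma>) ` T) powr \<sigma>)"
    proof (cases "T = {}")
      case False
      then obtain b where b: "b \<in> T" by blast
      define R where "R = K * D powr \<sigma>"
      have R: "R \<ge> 0" using K by (simp add: R_def)
      have "\<bar>cantor (1/2) b' - cantor (1/2) b\<bar> \<le> R" if "b' \<in> T" for b'
      proof -
        have "\<bar>cantor (ratio \<sigma>) b' - cantor (ratio \<sigma>) b\<bar> \<le> D"
          using diameter_bounded_bound[OF T imageI[OF that] imageI[OF b]] by (simp add: D_def dist_real_def)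
        then have "K * \<bar>cantor (ratio \<sigma>) b' - cantor (ratio \<sigma>) b\<bar> powr \<sigma> \<le> R"
          unfolding R_def using K \<sigma> by (intro mult_left_mono powr_mono2) auto
        then show ?thesis using K(2)[of b' b] by linarith
      qed
      then have "cantor (1/2) ` T \<subseteq> {cantor (1/2) b - R..cantor (1/2) b + R}" by (auto simp: abs_le_iff) (smt (verit))+
      moreover have "emeasure lborel {cantor (1/2) b - R..cantor (1/2) b + R} = ennreal (2 * K * D powr \<sigma>)"
        using R by (simp add: R_def)
      ultimately show ?thesis unfolding D_def[symmetric] by (intro bexI[of _ "{cantor (1/2) b - R..cantor (1/2) b + R}"]) auto
    qed (auto intro!: bexI[of _ "{}"])
  next
    show "{0..<1} \<subseteq> range (cantor (1/2))" using cantor_half_onto by fast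
  qed (use K \<sigma> in auto)
qed

lemma cantor_square_not_null:
  assumes \<sigma>: "0 < \<sigma>" "\<sigma> \<le> 1"
  shows "\<not> null_dim (2 * \<sigma>) (range (cantor (ratio \<sigma>)) \<times> range (cantor (ratio \<sigma>)))"
proof -
  obtain K where K: "K \<ge> 0"
    "\<And>b b'. \<bar>cantor (1/2) b - cantor (1/2) b'\<bar> \<le> K * \<bar>cantor (ratio \<sigma>) b - cantor (ratio \<sigma>) b'\<bar> powr \<sigma>"
    by (rule cantor_holder[OF \<sigma>]) (rule that)
  define g where "g = map_prod (cantor (ratio \<sigma>)) (cantor (ratio \<sigma>))"
  define f where "f = map_prod (cantor (1/2)) (cantor (1/2))"
  have "\<not> null_dim (2 * \<sigma>) (g ` UNIV)"
  proof (rule mass_distribution[where K = "4 * K\<^sup>2" and f = f and Z = "{0..<1} \<times> {0..<1}"])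
    fix T assume T: "bounded (g ` T)"
    define D where "D = diameter (g ` T)"
    have D: "D \<ge> 0" unfolding D_def by (rule diameter_ge_0[OF T])
    show "\<exists>B\<in>sets lborel. f ` T \<subseteq> B \<and> emeasure lborel B \<le> ennreal (4 * K\<^sup>2 * diameter (g ` T) powr (2 * \<sigma>))"
    proof (cases "T = {}")
      case False
      then obtain t where t: "t \<in> T" by blast
      define R where "R = K * D powr \<sigma>"
      have R: "R \<ge> 0" using K by (simp add: R_def)
      define I where "I c = {cantor (1/2) c - R..cantor (1/2) c + R}" for c
      have "f t' \<in> I (fst t) \<times> I (snd t)" if t': "t' \<in> T" for t'
      proof -
        have dist: "dist (g t') (g t) \<le> D"
          unfolding D_def by (rule diameter_bounded_bound[OF T imageI[OF t'] imageI[OF t]])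
        have "\<bar>cantor (ratio \<sigma>) (fst t') - cantor (ratio \<sigma>) (fst t)\<bar> \<le> D"
          "\<bar>cantor (ratio \<sigma>) (snd t') - cantor (ratio \<sigma>) (snd t)\<bar> \<le> D"
          using dist dist_fst_le[of "g t'" "g t"] dist_snd_le[of "g t'" "g t"] by (auto simp: g_def dist_real_def)
        then have "K * \<bar>cantor (ratio \<sigma>) (fst t') - cantor (ratio \<sigma>) (fst t)\<bar> powr \<sigma> \<le> R"
          "K * \<bar>cantor (ratio \<sigma>) (snd t') - cantor (ratio \<sigma>) (snd t)\<bar> powr \<sigma> \<le> R"
          unfolding R_def using K \<sigma> by (auto intro!: mult_left_mono powr_mono2)
        then have "\<bar>cantor (1/2) (fst t') - cantor (1/2) (fst t)\<bar> \<le> R" "\<bar>cantor (1/2) (snd t') - cantor (1/2) (snd t)\<bar> \<le> R"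
          using K(2) order_trans by blast+
        then show ?thesis by (auto simp: f_def I_def map_prod_def split_def abs_le_iff)
      qed
      then have "f ` T \<subseteq> I (fst t) \<times> I (snd t)" by blast
      moreover have "I (fst t) \<times> I (snd t) \<in> sets lborel"
        by (simp add: I_def closed_Times borel_closed)
      moreover have "emeasure lborel (I (fst t) \<times> I (snd t)) = ennreal (4 * K\<^sup>2 * D powr (2 * \<sigma>))"
      proof -
        have "emeasure (lborel \<Otimes>\<^sub>M lborel) (I (fst t) \<times> I (snd t)) = emeasure lborel (I (fst t)) * emeasure lborel (I (snd t))"
          by (rule lborel.emeasure_pair_measure_Times) (simp_all add: I_def)
        also have "\<dots> = ennreal (2 * R) * ennreal (2 * R)" using R by (simp add: I_def)
        also have "\<dots> = ennreal (4 * K\<^sup>2 * D powr (2 * \<sigma>))"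
          using R K by (simp add: R_def ennreal_mult'[symmetric] power2_eq_square algebra_simps powr_add flip: powr_add)
        finally show ?thesis by (simp add: lborel_prod)
      qed
      ultimately show ?thesis unfolding D_def[symmetric] by (intro bexI[of _ "I (fst t) \<times> I (snd t)"]) auto
    qed (auto intro!: bexI[of _ "{}"])
  next
    show "emeasure lborel ({0..<1::real} \<times> {0..<1::real}) = 1"
      using lborel.emeasure_pair_measure_Times[of "{0..<1::real}" lborel "{0..<1::real}"] by (simp add: lborel_prod)
    have "{0..<1::real} \<times> {0..<1::real} \<in> sets (borel \<Otimes>\<^sub>M borel)" by (intro pair_measureI) auto
    then show "{0..<1::real} \<times> {0..<1::real} \<in> sets lborel" unfolding borel_prod sets_lborel .
    show "{0..<1} \<times> {0..<1} \<subseteq> f ` UNIV"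
    proof
      fix z :: "real \<times> real" assume "z \<in> {0..<1} \<times> {0..<1}"
      then have "fst z \<in> {0..<1}" "snd z \<in> {0..<1}" by (simp_all add: mem_Times_iff)
      then obtain b b' where "cantor (1/2) b = fst z" "cantor (1/2) b' = snd z" using cantor_half_onto by meson
      then have "z = f (b, b')" by (simp add: f_def)
      then show "z \<in> f ` UNIV" by blast
    qed
  qed (use K \<sigma> in auto)
  moreover have "g ` UNIV = range (cantor (ratio \<sigma>)) \<times> range (cantor (ratio \<sigma>))"
    by (auto simp: g_def image_def)
  ultimately show ?thesis by simp
qed

text \<open>The Cantor set has a net of \<open>2 ^ n\<close> points at scale \<open>ratio \<sigma> ^ n\<close>. With at most \<open>c * R ^ n\<close> points for \<open>Y\<close>,
  the boxes of this scale cost a constant times \<open>(2 R 2\<^bsup>-s/\<sigma>\<^esup>)\<^sup>n\<close>.\<close>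

lemma cantor_times_null:
  assumes \<sigma>: "0 < \<sigma>" "\<sigma> \<le> 1" and s: "s > 0" and c: "c \<ge> 0"
    and R: "0 \<le> R" "2 * R * 2 powr (- s / \<sigma>) < 1"
    and Y: "\<And>n. \<exists>E. finite E \<and> real (card E) \<le> c * R ^ n \<and> (\<forall>y\<in>Y. \<exists>e\<in>E. \<bar>y - e\<bar> \<le> ratio \<sigma> ^ n)"
  shows "null_dim s (range (cantor (ratio \<sigma>)) \<times> Y)"
proof (rule null_dim_box_covers[OF s])
  define q where "q = ratio \<sigma>"
  have q: "0 < q" "q \<le> 1/2" using ratio_bounds[OF \<sigma>] by (auto simp: q_def)
  fix \<eta> :: real assume \<eta>: "\<eta> > 0"
  define r where "r = 2 * R * 2 powr (- s / \<sigma>)"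
  have r: "0 \<le> r" "r < 1" using R by (simp_all add: r_def)
  obtain n where n: "c * 4 powr s * r ^ n \<le> \<eta>" using powers_small[OF r \<eta>, of "c * 4 powr s"] c by auto
  obtain E where E: "finite E" "card E \<le> 2 ^ n" "\<forall>b. \<exists>e\<in>E. \<bar>cantor q b - e\<bar> \<le> q ^ n"
    using cantor_net[of q n] q by auto
  obtain E' where E': "finite E'" "real (card E') \<le> c * R ^ n" "\<forall>y\<in>Y. \<exists>e\<in>E'. \<bar>y - e\<bar> \<le> q ^ n"
    using Y[of n] unfolding q_def by blast
  have "real (card (E \<times> E')) * (4 * q ^ n) powr s \<le> (2 ^ n * (c * R ^ n)) * (4 * q ^ n) powr s"
  proof (rule mult_right_mono)
    have "real (card E) \<le> 2 ^ n" using E(2) by (metis of_nat_le_iff of_nat_numeral of_nat_power)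
    then show "real (card (E \<times> E')) \<le> 2 ^ n * (c * R ^ n)"
      unfolding card_cartesian_product of_nat_mult using E'(2) by (intro mult_mono) auto
  qed simp
  also have "\<dots> = c * 4 powr s * r ^ n"
    using q ratio_powr[of \<sigma> n s] \<sigma> by (simp add: powr_mult r_def q_def power_mult_distrib)
  finally have small: "real (card (E \<times> E')) * (4 * q ^ n) powr s \<le> \<eta>" using n by linarith
  have "\<forall>p\<in>range (cantor q) \<times> Y. \<exists>e\<in>E \<times> E'. \<bar>fst p - fst e\<bar> \<le> q ^ n \<and> \<bar>snd p - snd e\<bar> \<le> q ^ n"
  proof
    fix p assume "p \<in> range (cantor q) \<times> Y"
    then obtain b y where p: "p = (cantor q b, y)" "y \<in> Y" by blast
    obtain e e' where "e \<in> E" "e' \<in> E'" "\<bar>cantor q b - e\<bar> \<le> q ^ n" "\<bar>y - e'\<bar> \<le> q ^ n"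
      using E(3) E'(3) p(2) by meson
    then show "\<exists>e\<in>E \<times> E'. \<bar>fst p - fst e\<bar> \<le> q ^ n \<and> \<bar>snd p - snd e\<bar> \<le> q ^ n"
      by (intro bexI[of _ "(e, e')"]) (auto simp: p(1))
  qed
  then show "\<exists>E r. finite E \<and> r \<ge> 0 \<and> (\<forall>p\<in>range (cantor (ratio \<sigma>)) \<times> Y.
      \<exists>e\<in>E. \<bar>fst p - fst e\<bar> \<le> r \<and> \<bar>snd p - snd e\<bar> \<le> r) \<and> real (card E) * (4 * r) powr s \<le> \<eta>"
    unfolding q_def[symmetric] using E(1) E'(1) q small
    by (intro exI[of _ "E \<times> E'"] exI[of _ "q ^ n"]) auto
qed

lemma cantor_square_null:
  assumes \<sigma>: "0 < \<sigma>" "\<sigma> \<le> 1" and s: "s > 2 * \<sigma>"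
  shows "null_dim s (range (cantor (ratio \<sigma>)) \<times> range (cantor (ratio \<sigma>)))"
proof (rule cantor_times_null[OF \<sigma>, where c = 1 and R = 2])
  have "2 powr (- s / \<sigma>) < 2 powr (- 2)" using s \<sigma> by (intro powr_less_mono) (auto simp: field_simps)
  then show "2 * 2 * 2 powr (- s / \<sigma>) < 1" by (simp add: powr_minus_divide)
  fix n
  obtain E where E: "finite E" "card E \<le> 2 ^ n" "\<forall>b. \<exists>e\<in>E. \<bar>cantor (ratio \<sigma>) b - e\<bar> \<le> ratio \<sigma> ^ n"
    using cantor_net[of "ratio \<sigma>" n] ratio_bounds[OF \<sigma>] by auto
  have "real (card E) \<le> 2 ^ n" using E(2) by (metis of_nat_le_iff of_nat_numeral of_nat_power)
  then have "real (card E) \<le> 1 * 2 ^ n" by simp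
  then show "\<exists>E. finite E \<and> real (card E) \<le> 1 * 2 ^ n \<and> (\<forall>y\<in>range (cantor (ratio \<sigma>)). \<exists>e\<in>E. \<bar>y - e\<bar> \<le> ratio \<sigma> ^ n)"
    using E by blast
qed (use s \<sigma> in auto)

lemma unit_interval_net:
  fixes \<rho> :: real
  assumes \<rho>: "0 < \<rho>" "\<rho> \<le> 1"
  shows "\<exists>E. finite E \<and> real (card E) \<le> 2 / \<rho> \<and> (\<forall>y\<in>{0..1}. \<exists>e\<in>E. \<bar>y - e\<bar> \<le> \<rho>)"
proof -
  define N where "N = nat \<lfloor>1 / \<rho>\<rfloor>"
  define Y where "Y = (\<lambda>j. real j * \<rho>) ` {..N}"
  have "\<exists>e\<in>Y. \<bar>y - e\<bar> \<le> \<rho>" if y: "y \<in> {0..1}" for y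
  proof -
    define j where "j = nat \<lfloor>y / \<rho>\<rfloor>"
    have "y / \<rho> \<le> 1 / \<rho>" using y \<rho> by (intro divide_right_mono) auto
    then have "j \<le> N" unfolding j_def N_def by (intro nat_mono floor_mono)
    then have "real j * \<rho> \<in> Y" by (auto simp: Y_def)
    moreover have "0 \<le> \<lfloor>y / \<rho>\<rfloor>" using y \<rho> by simp
    then have "real j = real_of_int \<lfloor>y / \<rho>\<rfloor>" by (simp add: j_def)
    then have "real j \<le> y / \<rho>" "y / \<rho> \<le> real j + 1" by linarith+
    then have "\<bar>y - real j * \<rho>\<bar> \<le> \<rho>" using \<rho> by (simp add: field_simps abs_le_iff)
    ultimately show ?thesis by blast
  qed
  moreover have "real (card Y) \<le> 2 / \<rho>"
  proof -
    have "real (card Y) \<le> real (N + 1)" unfolding Y_def using card_image_le[of "{..N}" "\<lambda>j. real j * \<rho>"] by simp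
    also have "\<dots> \<le> 1 / \<rho> + 1"
    proof -
      have "0 \<le> \<lfloor>1 / \<rho>\<rfloor>" using \<rho> by simp
      then have "real N = real_of_int \<lfloor>1 / \<rho>\<rfloor>" by (simp add: N_def)
      then have "real N \<le> 1 / \<rho>" by linarith
      then show ?thesis by simp
    qed
    also have "\<dots> \<le> 2 / \<rho>" using \<rho> by (simp add: field_simps)
    finally show ?thesis .
  qed
  ultimately show ?thesis by (intro exI[of _ Y]) (auto simp: Y_def)
qed

lemma cantor_strip_null:
  assumes \<sigma>: "0 < \<sigma>" "\<sigma> \<le> 1" and s: "s > \<sigma> + 1"
  shows "null_dim s (range (cantor (ratio \<sigma>)) \<times> {0..1::real})"
proof (rule cantor_times_null[OF \<sigma>, where c = 2 and R = "1 / ratio \<sigma>"])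
  note q = ratio_bounds[OF \<sigma>]
  have "1 / ratio \<sigma> = 2 powr (1 / \<sigma>)"
    using powr_minus_divide[of 2 "1 / \<sigma>"] by (simp add: ratio_def)
  then have "2 * (1 / ratio \<sigma>) * 2 powr (- s / \<sigma>) = 2 powr (1 + 1 / \<sigma> + - s / \<sigma>)"
    by (simp only: powr_add) simp
  also have "1 + 1 / \<sigma> + - s / \<sigma> = (\<sigma> + 1 - s) / \<sigma>" using \<sigma> by (simp add: field_simps)
  also have "2 powr ((\<sigma> + 1 - s) / \<sigma>) < 2 powr 0" using s \<sigma> by (intro powr_less_mono divide_neg_pos) auto
  finally show "2 * (1 / ratio \<sigma>) * 2 powr (- s / \<sigma>) < 1" by simp
  show "\<exists>E. finite E \<and> real (card E) \<le> 2 * (1 / ratio \<sigma>) ^ n \<and> (\<forall>y\<in>{0..1::real}. \<exists>e\<in>E. \<bar>y - e\<bar> \<le> ratio \<sigma> ^ n)" for n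
    using unit_interval_net[of "ratio \<sigma> ^ n"] q by (auto simp: power_one_over power_le_one)
qed (use s \<sigma> ratio_bounds[OF \<sigma>] in auto)

text \<open>Slope and intercept can be recovered from the projection and the foot: the slope is the quotient of two
  matrix entries, the denominator of which is at least 1/2.\<close>

lemma dist_le_dist_graph_line:
  assumes fr: "frame a b" and m: "\<bar>fst l\<bar> \<le> 1" "\<bar>fst l'\<bar> \<le> 1" and k: "\<bar>snd l'\<bar> \<le> 1"
  shows "dist l l' \<le> 12 * dist (graph_line a b l) (graph_line a b l')"
proof -
  define h where "h l = cos_sq (fst l)" for l :: "real \<times> real"
  define g where "g l = sin_cos (fst l)" for l :: "real \<times> real"
  define \<delta> where "\<delta> = dist (graph_line a b l) (graph_line a b l')"
  note bl = bounded_linear_sub[OF bounded_linear_line_proj bounded_linear_line_proj]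
  have na: "norm a = 1" by (simp add: norm_eq_sqrt_inner frame_simps[OF fr])
  have on: "norm (line_proj (graph_line a b l) a - line_proj (graph_line a b l') a) \<le> \<delta>"
  proof -
    have "norm (line_proj (graph_line a b l) a - line_proj (graph_line a b l') a)
       \<le> onorm (\<lambda>x. line_proj (graph_line a b l) x - line_proj (graph_line a b l') x) * norm a"
      by (rule onorm[OF bl])
    also have "\<dots> \<le> \<delta>" by (simp add: na \<delta>_def dist_line_def)
    finally show ?thesis .
  qed
  have ft: "norm (foot (graph_line a b l) - foot (graph_line a b l')) \<le> \<delta>"
    unfolding \<delta>_def dist_line_def using onorm_pos_le[OF bl] by simp
  have pa: "a \<bullet> line_proj (graph_line a b l) a = h l" "b \<bullet> line_proj (graph_line a b l) a = g l" for l
    by (simp_all add: line_proj_graph_line[OF fr] h_def g_def inner_add_right frame_simps[OF fr])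
  have pf: "b \<bullet> foot (graph_line a b l) = snd l * h l" for l
    by (simp add: foot_graph_line[OF fr] h_def inner_add_right inner_diff_right frame_simps[OF fr])
  have dh: "\<bar>h l - h l'\<bar> \<le> \<delta>"
    using abs_inner_frame_le(1)[OF fr, of "line_proj (graph_line a b l) a - line_proj (graph_line a b l') a"] on
    by (simp add: inner_diff_right pa)
  have dg: "\<bar>g l - g l'\<bar> \<le> \<delta>"
    using abs_inner_frame_le(2)[OF fr, of "line_proj (graph_line a b l) a - line_proj (graph_line a b l') a"] on
    by (simp add: inner_diff_right pa)
  have dk: "\<bar>snd l * h l - snd l' * h l'\<bar> \<le> \<delta>"
    using abs_inner_frame_le(2)[OF fr, of "foot (graph_line a b l) - foot (graph_line a b l')"] ft
    by (simp add: inner_diff_right pf)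
  have hb: "1/2 \<le> h l \<and> h l \<le> 1" if "\<bar>fst l\<bar> \<le> 1" for l
  proof -
    have "(fst l)\<^sup>2 \<le> 1" using that by (simp add: abs_square_le_1)
    moreover have "1 + (fst l)\<^sup>2 > 0" by (simp add: add_pos_nonneg)
    ultimately show ?thesis by (simp add: h_def cos_sq_def le_divide_eq divide_le_eq)
  qed
  have gh: "g l = fst l * h l" for l by (simp add: g_def h_def slope_terms(5))
  have m1: "\<bar>fst l - fst l'\<bar> \<le> 4 * \<delta>"
  proof -
    have "(fst l - fst l') * h l = (g l - g l') - fst l' * (h l - h l')" by (simp add: gh algebra_simps)
    then have "\<bar>fst l - fst l'\<bar> * h l = \<bar>(g l - g l') - fst l' * (h l - h l')\<bar>"
      using hb[OF m(1)] by (metis abs_mult abs_of_nonneg order_trans[of 0 "1/2"] zero_le_divide_1_iff zero_le_numeral)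
    also have "\<dots> \<le> \<bar>g l - g l'\<bar> + \<bar>fst l' * (h l - h l')\<bar>" by (rule abs_triangle_ineq4)
    also have "\<dots> \<le> \<delta> + 1 * \<delta>" unfolding abs_mult using m dh dg by (intro add_mono mult_mono) auto
    finally have "\<bar>fst l - fst l'\<bar> * h l \<le> 2 * \<delta>" by simp
    moreover have "\<bar>fst l - fst l'\<bar> * (1/2) \<le> \<bar>fst l - fst l'\<bar> * h l" using hb[OF m(1)] by (intro mult_left_mono) auto
    ultimately have "\<bar>fst l - fst l'\<bar> * (1/2) \<le> 2 * \<delta>" by (rule order_trans[rotated])
    then show ?thesis by simp
  qed
  have k1: "\<bar>snd l - snd l'\<bar> \<le> 4 * \<delta>"
  proof -
    have "(snd l - snd l') * h l = (snd l * h l - snd l' * h l') - snd l' * (h l - h l')" by (simp add: algebra_simps)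
    then have "\<bar>snd l - snd l'\<bar> * h l = \<bar>(snd l * h l - snd l' * h l') - snd l' * (h l - h l')\<bar>"
      using hb[OF m(1)] by (metis abs_mult abs_of_nonneg order_trans[of 0 "1/2"] zero_le_divide_1_iff zero_le_numeral)
    also have "\<dots> \<le> \<bar>snd l * h l - snd l' * h l'\<bar> + \<bar>snd l' * (h l - h l')\<bar>" by (rule abs_triangle_ineq4)
    also have "\<dots> \<le> \<delta> + 1 * \<delta>" unfolding abs_mult[of "snd l'"] using k dh dk by (intro add_mono mult_mono) auto
    finally have "\<bar>snd l - snd l'\<bar> * h l \<le> 2 * \<delta>" by simp
    moreover have "\<bar>snd l - snd l'\<bar> * (1/2) \<le> \<bar>snd l - snd l'\<bar> * h l" using hb[OF m(1)] by (intro mult_left_mono) auto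
    ultimately have "\<bar>snd l - snd l'\<bar> * (1/2) \<le> 2 * \<delta>" by (rule order_trans[rotated])
    then show ?thesis by simp
  qed
  have "dist l l' \<le> \<bar>fst l - fst l'\<bar> + \<bar>snd l - snd l'\<bar>"
    using sqrt_sum_squares_le_sum_abs[of "fst l - fst l'" "snd l - snd l'"]
    by (simp add: dist_prod_def dist_real_def)
  moreover have "\<delta> \<ge> 0" by (simp add: \<delta>_def)
  ultimately show ?thesis using m1 k1 unfolding \<delta>_def[symmetric] by linarith
qed

text \<open>The strip set is \<open>C \<times> \<real>\<close> in the standard frame. Projecting to the first coordinate maps its intersection
  with each line of the family onto \<open>C\<close>.\<close>

theorem furstenberg_example:
  assumes uv: "1 \<le> v" "v \<le> 2" "0 < u" "u \<le> 1"
  shows "\<exists>A. furstenberg u v A \<and> hausdorff_dim A \<le> ereal (u + 1)"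
proof -
  define a b :: "real^2" where "a = axis 1 1" and "b = axis 2 1"
  have fr: "frame a b" unfolding a_def b_def by (rule frame_axes)
  define C where "C = range (cantor (ratio u))"
  define A where "A = {x. a \<bullet> x \<in> C}"
  define \<sigma> where "\<sigma> = v / 2"
  have \<sigma>: "0 < \<sigma>" "\<sigma> \<le> 1" "2 * \<sigma> = v" using uv by (auto simp: \<sigma>_def)
  define P where "P = range (cantor (ratio \<sigma>)) \<times> range (cantor (ratio \<sigma>))"
  define \<L> where "\<L> = graph_line a b ` P"
  have P1: "\<bar>fst p\<bar> \<le> 1" "\<bar>snd p\<bar> \<le> 1" if "p \<in> P" for p
    using that cantor_bounds[of "ratio \<sigma>"] ratio_bounds[OF \<sigma>(1,2)] by (auto simp: P_def abs_le_iff intro: order_trans[of _ 0])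
  have "hausdorff_dim \<L> \<le> ereal v"
  proof (rule hausdorff_dim_leI)
    fix s assume s: "s > v"
    have "null_dim s P" unfolding P_def by (rule cantor_square_null[OF \<sigma>(1,2)]) (use s \<sigma> in simp)
    then show "null_dim s \<L>" unfolding \<L>_def
      by (rule null_dim_lipschitz_image[where C = "10 + 4 * 1"])
        (use s uv P1 in \<open>auto intro!: dist_graph_line_le[OF fr, where K = 1, simplified]\<close>)
  qed (use uv in simp)
  moreover have "\<not> null_dim v \<L>"
  proof
    assume null: "null_dim v \<L>"
    define F where "F = inv_into P (graph_line a b)"
    have inj: "inj_on (graph_line a b) P"
    proof (rule inj_onI)
      fix p q assume "p \<in> P" "q \<in> P" "graph_line a b p = graph_line a b q"
      then show "p = q" using dist_le_dist_graph_line[OF fr, of p q] P1 by simp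
    qed
    have "null_dim v (F ` \<L>)"
    proof (rule null_dim_lipschitz_image[OF null, where C = 12])
      fix x y assume "x \<in> \<L>" "y \<in> \<L>"
      then obtain p q where pq: "p \<in> P" "q \<in> P" "x = graph_line a b p" "y = graph_line a b q" unfolding \<L>_def by blast
      then have "F x = p" "F y = q" using inj by (simp_all add: F_def inv_into_f_f)
      then show "dist (F x) (F y) \<le> 12 * dist x y"
        using dist_le_dist_graph_line[OF fr, of p q] P1 pq by simp
    qed (use uv in auto)
    moreover have "F ` \<L> = P" unfolding F_def \<L>_def by (rule inv_into_image_cancel[OF inj]) simp
    ultimately show False using cantor_square_not_null[OF \<sigma>(1,2)] \<sigma>(3) by (simp add: P_def)
  qed
  then have "hausdorff_dim \<L> \<ge> ereal v" by (rule hausdorff_dim_ge_if_not_null)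
  ultimately have dimL: "hausdorff_dim \<L> = ereal v" by (rule antisym)
  have "hausdorff_dim (A \<inter> points_of l) \<ge> ereal u" if l: "l \<in> \<L>" for l
  proof (rule hausdorff_dim_ge_if_not_null, rule notI)
    assume null: "null_dim u (A \<inter> points_of l)"
    obtain p where p: "l = graph_line a b p" using l unfolding \<L>_def by blast
    have "null_dim u ((\<lambda>x. a \<bullet> x) ` (A \<inter> points_of l))"
    proof (rule null_dim_lipschitz_image[OF null uv(3), of 1])
      show "dist (a \<bullet> x) (a \<bullet> y) \<le> 1 * dist x y" for x y
        using abs_inner_frame_le(1)[OF fr, of "x - y"] by (simp add: dist_real_def dist_norm inner_diff_right)
    qed simp
    moreover have "C \<subseteq> (\<lambda>x. a \<bullet> x) ` (A \<inter> points_of l)"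
    proof
      fix c assume c: "c \<in> C"
      define x where "x = c *\<^sub>R a + (fst p * c + snd p) *\<^sub>R b"
      have "a \<bullet> x = c" "b \<bullet> x = fst p * c + snd p" by (simp_all add: x_def inner_add_right frame_simps[OF fr])
      then show "c \<in> (\<lambda>x. a \<bullet> x) ` (A \<inter> points_of l)"
        using c by (intro image_eqI[of _ _ x]) (auto simp: A_def p points_of_graph_line[OF fr])
    qed
    ultimately have "null_dim u C" by (rule null_dim_subset)
    then show False using cantor_not_null[OF uv(3,4)] by (simp add: C_def)
  qed
  then have "furstenberg u v A" unfolding furstenberg_def using dimL by blast
  moreover have "hausdorff_dim A \<le> ereal (u + 1)"
  proof (rule hausdorff_dim_leI)
    fix s assume s: "s > u + 1"
    define pt where "pt i p = fst p *\<^sub>R a + (snd p + real_of_int i) *\<^sub>R b" for i p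
    have "null_dim s (pt i ` (C \<times> {0..1}))" for i
    proof (rule null_dim_lipschitz_image[where C = 2])
      show "null_dim s (C \<times> {0..1::real})" unfolding C_def by (rule cantor_strip_null[OF uv(3,4) s])
      fix p q :: "real \<times> real"
      have "pt i p - pt i q = (fst p - fst q) *\<^sub>R a + (snd p - snd q) *\<^sub>R b" by (simp add: pt_def algebra_simps)
      then have "dist (pt i p) (pt i q) \<le> \<bar>fst p - fst q\<bar> + \<bar>snd p - snd q\<bar>"
        using norm_frame_le[OF fr, of "fst p - fst q" "snd p - snd q"] by (simp add: dist_norm)
      then show "dist (pt i p) (pt i q) \<le> 2 * dist p q"
        using dist_fst_le[of p q] dist_snd_le[of p q] by (simp add: dist_real_def)
    qed (use s uv in auto)
    then have "null_dim s (\<Union>i. pt i ` (C \<times> {0..1}))" by (rule null_dim_UN)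
    moreover have "A \<subseteq> (\<Union>i. pt i ` (C \<times> {0..1}))"
    proof
      fix x assume x: "x \<in> A"
      define i where "i = \<lfloor>b \<bullet> x\<rfloor>"
      have "b \<bullet> x - real_of_int i \<in> {0..1}" unfolding i_def by simp linarith
      then have "(a \<bullet> x, b \<bullet> x - real_of_int i) \<in> C \<times> {0..1}" using x by (simp add: A_def)
      moreover have "x = pt i (a \<bullet> x, b \<bullet> x - real_of_int i)" using frame_expand[OF fr, of x] by (simp add: pt_def)
      ultimately show "x \<in> (\<Union>i. pt i ` (C \<times> {0..1}))" by blast
    qed
    ultimately show "null_dim s A" by (rule null_dim_subset)
  qed (use uv in simp)
  ultimately show ?thesis by blast
qed

theorem theorem1p6:
  fixes u v :: real
  assumes "1 \<le> v" "v \<le> 2" "0 < u" "u \<le> 1"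
  shows "(\<forall>A. furstenberg u v A \<longrightarrow>
            hausdorff_dim A \<ge> ereal (min (2 * u + v - 1) (u + 1))) \<and>
         (u + v \<ge> 2 \<longrightarrow>
            Inf {hausdorff_dim A | A. furstenberg u v A} = ereal (min (2 * u + v - 1) (u + 1)) \<and>
            min (2 * u + v - 1) (u + 1) = u + 1)"
proof (intro conjI allI impI)
  show "hausdorff_dim A \<ge> ereal (min (2 * u + v - 1) (u + 1))" if "furstenberg u v A" for A
    by (rule furstenberg_lower_bound[OF assms that])
  assume uv: "u + v \<ge> 2"
  then show min_eq: "min (2 * u + v - 1) (u + 1) = u + 1" by simp
  obtain A where A: "furstenberg u v A" "hausdorff_dim A \<le> ereal (u + 1)"
    using furstenberg_example[OF assms] by blast
  show "Inf {hausdorff_dim A | A. furstenberg u v A} = ereal (min (2 * u + v - 1) (u + 1))"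
  proof (rule antisym)
    show "Inf {hausdorff_dim A | A. furstenberg u v A} \<le> ereal (min (2 * u + v - 1) (u + 1))"
      unfolding min_eq by (rule Inf_lower2[OF _ A(2)]) (use A(1) in blast)
    show "ereal (min (2 * u + v - 1) (u + 1)) \<le> Inf {hausdorff_dim A | A. furstenberg u v A}"
      by (rule Inf_greatest) (use furstenberg_lower_bound[OF assms] in blast)
  qed
qed

end
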